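(* Let $\Omega\subset\mathbb{C}^n$ be a bounded domain and let $S\subset\mathbb{C}^n$ be a complex affine hyperplane such that $\Omega\cap S\neq\varnothing$. For a bounded domain $G$ let $d_G$ denote the Bergman distance on $G$ (respectively, the Carath\'eodory distance on $G$). Then $(\Omega,d_\Omega)$ is Gromov hyperbolic if and only if $(\Omega\setminus S,d_{\Omega\setminus S})$ is Gromov hyperbolic.
   Context: A domain is a non-empty connected open set. For a bounded domain $G\subset\mathbb{C}^n$: - The Carath\'eodory distance is $c_G(z,w)=\sup\{\rho(f(z),f(w)): f:G\to\mathbb{D}\text{ holomorphic}\}$, where $\rho$ is the Poincar\'e distance $\rho(a,b)=\tanh^{-1}\left|\frac{a-b}{1-\bar a b}\right|$ on the unit disc $\mathbb{D}\subset\mathbb{C}$. - The Bergman distance is $b_G(z,w)=\inf_\alpha\int_0^1\beta_G(\alpha(t);\alpha'(t))\,dt$, the infimum over piecewise $\mathcal{C}^1$ curves $\alpha:[0,1]\to G$ from $z$ to $w$. Here $\beta_G(z;X)=\Big(\sum_{j,k}\frac{\partial^2\log K_G(z,z)}{\partial z_j\partial\bar z_k}X_j\overline{X_k}\Big)^{1/2}$ and $K_G$ is the Bergman kernel, i.e. the reproducing kernel of the space of square-integrable holomorphic functions on $G$. A metric space $(X,d)$ is Gromov hyperbolic if there is $\delta\ge0$ such that $(x|y)_o\ge\min\{(x|z)_o,(z|y)_o\}-\delta$ for all $x,y,z,o\in X$, where $(x|y)_o=\frac12\big(d(x,o)+d(y,o)-d(x,y)\big)$. For geodesic metric spaces this is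 equivalent to the existence of $M>0$ such that, in every geodesic triangle, each side lies in the $M$-neighbourhood of the union of the other two. *)

theory Defs
  imports "HOL-Analysis.Analysis"
begin

definition domain_in_Cn :: "(complex^'n) set \<Rightarrow> bool" where
  "domain_in_Cn G \<longleftrightarrow> G \<noteq> {} \<and> connected G \<and> open G"

definition complex_hyperplane :: "(complex^'n) set \<Rightarrow> bool" where
  "complex_hyperplane S \<longleftrightarrow>
     (\<exists>(a :: complex^'n) (b :: complex). a \<noteq> 0 \<and> S = {z. (\<Sum>i\<in>UNIV. a $ i * z $ i) = b})"

(* The library's holomorphic_on covers one complex variable only. *)
definition holomorphic_Cn :: "(complex^'n \<Rightarrow> complex) \<Rightarrow> (complex^'n) set \<Rightarrow> bool" where
  "holomorphic_Cn f G \<longleftrightarrow>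
     (\<forall>z\<in>G. \<exists>L. (f has_derivative L) (at z within G) \<and> (\<forall>c v. L (c *s v) = c * L v))"

definition poincare_dist :: "complex \<Rightarrow> complex \<Rightarrow> real" where
  "poincare_dist a b = artanh (cmod ((a - b) / (1 - cnj a * b)))"

definition caratheodory_dist :: "(complex^'n) set \<Rightarrow> complex^'n \<Rightarrow> complex^'n \<Rightarrow> real" where
  "caratheodory_dist G z w =
     (SUP f \<in> {f. holomorphic_Cn f G \<and> f ` G \<subseteq> ball 0 1}. poincare_dist (f z) (f w))"

(* Elements are total functions; their values outside G are irrelevant. *)
definition bergman_space :: "(complex^'n) set \<Rightarrow> (complex^'n \<Rightarrow> complex) set" where
  "bergman_space G =
     {f. holomorphic_Cn f G \<and> set_integrable lborel G (\<lambda>z. (cmod (f z))\<^sup>2)}"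

(* The reproducing property determines the kernel on G \<times> G only; it is set to 0 elsewhere so
   that the definite description denotes. *)
definition bergman_kernel :: "(complex^'n) set \<Rightarrow> complex^'n \<Rightarrow> complex^'n \<Rightarrow> complex" where
  "bergman_kernel G = (THE K.
     (\<forall>w\<in>G. (\<lambda>z. K z w) \<in> bergman_space G \<and>
        (\<forall>f\<in>bergman_space G. f w = (LINT z:G|lborel. f z * cnj (K z w)))) \<and>
     (\<forall>z w. z \<notin> G \<or> w \<notin> G \<longrightarrow> K z w = 0))"

definition partial_x :: "'n \<Rightarrow> (complex^'n \<Rightarrow> complex) \<Rightarrow> complex^'n \<Rightarrow> complex" where
  "partial_x j u z = vector_derivative (\<lambda>t. u (z + axis j (complex_of_real t))) (at 0)"

definition partial_y :: "'n \<Rightarrow> (complex^'n \<Rightarrow> complex) \<Rightarrow> complex^'n \<Rightarrow> complex" where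
  "partial_y j u z = vector_derivative (\<lambda>t. u (z + axis j (\<i> * complex_of_real t))) (at 0)"

definition wirtinger :: "'n \<Rightarrow> (complex^'n \<Rightarrow> complex) \<Rightarrow> complex^'n \<Rightarrow> complex" where
  "wirtinger j u z = (partial_x j u z - \<i> * partial_y j u z) / 2"

definition wirtinger_bar :: "'n \<Rightarrow> (complex^'n \<Rightarrow> complex) \<Rightarrow> complex^'n \<Rightarrow> complex" where
  "wirtinger_bar j u z = (partial_x j u z + \<i> * partial_y j u z) / 2"

definition log_bergman :: "(complex^'n) set \<Rightarrow> complex^'n \<Rightarrow> complex" where
  "log_bergman G z = complex_of_real (ln (Re (bergman_kernel G z z)))"

(* Re is a coercion: for bounded domains the kernel on the diagonal and the Levi form of its
   logarithm are real. *)
definition bergman_metric :: "(complex^'n) set \<Rightarrow> complex^'n \<Rightarrow> complex^'n \<Rightarrow> real" where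
  "bergman_metric G z X =
     sqrt (Re (\<Sum>j\<in>UNIV. \<Sum>k\<in>UNIV.
       wirtinger j (wirtinger_bar k (log_bergman G)) z * X $ j * cnj (X $ k)))"

(* Unlike the library's valid_path, this requires the derivative to extend continuously to the
   closed pieces; otherwise curves of infinite length, whose integral defaults to 0, would enter
   the infimum below. *)
definition piecewise_C1_curve :: "(real \<Rightarrow> 'a::real_normed_vector) \<Rightarrow> bool" where
  "piecewise_C1_curve \<alpha> \<longleftrightarrow> path \<alpha> \<and>
     (\<exists>(m::nat) p. p 0 = 0 \<and> p m = 1 \<and> (\<forall>i<m. p i < p (Suc i)) \<and>
        (\<forall>i<m. \<exists>\<alpha>'. continuous_on {p i..p (Suc i)} \<alpha>' \<and>
           (\<forall>t\<in>{p i..p (Suc i)}.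
              (\<alpha> has_vector_derivative \<alpha>' t) (at t within {p i..p (Suc i)}))))"

definition bergman_length :: "(complex^'n) set \<Rightarrow> (real \<Rightarrow> complex^'n) \<Rightarrow> real" where
  "bergman_length G \<alpha> =
     integral {0..1} (\<lambda>t. bergman_metric G (\<alpha> t) (vector_derivative \<alpha> (at t within {0..1})))"

definition bergman_dist :: "(complex^'n) set \<Rightarrow> complex^'n \<Rightarrow> complex^'n \<Rightarrow> real" where
  "bergman_dist G z w =
     (INF \<alpha> \<in> {\<alpha>. piecewise_C1_curve \<alpha> \<and> path_image \<alpha> \<subseteq> G \<and>
                   pathstart \<alpha> = z \<and> pathfinish \<alpha> = w}. bergman_length G \<alpha>)"

definition gromov_product :: "('a \<Rightarrow> 'a \<Rightarrow> real) \<Rightarrow> 'a \<Rightarrow> 'a \<Rightarrow> 'a \<Rightarrow> real" where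
  "gromov_product d p x y = (d x p + d y p - d x y) / 2"

definition gromov_hyperbolic :: "'a set \<Rightarrow> ('a \<Rightarrow> 'a \<Rightarrow> real) \<Rightarrow> bool" where
  "gromov_hyperbolic X d \<longleftrightarrow>
     (\<exists>\<delta>\<ge>0. \<forall>x\<in>X. \<forall>y\<in>X. \<forall>z\<in>X. \<forall>p\<in>X.
        gromov_product d p x y \<ge> min (gromov_product d p x z) (gromov_product d p z y) - \<delta>)"

end

theory Submission
  imports Defs "HOL-Complex_Analysis.Conformal_Mappings"
begin

text \<open>Bounded and square-integrable holomorphic functions on \<open>\<Omega> - S\<close> extend across \<open>S\<close>, so \<open>\<Omega>\<close> and
  \<open>\<Omega> - S\<close> have the same Caratheodory distance, Bergman kernel and Bergman metric off \<open>S\<close>.  As \<open>S\<close> has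
  real codimension two, every curve in \<open>\<Omega>\<close> with end points off \<open>S\<close> can be pushed off \<open>S\<close> by an
  arbitrarily small perturbation, so the Bergman distances agree as well.  The complement of \<open>S\<close> is
  dense in \<open>\<Omega>\<close>, and the four-point condition extends from a subset to all points within
  bounded distance of it.\<close>

section \<open>Holomorphic functions of several variables\<close>

text \<open>Holomorphy is given only as a complex linear differential at each point, so the analysis
  goes through complex lines. One-variable Cauchy estimates on a line bound the first-order
  remainder by a multiple of \<open>(norm h)\<^sup>2\<close> whose constant depends on
  \<open>f\<close> only through a bound on a ball; this estimate survives uniform limits, parameters
  and integration. Square-integrable functions extend because a point at transversal distance
  \<open>cmod \<zeta>\<close> from \<open>S\<close> is the centre of a balanced set that misses
  \<open>S\<close> and has volume at least a multiple of \<open>(cmod \<zeta>)\<^sup>2\<close>. The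
  mean value inequality there bounds \<open>(cmod (\<zeta> * f))\<^sup>2\<close> by the mass of
  \<open>f\<close> near \<open>S\<close>, which tends to 0, and this is the hypothesis of Riemann's
  theorem in \<zeta>. \<open>bergman_kernel\<close> is a definite description: it says something
  only once a reproducing kernel exists and is unique. Pushing curves off \<open>S\<close> helps
  only if lengths converge, so the metric must be continuous; this comes from a kernel that is
  holomorphic in one variable, antiholomorphic in the other and locally bounded in both.\<close>

lemma norm_vector_smult: "norm (c *s v) = cmod c * norm (v :: complex^'n)"
proof -
  have "(\<Sum>i\<in>UNIV. (cmod c * cmod (v $ i))\<^sup>2) = (cmod c)\<^sup>2 * (\<Sum>i\<in>UNIV. (cmod (v $ i))\<^sup>2)"
    by (simp add: power_mult_distrib sum_distrib_left)
  then show ?thesis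
    by (simp add: norm_vec_def L2_set_def norm_mult real_sqrt_mult)
qed

lemma bounded_linear_smult_left: "bounded_linear (\<lambda>c. c *s (v :: complex^'n))"
  by (rule bounded_linear_intro[where K="norm v"]) (simp_all add: norm_vector_smult vec_eq_iff algebra_simps)

lemma bounded_linear_smult_right: "bounded_linear (\<lambda>v. c *s (v :: complex^'n))"
  by (rule bounded_linear_intro[where K="cmod c"]) (simp_all add: norm_vector_smult vec_eq_iff algebra_simps)

lemma continuous_on_smult [continuous_intros]:
  fixes g :: "'a::topological_space \<Rightarrow> complex^'n"
  assumes "continuous_on A f" "continuous_on A g"
  shows "continuous_on A (\<lambda>x. f x *s g x)"
  unfolding vector_scalar_mult_def using assms by (intro continuous_intros)

lemma of_real_smult: "complex_of_real c *s v = c *\<^sub>R v"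
  by (simp add: vec_eq_iff scaleR_conv_of_real[symmetric])

lemma holomorphic_Cn_iff:
  assumes "open G"
  shows "holomorphic_Cn f G \<longleftrightarrow>
    (\<forall>z\<in>G. \<exists>L. (f has_derivative L) (at z) \<and> (\<forall>c v. L (c *s v) = c * L v))"
  unfolding holomorphic_Cn_def using assms by (metis at_within_open)

lemma holomorphic_Cn_subset:
  assumes "holomorphic_Cn f G" "H \<subseteq> G" shows "holomorphic_Cn f H"
  using assms unfolding holomorphic_Cn_def by (meson has_derivative_subset subsetD)

lemma holomorphic_Cn_local:
  assumes "open G" "\<And>z. z \<in> G \<Longrightarrow> \<exists>r>0. holomorphic_Cn f (ball z r)"
  shows "holomorphic_Cn f G"
  unfolding holomorphic_Cn_iff[OF assms(1)]
  using assms(2) holomorphic_Cn_iff[OF open_ball] by (metis centre_in_ball)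

lemma holomorphic_Cn_cong:
  assumes "\<And>z. z \<in> G \<Longrightarrow> f z = g z" shows "holomorphic_Cn f G \<longleftrightarrow> holomorphic_Cn g G"
proof -
  have "(f has_derivative L) (at z within G) \<longleftrightarrow> (g has_derivative L) (at z within G)" if "z \<in> G" for z L
    using assms that by (auto intro: has_derivative_transform_within[OF _ zero_less_one])
  then show ?thesis unfolding holomorphic_Cn_def by auto
qed

abbreviation hderiv :: "(complex^'n \<Rightarrow> complex) \<Rightarrow> complex^'n \<Rightarrow> complex^'n \<Rightarrow> complex" where
  "hderiv f z \<equiv> frechet_derivative f (at z)"

lemma
  assumes "holomorphic_Cn f G" "open G" "z \<in> G"
  shows holomorphic_Cn_has_derivative: "(f has_derivative hderiv f z) (at z)"
    and hderiv_smult: "hderiv f z (c *s v) = c * hderiv f z v"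
proof -
  obtain L where L: "(f has_derivative L) (at z)" "\<forall>c v. L (c *s v) = c * L v"
    using assms holomorphic_Cn_iff by blast
  then have "hderiv f z = L" using frechet_derivative_at by metis
  then show "(f has_derivative hderiv f z) (at z)" "hderiv f z (c *s v) = c * hderiv f z v"
    using L by auto
qed

lemma holomorphic_Cn_continuous_on:
  assumes "holomorphic_Cn f G" shows "continuous_on G f"
  using assms unfolding holomorphic_Cn_def continuous_on_eq_continuous_within
  by (meson has_derivative_continuous)

lemma bounded_linear_hderiv:
  assumes "holomorphic_Cn f G" "open G" "z \<in> G" shows "bounded_linear (hderiv f z)"
  using holomorphic_Cn_has_derivative[OF assms] has_derivative_bounded_linear by blast

lemma hderiv_unique:
  assumes "(f has_derivative L) (at z)" shows "hderiv f z = L"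
  using frechet_derivative_at[OF assms] by simp

lemma holomorphic_Cn_const [simp]: "holomorphic_Cn (\<lambda>z. c) G"
  unfolding holomorphic_Cn_def by (auto intro!: exI[of _ "\<lambda>_. 0"])

lemma holomorphic_Cn_add:
  assumes "holomorphic_Cn f G" "holomorphic_Cn g G" shows "holomorphic_Cn (\<lambda>z. f z + g z) G"
  unfolding holomorphic_Cn_def
proof
  fix z assume "z \<in> G"
  then obtain L M where "(f has_derivative L) (at z within G)" "\<forall>c v. L (c *s v) = c * L v"
     "(g has_derivative M) (at z within G)" "\<forall>c v. M (c *s v) = c * M v"
    using assms unfolding holomorphic_Cn_def by blast
  then show "\<exists>L. ((\<lambda>z. f z + g z) has_derivative L) (at z within G) \<and> (\<forall>c v. L (c *s v) = c * L v)"
    by (intro exI[of _ "\<lambda>h. L h + M h"]) (auto intro!: derivative_eq_intros simp: algebra_simps)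
qed

lemma holomorphic_Cn_mult:
  assumes "holomorphic_Cn f G" "holomorphic_Cn g G" shows "holomorphic_Cn (\<lambda>z. f z * g z) G"
  unfolding holomorphic_Cn_def
proof
  fix z assume "z \<in> G"
  then obtain L M where "(f has_derivative L) (at z within G)" "\<forall>c v. L (c *s v) = c * L v"
     "(g has_derivative M) (at z within G)" "\<forall>c v. M (c *s v) = c * M v"
    using assms unfolding holomorphic_Cn_def by blast
  then show "\<exists>L. ((\<lambda>z. f z * g z) has_derivative L) (at z within G) \<and> (\<forall>c v. L (c *s v) = c * L v)"
    by (intro exI[of _ "\<lambda>h. f z * M h + L h * g z"]) (auto intro!: derivative_eq_intros simp: algebra_simps)
qed

lemma holomorphic_Cn_diff:
  assumes "holomorphic_Cn f G" "holomorphic_Cn g G" shows "holomorphic_Cn (\<lambda>z. f z - g z) G"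
  using holomorphic_Cn_add[OF assms(1) holomorphic_Cn_mult[OF holomorphic_Cn_const[of "-1"] assms(2)]] by simp

lemma holomorphic_Cn_translate:
  assumes "holomorphic_Cn f H" "open G" "open H" "\<And>z. z \<in> G \<Longrightarrow> z + a \<in> H"
  shows "holomorphic_Cn (\<lambda>z. f (z + a)) G"
  unfolding holomorphic_Cn_iff[OF \<open>open G\<close>]
proof
  fix z assume "z \<in> G"
  then have "z + a \<in> H" using assms by blast
  then obtain L where L: "(f has_derivative L) (at (z + a))" "\<forall>c v. L (c *s v) = c * L v"
    using assms(1) holomorphic_Cn_iff[OF assms(3)] by blast
  have "((\<lambda>z. z + a) has_derivative (\<lambda>h. h)) (at z)" by (auto intro!: derivative_eq_intros)
  from has_derivative_compose[OF this L(1)]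
  show "\<exists>L. ((\<lambda>z. f (z + a)) has_derivative L) (at z) \<and> (\<forall>c v. L (c *s v) = c * L v)"
    using L(2) by auto
qed

text \<open>The bridge to one variable: complex linearity of the differential is what turns the
  chain rule along \<open>z + \<zeta> *s v\<close> into a complex derivative in \<zeta>.\<close>

lemma has_field_derivative_slice:
  assumes "holomorphic_Cn f G" "open G" "z + \<zeta> *s v \<in> G"
  shows "((\<lambda>\<zeta>. f (z + \<zeta> *s v)) has_field_derivative hderiv f (z + \<zeta> *s v) v) (at \<zeta>)"
proof -
  have "((\<lambda>\<zeta>. z + \<zeta> *s v) has_derivative (\<lambda>h. h *s v)) (at \<zeta>)"
    by (auto intro!: derivative_eq_intros bounded_linear_imp_has_derivative bounded_linear_smult_left)
  from has_derivative_compose[OF this holomorphic_Cn_has_derivative[OF assms]]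
  moreover have "(\<lambda>h. hderiv f (z + \<zeta> *s v) (h *s v)) = (*) (hderiv f (z + \<zeta> *s v) v)"
    by (simp add: hderiv_smult[OF assms] fun_eq_iff)
  ultimately show ?thesis unfolding has_field_derivative_def by simp
qed

lemma holomorphic_on_slice:
  assumes "holomorphic_Cn f G" "open G" "\<And>\<zeta>. \<zeta> \<in> U \<Longrightarrow> z + \<zeta> *s v \<in> G"
  shows "(\<lambda>\<zeta>. f (z + \<zeta> *s v)) holomorphic_on U"
  unfolding holomorphic_on_def field_differentiable_def
  using has_field_derivative_slice[OF assms(1,2)] assms(3) has_field_derivative_at_within by blast

section \<open>Cauchy estimates on complex lines\<close>

lemma taylor_remainder_1:
  assumes hol: "g holomorphic_on ball 0 R" and R: "R \<ge> 4" and M: "\<And>\<zeta>. \<zeta> \<in> ball 0 R \<Longrightarrow> cmod (g \<zeta>) \<le> M"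
  shows "cmod (g 1 - g 0 - deriv g 0) \<le> 8 * M / R\<^sup>2"
proof -
  \<comment> \<open>Since \<open>1 + R/2 < R\<close>, the disc of radius \<open>R/2\<close> about
    any point of the unit disc lies in the domain; Cauchy's inequality for the second derivative
    gives \<open>2 * M / (R/2)\<^sup>2\<close>.\<close>
  have B: "cmod ((deriv ^^ 2) g x) \<le> 8 * M / R\<^sup>2" if "x \<in> cball 0 1" for x
  proof -
    have sub: "cball x (R/2) \<subseteq> ball 0 R"
    proof
      fix y assume "y \<in> cball x (R/2)"
      then have "dist x y \<le> R/2" by simp
      moreover have "dist 0 x \<le> 1" using that by simp
      ultimately have "dist 0 y \<le> 1 + R/2" using dist_triangle[of 0 y x] by linarith
      then show "y \<in> ball 0 R" using R by simp
    qed
    have "cmod ((deriv ^^ 2) g x) \<le> fact 2 * M / (R/2)^2"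
    proof (rule Cauchy_inequality)
      show "g holomorphic_on ball x (R/2)" using hol sub ball_subset_cball holomorphic_on_subset by blast
      show "continuous_on (cball x (R/2)) g"
        using holomorphic_on_imp_continuous_on[OF hol] sub continuous_on_subset by blast
      show "0 < R/2" using R by simp
      fix y assume "cmod (x - y) = R/2"
      then have "y \<in> cball x (R/2)" by (simp add: dist_norm)
      then show "cmod (g y) \<le> M" using sub M by blast
    qed
    also have "\<dots> = 8 * M / R\<^sup>2" by (simp add: power2_eq_square)
    finally show ?thesis .
  qed
  have sub1: "cball 0 1 \<subseteq> ball (0::complex) R" using R by auto
  have d: "((deriv ^^ i) g has_field_derivative (deriv ^^ Suc i) g x) (at x within cball 0 1)"
    if "x \<in> cball 0 1" for i x
  proof -
    have "(deriv ^^ i) g holomorphic_on ball 0 R" using hol by (rule holomorphic_higher_deriv) auto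
    then have "((deriv ^^ i) g has_field_derivative deriv ((deriv ^^ i) g) x) (at x)"
      using holomorphic_derivI[OF _ open_ball] sub1 that by blast
    then show ?thesis by (simp add: has_field_derivative_at_within)
  qed
  have "cmod ((deriv ^^ 0) g 1 - (\<Sum>i\<le>1. (deriv ^^ i) g 0 * (1-0)^i / fact i)) \<le> (8 * M / R\<^sup>2) * cmod (1-0)^(Suc 1) / fact 1"
    by (rule complex_Taylor[where f="\<lambda>i. (deriv ^^ i) g" and S="cball 0 1"])
       (use d B in \<open>auto simp: numeral_2_eq_2\<close>)
  then show ?thesis by (simp add: algebra_simps)
qed

text \<open>Both bounds are one-variable facts about \<open>g \<zeta> = f (z + \<zeta> *s h)\<close>
  on the disc of radius \<open>R = r / norm h\<close>, where \<open>h\<close> corresponds to the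
  parameter 1; the condition \<open>norm h \<le> r/4\<close> says \<open>R \<ge> 4\<close>.
  \<open>f\<close> enters the constants through \<open>M\<close> alone, which makes the bounds
  uniform in families.\<close>

lemma
  fixes z h :: "complex^'n"
  assumes hol: "holomorphic_Cn f (ball z r)" and r: "r > 0"
    and M: "\<And>x. x \<in> ball z r \<Longrightarrow> cmod (f x) \<le> M"
  shows hderiv_bound: "cmod (hderiv f z h) \<le> 2 * M * norm h / r"
    and hderiv_remainder: "norm h \<le> r/4 \<Longrightarrow> cmod (f (z+h) - f z - hderiv f z h) \<le> 8 * M * (norm h)\<^sup>2 / r\<^sup>2"
proof -
  define R where "R = r / norm h"
  define g where "g = (\<lambda>\<zeta>. f (z + \<zeta> *s h))"
  have h0: "hderiv f z 0 = 0"
    using linear_simps(3)[OF bounded_linear_hderiv[OF hol open_ball]] r by simp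
  have in_ball: "z + \<zeta> *s h \<in> ball z r" if "\<zeta> \<in> ball 0 R" "h \<noteq> 0" for \<zeta>
    using that by (simp add: R_def dist_norm norm_vector_smult pos_less_divide_eq)
  have holg: "g holomorphic_on ball 0 R" if "h \<noteq> 0"
    unfolding g_def using holomorphic_on_slice[OF hol open_ball in_ball] that by blast
  have "(g has_field_derivative hderiv f z h) (at 0)"
    using has_field_derivative_slice[OF hol open_ball, of z 0 h] r by (simp add: g_def)
  then have dg: "deriv g 0 = hderiv f z h" by (rule DERIV_imp_deriv)
  have Mg: "cmod (g \<zeta>) \<le> M" if "\<zeta> \<in> ball 0 R" "h \<noteq> 0" for \<zeta>
    using M in_ball[OF that] by (simp add: g_def)
  show "cmod (hderiv f z h) \<le> 2 * M * norm h / r"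
  proof (cases "h = 0")
    case True then show ?thesis using h0 by simp
  next
    case False
    have Rp: "R > 0" using r False by (simp add: R_def)
    have sub: "cball 0 (R/2) \<subseteq> ball (0::complex) R" using Rp by auto
    have "cmod ((deriv ^^ 1) g 0) \<le> fact 1 * M / (R/2)^1"
    proof (rule Cauchy_inequality)
      show "g holomorphic_on ball 0 (R/2)" using holg[OF False] holomorphic_on_subset sub ball_subset_cball by blast
      show "continuous_on (cball 0 (R/2)) g"
        using holomorphic_on_imp_continuous_on[OF holg[OF False]] sub continuous_on_subset by blast
      show "0 < R/2" using Rp by simp
      fix x assume "cmod (0 - x) = R/2"
      then have "x \<in> ball 0 R" using Rp by simp
      then show "cmod (g x) \<le> M" using Mg False by blast
    qed
    then show ?thesis using dg by (simp add: R_def field_simps)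
  qed
  show "cmod (f (z+h) - f z - hderiv f z h) \<le> 8 * M * (norm h)\<^sup>2 / r\<^sup>2" if "norm h \<le> r/4"
  proof (cases "h = 0")
    case True then show ?thesis using h0 by simp
  next
    case False
    have "R \<ge> 4" using that False by (simp add: R_def field_simps)
    from taylor_remainder_1[OF holg[OF False] this Mg[OF _ False]]
    have "cmod (g 1 - g 0 - deriv g 0) \<le> 8 * M / R\<^sup>2" .
    then show ?thesis using dg False by (simp add: g_def R_def power_divide)
  qed
qed

section \<open>Locally uniform limits and directional derivatives\<close>

lemma has_derivative_quadratic:
  fixes f :: "'a::real_normed_vector \<Rightarrow> 'b::real_normed_vector"
  assumes "bounded_linear L" "r > 0"
    and *: "\<And>h. norm h < r \<Longrightarrow> norm (f (z+h) - f z - L h) \<le> C * (norm h)\<^sup>2"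
  shows "(f has_derivative L) (at z)"
  unfolding has_derivative_at
proof
  show "bounded_linear L" by fact
  show "(\<lambda>h. norm (f (z + h) - f z - L h) / norm h) \<midarrow>0\<rightarrow> 0"
  proof (rule Lim_null_comparison)
    have "eventually (\<lambda>h. norm h < r \<and> h \<noteq> 0) (at (0::'a))"
      using \<open>r > 0\<close> by (auto simp: eventually_at dist_norm intro!: exI[of _ r])
    then show "eventually (\<lambda>h. norm (norm (f (z + h) - f z - L h) / norm h) \<le> C * norm h) (at 0)"
    proof eventually_elim
      case (elim h)
      then show ?case using *[of h] by (simp add: divide_le_eq power2_eq_square mult.assoc)
    qed
    show "((\<lambda>h. C * norm h) \<longlongrightarrow> 0) (at (0::'a))" by (auto intro!: tendsto_eq_intros)
  qed
qed

lemma locally_bounded_ball: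
  fixes f :: "'a::euclidean_space \<Rightarrow> 'b::real_normed_vector"
  assumes "open G" "continuous_on G f" "z \<in> G"
  obtains r M where "r > 0" "ball z r \<subseteq> G" "\<And>x. x \<in> ball z r \<Longrightarrow> norm (f x) \<le> M"
proof -
  obtain e where e: "e > 0" "cball z e \<subseteq> G" using assms(1,3) unfolding open_contains_cball by blast
  have "compact (f ` cball z e)"
    by (intro compact_continuous_image continuous_on_subset[OF assms(2) e(2)] compact_cball)
  then have "bounded (f ` cball z e)" by (rule compact_imp_bounded)
  then obtain M where "\<forall>y\<in>f ` cball z e. norm y \<le> M" unfolding bounded_iff by blast
  then have M: "norm (f x) \<le> M" if "x \<in> ball z e" for x using that by simp
  have "ball z e \<subseteq> G" using e(2) by auto
  with e(1) show thesis using M by (rule that)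
qed

text \<open>Weierstrass' theorem. \<open>hderiv_bound\<close> for \<open>f m - f n\<close> makes the
  differentials at \<open>z\<close> a Cauchy sequence in every direction. Their limit
  \<open>L\<close> inherits complex linearity, and the remainder bound passes to the limit because
  one \<open>M\<close> serves all large \<open>k\<close>.\<close>

lemma holomorphic_Cn_uniform_limit:
  fixes f :: "nat \<Rightarrow> complex^'n \<Rightarrow> complex"
  assumes G: "open G" and hol: "\<And>k. holomorphic_Cn (f k) G"
    and lim: "\<And>z. z \<in> G \<Longrightarrow> \<exists>r>0. ball z r \<subseteq> G \<and> uniform_limit (ball z r) f F sequentially"
  shows "holomorphic_Cn F G"
proof -
  have *: "\<exists>L. (F has_derivative L) (at z) \<and> (\<forall>c v. L (c *s v) = c * L v)"
    if z: "z \<in> G" for z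
  proof -
    obtain r1 where r1: "r1 > 0" "ball z r1 \<subseteq> G" "uniform_limit (ball z r1) f F sequentially"
      using lim[OF z] by blast
    obtain k0 where k0: "\<And>k x. k \<ge> k0 \<Longrightarrow> x \<in> ball z r1 \<Longrightarrow> dist (f k x) (F x) < 1"
      using r1(3) unfolding uniform_limit_iff eventually_sequentially by (meson zero_less_one)
    obtain r2 M0 where r2: "r2 > 0" "\<And>x. x \<in> ball z r2 \<Longrightarrow> cmod (f k0 x) \<le> M0"
      using locally_bounded_ball[OF G holomorphic_Cn_continuous_on[OF hol] z] by metis
    define r where "r = min r1 r2"
    have r: "r > 0" "ball z r \<subseteq> ball z r1" "ball z r \<subseteq> ball z r2" using r1 r2 by (auto simp: r_def)
    \<comment> \<open>From \<open>k0\<close> on, every \<open>f k\<close> is within 1 of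
      \<open>F\<close>, hence within 2 of \<open>f k0\<close>, which is bounded by
      \<open>M0\<close>.\<close>
    define M where "M = M0 + 2"
    have M: "cmod (f k x) \<le> M" if "k \<ge> k0" "x \<in> ball z r" for k x
    proof -
      have "dist (f k x) (F x) < 1" "dist (f k0 x) (F x) < 1" "cmod (f k0 x) \<le> M0"
        using k0 r2 r that by auto
      then have "dist (f k x) (f k0 x) < 2" using dist_triangle2[of "f k x" "f k0 x" "F x"] by linarith
      then show ?thesis using norm_triangle_sub[of "f k x" "f k0 x"] \<open>cmod (f k0 x) \<le> M0\<close>
        by (simp add: M_def dist_norm)
    qed
    have holr: "holomorphic_Cn (f k) (ball z r)" for k
      using hol holomorphic_Cn_subset r(2) r1(2) by blast
    have zr: "z \<in> ball z r" using r by simp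
    have D: "(f k has_derivative hderiv (f k) z) (at z)" for k
      using holomorphic_Cn_has_derivative[OF holr open_ball zr] .
    have "Cauchy (\<lambda>k. hderiv (f k) z h)" for h
    proof (rule metric_CauchyI)
      fix e :: real assume e: "e > 0"
      \<comment> \<open>Chosen so that the Cauchy bound for a difference of size
        \<open>2 * d\<close> stays below \<open>e\<close>; the \<open>+ 1\<close> covers
        \<open>h = 0\<close>.\<close>
      define d where "d = e * r / (8 * (norm h + 1))"
      have d: "d > 0" using e r by (simp add: d_def add_nonneg_pos)
      obtain k1 where k1: "\<And>k x. k \<ge> k1 \<Longrightarrow> x \<in> ball z r1 \<Longrightarrow> dist (f k x) (F x) < d"
        using r1(3) d unfolding uniform_limit_iff eventually_sequentially by meson
      have "dist (hderiv (f m) z h) (hderiv (f n) z h) < e" if mn: "m \<ge> k1" "n \<ge> k1" for m n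
      proof -
        have "cmod (f m x - f n x) \<le> 2 * d" if "x \<in> ball z r" for x
          using k1[OF mn(1), of x] k1[OF mn(2), of x] dist_triangle2[of "f m x" "f n x" "F x"] r that
          by (auto simp: dist_norm)
        from hderiv_bound[OF holomorphic_Cn_diff[OF holr holr] r(1) this]
        have "cmod (hderiv (\<lambda>z. f m z - f n z) z h) \<le> 2 * (2 * d) * norm h / r" .
        moreover have "hderiv (\<lambda>z. f m z - f n z) z = (\<lambda>h. hderiv (f m) z h - hderiv (f n) z h)"
          by (rule hderiv_unique) (intro has_derivative_diff D)
        ultimately have "dist (hderiv (f m) z h) (hderiv (f n) z h) \<le> 4 * d * norm h / r"
          by (simp add: dist_norm)
        also have "\<dots> = e * (norm h / (2 * (norm h + 1)))" 
          using r by (simp add: d_def divide_simps add_nonneg_eq_0_iff)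
        also have "\<dots> < e * 1" using e by (intro mult_strict_left_mono) (auto simp: divide_less_eq add_nonneg_pos)
        finally show ?thesis by simp
      qed
      then show "\<exists>M. \<forall>m\<ge>M. \<forall>n\<ge>M. dist (hderiv (f m) z h) (hderiv (f n) z h) < e" by blast
    qed
    then have conv: "convergent (\<lambda>k. hderiv (f k) z h)" for h by (simp add: Cauchy_convergent_iff)
    define L where "L h = lim (\<lambda>k. hderiv (f k) z h)" for h
    have L: "(\<lambda>k. hderiv (f k) z h) \<longlonglongrightarrow> L h" for h
      using conv unfolding L_def by (simp add: convergent_LIMSEQ_iff)
    have bl: "bounded_linear (hderiv (f k) z)" for k using D has_derivative_bounded_linear by blast
    have Lc: "L (c *s v) = c * L v" for c v
    proof -
      have "(\<lambda>k. hderiv (f k) z (c *s v)) \<longlonglongrightarrow> c * L v"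
        unfolding hderiv_smult[OF holr open_ball zr] by (intro tendsto_intros L)
      then show ?thesis using L LIMSEQ_unique by blast
    qed
    have "bounded_linear L"
    proof -
      have "L (x + y) = L x + L y" for x y
      proof -
        have "(\<lambda>k. hderiv (f k) z (x + y)) \<longlonglongrightarrow> L x + L y"
          unfolding linear_simps(1)[OF bl] by (intro tendsto_intros L)
        then show ?thesis using L LIMSEQ_unique by blast
      qed
      moreover have "L (c *\<^sub>R x) = c *\<^sub>R L x" for c x
        using Lc[of "of_real c" x] by (simp add: of_real_smult scaleR_conv_of_real)
      ultimately have "linear L" by (rule linearI)
      then show ?thesis by (simp add: linear_conv_bounded_linear)
    qed
    moreover have "cmod (F (z+h) - F z - L h) \<le> (8 * M / r\<^sup>2) * (norm h)\<^sup>2" if "norm h < r/4" for h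
    proof -
      have pt: "(\<lambda>k. f k x) \<longlonglongrightarrow> F x" if "x \<in> ball z r" for x
        using tendsto_uniform_limitI[OF r1(3)] that r by blast
      have zh: "z + h \<in> ball z r" using that r by (simp add: dist_norm)
      have "(\<lambda>k. cmod (f k (z+h) - f k z - hderiv (f k) z h)) \<longlonglongrightarrow> cmod (F (z+h) - F z - L h)"
        by (intro tendsto_intros pt L zh zr)
      moreover have "\<forall>k\<ge>k0. cmod (f k (z+h) - f k z - hderiv (f k) z h) \<le> (8 * M / r\<^sup>2) * (norm h)\<^sup>2"
        using hderiv_remainder[OF holr r(1) M] that by (auto simp: field_simps)
      ultimately show ?thesis by (meson LIMSEQ_le_const2)
    qed
    ultimately have "(F has_derivative L) (at z)"
      by (intro has_derivative_quadratic[where r="r/4" and C="8 * M / r\<^sup>2"]) (use r in auto)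
    then show ?thesis using Lc by blast
  qed
  show ?thesis using * unfolding holomorphic_Cn_iff[OF G] by blast
qed

text \<open>A quadratic remainder for the step \<open>v / n\<close>, multiplied by \<open>n\<close>,
  leaves an error of order \<open>1 / n\<close>.\<close>

lemma difference_quotient_bound:
  assumes hol: "holomorphic_Cn f (ball z r)" and r: "r > 0"
    and M: "\<And>x. x \<in> ball z r \<Longrightarrow> cmod (f x) \<le> M"
    and n: "n > 0" "norm v / real n \<le> r/4"
  shows "cmod (of_nat n * (f (z + v /\<^sub>R real n) - f z) - hderiv f z v) \<le> 8 * M * (norm v)\<^sup>2 / r\<^sup>2 / real n"
proof -
  define h where "h = v /\<^sub>R real n"
  have nh: "norm h = norm v / real n" by (simp add: h_def divide_inverse)
  have "hderiv f z (real n *\<^sub>R h) = real n *\<^sub>R hderiv f z h"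
    using bounded_linear_hderiv[OF hol open_ball] r linear_simps(5) by (metis centre_in_ball)
  moreover have "real n *\<^sub>R h = v" using n by (simp add: h_def)
  ultimately have e: "hderiv f z v = of_nat n * hderiv f z h" by (simp add: scaleR_conv_of_real)
  have "cmod (of_nat n * (f (z + h) - f z) - hderiv f z v) = real n * cmod (f (z+h) - f z - hderiv f z h)"
    unfolding e by (metis norm_mult norm_of_nat right_diff_distrib)
  also have "\<dots> \<le> real n * (8 * M * (norm h)\<^sup>2 / r\<^sup>2)"
    by (intro mult_left_mono hderiv_remainder[OF hol r M]) (use n nh in auto)
  also have "\<dots> = 8 * M * (norm v)\<^sup>2 / r\<^sup>2 / real n" using n by (simp add: nh power2_eq_square mult.commute mult.left_commute)
  finally show ?thesis by (simp add: h_def)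
qed

text \<open>The parameter \<open>w\<close> is there for kernels: uniformity in \<open>w\<close> lets
  a derivative in one variable keep its holomorphy in the other. A single function is the case of a
  one-point \<open>W\<close>.\<close>

lemma difference_quotient_uniform:
  fixes f :: "'a \<Rightarrow> complex^'n \<Rightarrow> complex"
  assumes r: "r > 0" and hol: "\<And>w. w \<in> W \<Longrightarrow> holomorphic_Cn (f w) (ball z (2*r))"
    and M: "\<And>w x. w \<in> W \<Longrightarrow> x \<in> ball z (2*r) \<Longrightarrow> cmod (f w x) \<le> M"
  shows "uniform_limit (W \<times> ball z r) (\<lambda>n (w,x). of_nat n * (f w (x + v /\<^sub>R real n) - f w x))
           (\<lambda>(w,x). hderiv (f w) x v) sequentially"
  unfolding uniform_limit_iff
proof (intro allI impI)
  fix e :: real assume e: "e > 0"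
  have "eventually (\<lambda>n. 8 * M * (norm v)\<^sup>2 / r\<^sup>2 / real n < e) sequentially"
    by (rule order_tendstoD(2)[OF lim_const_over_n e])
  moreover have "eventually (\<lambda>n. norm v / real n < r/4) sequentially"
    by (rule order_tendstoD(2)[OF lim_const_over_n]) (use r in auto)
  ultimately show "eventually (\<lambda>n. \<forall>p\<in>W \<times> ball z r. dist (case p of (w,x) \<Rightarrow> of_nat n * (f w (x + v /\<^sub>R real n) - f w x))
         (case p of (w,x) \<Rightarrow> hderiv (f w) x v) < e) sequentially"
    using eventually_gt_at_top[of 0]
  proof eventually_elim
    case (elim n)
    show ?case
    proof clarify
      fix w x assume wx: "w \<in> W" "x \<in> ball z r"
      have sub: "ball x r \<subseteq> ball z (2*r)"
      proof
        fix y assume "y \<in> ball x r"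
        then show "y \<in> ball z (2*r)" using wx(2) dist_triangle[of z y x] by auto
      qed
      have "cmod (of_nat n * (f w (x + v /\<^sub>R real n) - f w x) - hderiv (f w) x v) \<le> 8 * M * (norm v)\<^sup>2 / r\<^sup>2 / real n"
        by (rule difference_quotient_bound)
           (use r elim wx M sub holomorphic_Cn_subset[OF hol[OF wx(1)] sub] in auto)
      then show "dist (of_nat n * (f w (x + v /\<^sub>R real n) - f w x)) (hderiv (f w) x v) < e"
        using elim by (simp add: dist_norm)
    qed
  qed
qed

lemma dist_add_le: "dist z (x + a) \<le> dist z x + norm (a :: 'a::real_normed_vector)"
  using norm_triangle_ineq4[of "z - x" a] by (simp add: dist_norm diff_diff_eq)

lemma uniform_limit_shift:
  assumes "uniform_limit A f l sequentially" shows "uniform_limit A (\<lambda>n. f (n + k :: nat)) l sequentially"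
  using assms unfolding uniform_limit_iff using sequentially_offset[where k=k] by fast

text \<open>A directional derivative is a locally uniform limit of difference quotients, so
  \<open>holomorphic_Cn_uniform_limit\<close> applies.\<close>

lemma holomorphic_Cn_hderiv:
  assumes "holomorphic_Cn f G" "open G" shows "holomorphic_Cn (\<lambda>z. hderiv f z v) G"
proof (rule holomorphic_Cn_local[OF assms(2)])
  fix z assume "z \<in> G"
  then obtain R M where R: "R > 0" "ball z R \<subseteq> G" "\<And>x. x \<in> ball z R \<Longrightarrow> cmod (f x) \<le> M"
    using locally_bounded_ball[OF assms(2) holomorphic_Cn_continuous_on[OF assms(1)]] by blast
  define r where "r = R/2"
  have r: "r > 0" "ball z (2*r) \<subseteq> G" "\<And>x. x \<in> ball z (2*r) \<Longrightarrow> cmod (f x) \<le> M"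
    using R by (auto simp: r_def)
  have hol: "holomorphic_Cn f (ball z (2*r))" using assms(1) r(2) holomorphic_Cn_subset by blast
  have U: "uniform_limit ({()} \<times> ball z r) (\<lambda>n (w,x). of_nat n * (f (x + v /\<^sub>R real n) - f x))
           (\<lambda>(w,x). hderiv f x v) sequentially"
    by (rule difference_quotient_uniform[OF r(1) hol r(3)])
  have "uniform_limit (ball z r) (\<lambda>n x. of_nat n * (f (x + v /\<^sub>R real n) - f x))
           (\<lambda>x. hderiv f x v) sequentially"
    using U unfolding uniform_limit_iff by auto
  \<comment> \<open>For small \<open>n\<close> the point \<open>x + v /\<^sub>R real n\<close> may
    leave the ball on which \<open>f\<close> is controlled, so the sequence starts at
    \<open>N\<close>.\<close>
  moreover obtain N where N: "\<And>n. n \<ge> N \<Longrightarrow> norm v / real n < r"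
    using order_tendstoD(2)[OF lim_const_over_n[of "norm v"] r(1)] unfolding eventually_sequentially by blast
  ultimately have U2: "uniform_limit (ball z r) (\<lambda>n x. of_nat (n+N) * (f (x + v /\<^sub>R real (n+N)) - f x))
           (\<lambda>x. hderiv f x v) sequentially"
    using uniform_limit_shift by fast
  have "holomorphic_Cn (\<lambda>x. hderiv f x v) (ball z r)"
  proof (rule holomorphic_Cn_uniform_limit[OF open_ball])
    fix k
    show "holomorphic_Cn (\<lambda>x. of_nat (k+N) * (f (x + v /\<^sub>R real (k+N)) - f x)) (ball z r)"
    proof (intro holomorphic_Cn_mult holomorphic_Cn_const holomorphic_Cn_diff)
      show "holomorphic_Cn f (ball z r)" by (rule holomorphic_Cn_subset[OF hol]) (use r in auto)
      show "holomorphic_Cn (\<lambda>x. f (x + v /\<^sub>R real (k + N))) (ball z r)"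
      proof (rule holomorphic_Cn_translate[OF hol])
        fix x assume "x \<in> ball z r"
        moreover have "norm (v /\<^sub>R real (k+N)) < r" using N[of "k+N"] by (simp add: divide_inverse_commute)
        moreover have "dist z (x + v /\<^sub>R real (k+N)) \<le> dist z x + norm (v /\<^sub>R real (k+N))"
          by (rule dist_add_le)
        ultimately show "x + v /\<^sub>R real (k + N) \<in> ball z (2*r)" unfolding mem_ball by linarith
      qed (rule open_ball)+
    qed
  next
    fix y assume y: "y \<in> ball z r"
    then obtain s where "s > 0" "ball y s \<subseteq> ball z r" by (meson open_ball open_contains_ball)
    then show "\<exists>s>0. ball y s \<subseteq> ball z r \<and> uniform_limit (ball y s) (\<lambda>n x. of_nat (n+N) * (f (x + v /\<^sub>R real (n+N)) - f x))
           (\<lambda>x. hderiv f x v) sequentially"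
      using uniform_limit_on_subset[OF U2, of "ball y s"] by (intro exI[of _ s]) simp
  qed
  then show "\<exists>r>0. holomorphic_Cn (\<lambda>z. hderiv f z v) (ball z r)" using r by blast
qed

section \<open>Mean values and Lebesgue measure\<close>

lemma circle_mean_value:
  assumes g: "g holomorphic_on U" and sub: "cball 0 r \<subseteq> U" and r: "r > 0"
  shows "((\<lambda>t. g (of_real r * exp (2 * of_real pi * \<i> * of_real t))) has_integral g 0) {0..1}"
proof -
  have "((\<lambda>u. g u / (u - 0)) has_contour_integral (2 * of_real pi * \<i> * g 0)) (circlepath 0 r)"
    by (rule Cauchy_integral_circlepath_simple) (use g sub r holomorphic_on_subset in auto)
  then have "((\<lambda>x. g (circlepath 0 r x) / circlepath 0 r x *
      vector_derivative (circlepath 0 r) (at x within {0..1})) has_integral (2 * of_real pi * \<i> * g 0)) {0..1}"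
    by (simp add: has_contour_integral_def)
  then have "((\<lambda>x. (2 * of_real pi * \<i>) * g (of_real r * exp (2 * of_real pi * \<i> * of_real x)))
      has_integral (2 * of_real pi * \<i> * g 0)) {0..1}"
    by (rule has_integral_eq[rotated])
       (use r in \<open>auto simp: vector_derivative_circlepath01, simp add: circlepath\<close>)
  then have "((\<lambda>x. inverse (2 * of_real pi * \<i>) * ((2 * of_real pi * \<i>) * g (of_real r * exp (2 * of_real pi * \<i> * of_real x))))
      has_integral inverse (2 * of_real pi * \<i>) * (2 * of_real pi * \<i> * g 0)) {0..1}"
    by (rule has_integral_mult_right)
  moreover have "inverse (2 * of_real pi * \<i>) * ((2 * of_real pi * \<i>) * x) = x" for x :: complex
    by (subst mult.assoc[symmetric], subst left_inverse) auto
  ultimately show ?thesis by (simp only:)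
qed

section \<open>Lebesgue measure under linear maps\<close>

lemma nn_integral_lborel_translate:
  fixes g :: "'a::euclidean_space \<Rightarrow> ennreal"
  assumes [measurable]: "g \<in> borel_measurable borel"
  shows "(\<integral>\<^sup>+x. g (c + x) \<partial>lborel) = (\<integral>\<^sup>+x. g x \<partial>lborel)"
proof -
  have "(\<integral>\<^sup>+x. g x \<partial>lborel) = (\<integral>\<^sup>+x. g x \<partial>(distr lborel borel ((+) c)))"
    by (simp add: lborel_distr_plus)
  also have "\<dots> = (\<integral>\<^sup>+x. g (c + x) \<partial>lborel)" by (rule nn_integral_distr) auto
  finally show ?thesis by simp
qed

text \<open>Both sides of the identity are the double integral of \<open>f (T x) g y\<close>: the uniqueness
  argument for translation-invariant measures.\<close>

lemma nn_integral_linear_change: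
  fixes T :: "'a::euclidean_space \<Rightarrow> 'a" and f g :: "'a \<Rightarrow> ennreal"
  assumes T: "linear T" "surj T" and [measurable]: "f \<in> borel_measurable borel" "g \<in> borel_measurable borel"
    and sym: "\<And>x. f (- x) = f x"
  shows "(\<integral>\<^sup>+x. f x \<partial>lborel) * (\<integral>\<^sup>+x. g (T x) \<partial>lborel) = (\<integral>\<^sup>+x. f (T x) \<partial>lborel) * (\<integral>\<^sup>+x. g x \<partial>lborel)"
proof -
  have [measurable]: "T \<in> borel_measurable borel"
    using T(1) by (simp add: linear_continuous_on linear_conv_bounded_linear borel_measurable_continuous_onI)
  have "(\<integral>\<^sup>+x. f (T x) \<partial>lborel) * (\<integral>\<^sup>+y. g y \<partial>lborel) = (\<integral>\<^sup>+x. (\<integral>\<^sup>+y. f (T x) * g y \<partial>lborel) \<partial>lborel)"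
    by (simp add: nn_integral_cmult nn_integral_multc)
  also have "\<dots> = (\<integral>\<^sup>+x. (\<integral>\<^sup>+y. f (T x) * g (T x + y) \<partial>lborel) \<partial>lborel)"
    by (rule nn_integral_cong, subst (1 2) nn_integral_cmult) (simp_all add: nn_integral_lborel_translate)
  also have "\<dots> = (\<integral>\<^sup>+y. (\<integral>\<^sup>+x. f (T x) * g (T x + y) \<partial>lborel) \<partial>lborel)"
    by (rule lborel_pair.Fubini'[symmetric]) measurable
  also have "\<dots> = (\<integral>\<^sup>+y. (\<integral>\<^sup>+x. f (T x - y) * g (T x) \<partial>lborel) \<partial>lborel)"
  proof (rule nn_integral_cong)
    fix y :: 'a
    obtain u where u: "T u = y" using T(2) by (metis surjD)
    have "(\<integral>\<^sup>+x. f (T x - y) * g (T x) \<partial>lborel) = (\<integral>\<^sup>+x. f (T (u + x) - y) * g (T (u + x)) \<partial>lborel)"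
      by (rule nn_integral_lborel_translate[symmetric]) measurable
    then show "(\<integral>\<^sup>+x. f (T x) * g (T x + y) \<partial>lborel) = (\<integral>\<^sup>+x. f (T x - y) * g (T x) \<partial>lborel)"
      by (simp add: linear_add[OF T(1)] u add.commute)
  qed
  also have "\<dots> = (\<integral>\<^sup>+x. (\<integral>\<^sup>+y. f (T x - y) * g (T x) \<partial>lborel) \<partial>lborel)"
    by (rule lborel_pair.Fubini') measurable
  also have "\<dots> = (\<integral>\<^sup>+x. (\<integral>\<^sup>+y. f y \<partial>lborel) * g (T x) \<partial>lborel)"
  proof (rule nn_integral_cong)
    fix x
    \<comment> \<open>Evenness of \<open>f\<close> allows the reflection that turns
      \<open>T x - y\<close> into a translate of \<open>y\<close>.\<close>
    have "(\<integral>\<^sup>+y. f (T x - y) \<partial>lborel) = (\<integral>\<^sup>+y. f (- T x + y) \<partial>lborel)"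
      using sym[of "T x - _"] by (intro nn_integral_cong) (metis minus_diff_eq uminus_add_conv_diff)
    also have "\<dots> = (\<integral>\<^sup>+y. f y \<partial>lborel)" by (rule nn_integral_lborel_translate) measurable
    finally show "(\<integral>\<^sup>+y. f (T x - y) * g (T x) \<partial>lborel) = (\<integral>\<^sup>+y. f y \<partial>lborel) * g (T x)"
      by (simp add: nn_integral_multc)
  qed
  also have "\<dots> = (\<integral>\<^sup>+x. f x \<partial>lborel) * (\<integral>\<^sup>+x. g (T x) \<partial>lborel)" by (simp add: nn_integral_cmult)
  finally show ?thesis by simp
qed

lemma emeasure_lborel_ball_pos: "r > 0 \<Longrightarrow> emeasure lborel (ball (x::'a::euclidean_space) r) > 0"
  using emeasure_lborel_ball_finite open_not_negligible[of "ball x r"]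
  by (metis ball_eq_empty completion.null_sets_outer_le emeasure_completion gr_zeroI lborelD linorder_not_less negligible_iff_null_sets null_setsI null_sets_completionI open_ball borel_open sets_lborel)

text \<open>With the indicator of the unit ball for \<open>f\<close>: an isometry preserves it, and
  its integral is positive and finite, so the two constants cancel.\<close>

lemma nn_integral_isometry:
  fixes T :: "'a::euclidean_space \<Rightarrow> 'a" and g :: "'a \<Rightarrow> ennreal"
  assumes T: "linear T" "surj T" "\<And>x. norm (T x) = norm x" and g: "g \<in> borel_measurable borel"
  shows "(\<integral>\<^sup>+x. g (T x) \<partial>lborel) = (\<integral>\<^sup>+x. g x \<partial>lborel)"
proof -
  let ?f = "indicator (ball 0 1) :: 'a \<Rightarrow> ennreal"
  have "(\<integral>\<^sup>+x. ?f x \<partial>lborel) * (\<integral>\<^sup>+x. g (T x) \<partial>lborel) = (\<integral>\<^sup>+x. ?f (T x) \<partial>lborel) * (\<integral>\<^sup>+x. g x \<partial>lborel)"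
    by (rule nn_integral_linear_change[OF T(1,2) _ g]) (auto simp: indicator_def)
  moreover have "?f (T x) = ?f x" for x using T(3) by (simp add: indicator_def)
  moreover have "(\<integral>\<^sup>+x. ?f x \<partial>lborel) = emeasure lborel (ball (0::'a) 1)" by simp
  ultimately show ?thesis using emeasure_lborel_ball_pos[of 1 "0::'a"] emeasure_lborel_ball_finite[of "0::'a" 1]
    by (auto simp: ennreal_mult_cancel_left)
qed

text \<open>\<open>c\<close> is the volume of the preimage of the unit ball divided by that of the
  ball; it is positive because the preimage is a neighbourhood of 0. As an \<open>ennreal\<close> it
  is not claimed to be finite.\<close>

lemma emeasure_linear_vimage:
  fixes T :: "'a::euclidean_space \<Rightarrow> 'a"
  assumes T: "linear T" "surj T"
  obtains c where "c > 0" "\<And>A. A \<in> sets borel \<Longrightarrow> emeasure lborel (T -` A) = c * emeasure lborel A"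
proof -
  have [measurable]: "T \<in> borel_measurable borel"
    using T(1) by (simp add: linear_continuous_on linear_conv_bounded_linear borel_measurable_continuous_onI)
  let ?f = "indicator (ball 0 1) :: 'a \<Rightarrow> ennreal"
  define m where "m = emeasure lborel (ball (0::'a) 1)"
  have m: "m > 0" "m < \<infinity>" using emeasure_lborel_ball_pos[of 1 "0::'a"] emeasure_lborel_ball_finite[of "0::'a" 1] by (auto simp: m_def)
  define k where "k = emeasure lborel (T -` ball 0 1)"
  have op: "open (T -` ball 0 1)"
    using T(1) by (intro open_vimage) (auto simp: linear_continuous_on linear_conv_bounded_linear)
  have "0 \<in> T -` ball 0 1" using linear_0[OF T(1)] by simp
  then obtain e where e: "e > 0" "ball 0 e \<subseteq> T -` ball 0 1" using op open_contains_ball by blast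
  have k: "k > 0"
  proof -
    have "emeasure lborel (ball (0::'a) e) \<le> k" unfolding k_def using e op by (intro emeasure_mono) auto
    then show ?thesis using emeasure_lborel_ball_pos[OF e(1)] less_le_trans by blast
  qed
  have main: "m * emeasure lborel (T -` A) = k * emeasure lborel A" if [measurable]: "A \<in> sets borel" for A
  proof -
    have "(\<integral>\<^sup>+x. ?f x \<partial>lborel) * (\<integral>\<^sup>+x. indicator A (T x) \<partial>lborel) = (\<integral>\<^sup>+x. ?f (T x) \<partial>lborel) * (\<integral>\<^sup>+x. indicator A x \<partial>lborel)"
      by (rule nn_integral_linear_change[OF T]) (auto simp: indicator_def)
    moreover have "(\<integral>\<^sup>+x. indicator B (T x) \<partial>lborel) = emeasure lborel (T -` B)" if "B \<in> sets borel" for B :: "'a set"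
    proof -
      have "T -` B \<in> sets lborel" using measurable_sets[OF \<open>T \<in> borel_measurable borel\<close> that] by simp
      then show ?thesis by (simp add: indicator_vimage[symmetric] flip: nn_integral_indicator)
    qed
    ultimately show ?thesis by (simp add: m_def k_def)
  qed
  show thesis
  proof (rule that[of "k / m"])
    show "k / m > 0" using k m by (simp add: ennreal_zero_less_divide)
    fix A :: "'a set" assume "A \<in> sets borel"
    from main[OF this] have "emeasure lborel (T -` A) * m / m = emeasure lborel A * k / m"
      by (simp add: mult.commute)
    moreover have "emeasure lborel (T -` A) * m / m = emeasure lborel (T -` A)"
      using m by (intro ennreal_mult_divide_eq) auto
    ultimately show "emeasure lborel (T -` A) = k / m * emeasure lborel A"
      by (simp add: ennreal_times_divide mult.commute[of "k / m"])
  qed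
qed

text \<open>The mean value over circles \<open>z + e\<^sup>i\<^sup>t v\<close> is averaged over \<open>v \<in> N\<close>; rotations preserve
  Lebesgue measure.\<close>

lemma mean_value_inequality:
  fixes f :: "complex^'n \<Rightarrow> complex"
  assumes hol: "holomorphic_Cn f G" and G: "open G" and N: "open N"
    and bal: "\<And>c v. cmod c \<le> 1 \<Longrightarrow> v \<in> N \<Longrightarrow> c *s v \<in> N" and sub: "\<And>v. v \<in> N \<Longrightarrow> z + v \<in> G"
  shows "ennreal ((cmod (f z))\<^sup>2) * emeasure lborel N \<le> (\<integral>\<^sup>+v. ennreal ((cmod (f (z + v)))\<^sup>2) * indicator N v \<partial>lborel)"
proof -
  define c where "c t = exp (2 * of_real pi * \<i> * complex_of_real t)" for t
  have c1: "cmod (c t) = 1" for t by (simp add: c_def)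
  have contc: "continuous_on UNIV c" unfolding c_def by (intro continuous_intros)
  have contf: "continuous_on G f" using hol by (rule holomorphic_Cn_continuous_on)
  define h where "h v = ennreal ((cmod (f (z + v)))\<^sup>2) * indicator N v" for v
  have cN: "c t *s v \<in> N \<longleftrightarrow> v \<in> N" for t v
  proof
    assume "c t *s v \<in> N"
    then have "inverse (c t) *s (c t *s v) \<in> N" by (rule bal[rotated]) (simp add: norm_inverse c1)
    then show "v \<in> N" using c1[of t] by (simp add: vector_smult_assoc) (metis left_inverse norm_zero vector_smult_lid zero_neq_one)
  qed (auto intro: bal simp: c1)
  have hm [measurable]: "h \<in> borel_measurable borel"
  proof -
    have "(\<lambda>v. indicator N v *\<^sub>R ((cmod (f (z + v)))\<^sup>2)) \<in> borel_measurable borel"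
      using N by (intro borel_measurable_continuous_on_indicator continuous_intros continuous_on_compose2[OF contf]) (auto intro: sub)
    then have "(\<lambda>v. ennreal (indicator N v *\<^sub>R ((cmod (f (z + v)))\<^sup>2))) \<in> borel_measurable borel" by measurable
    also have "(\<lambda>v. ennreal (indicator N v *\<^sub>R ((cmod (f (z + v)))\<^sup>2))) = h"
      by (auto simp: h_def indicator_def)
    finally show ?thesis .
  qed
  define H where "H = (\<lambda>(v,t). h (c t *s v) * indicator {0..1} t)"
  have Hm: "H \<in> borel_measurable (lborel \<Otimes>\<^sub>M lborel)"
  proof -
    have "continuous_on UNIV (\<lambda>p. c (snd p) *s fst p :: complex^'n)"
      by (intro continuous_intros continuous_on_compose2[OF contc]) auto
    then have [measurable]: "(\<lambda>p. c (snd p) *s fst p :: complex^'n) \<in> borel_measurable (borel \<Otimes>\<^sub>M borel)"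
      unfolding borel_prod by (rule borel_measurable_continuous_onI)
    show ?thesis unfolding H_def split_beta by measurable
  qed
  have step: "ennreal ((cmod (f z))\<^sup>2) * indicator N v \<le> (\<integral>\<^sup>+t. H (v, t) \<partial>lborel)" for v
  proof (cases "v \<in> N")
    case True
    define U where "U = {\<zeta>. z + \<zeta> *s v \<in> G}"
    have "continuous_on UNIV (\<lambda>\<zeta>. z + \<zeta> *s v)" by (intro continuous_intros)
    then have U: "open U" unfolding U_def using G open_vimage[of G "\<lambda>\<zeta>. z + \<zeta> *s v"] by (simp add: vimage_def)
    \<comment> \<open>The mean value property is applied to the square of \<open>f\<close>, which is
      holomorphic and has modulus \<open>(cmod f)\<^sup>2\<close>, so the triangle inequality for
      integrals gives the squared estimate directly.\<close>
    define g where "g \<zeta> = (f (z + \<zeta> *s v))\<^sup>2" for \<zeta>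
    have holg: "g holomorphic_on U" unfolding g_def
      by (intro holomorphic_intros holomorphic_on_slice[OF hol G]) (auto simp: U_def)
    have sU: "cball 0 1 \<subseteq> U" using bal[OF _ True] sub by (auto simp: U_def)
    have mv: "((\<lambda>t. g (c t)) has_integral g 0) {0..1}"
      using circle_mean_value[OF holg sU] by (simp add: c_def)
    have cont: "continuous_on {0..1} (\<lambda>t. cmod (g (c t)))"
      using sU c1 by (intro continuous_intros continuous_on_compose2[OF holomorphic_on_imp_continuous_on[OF holg]]
          continuous_on_subset[OF contc]) (auto simp: subset_iff)
    then have int: "(\<lambda>t. cmod (g (c t))) integrable_on {0..1}" by (rule integrable_continuous_real)
    have "cmod (g 0) \<le> integral {0..1} (\<lambda>t. cmod (g (c t)))"
      using integral_norm_bound_integral[OF has_integral_integrable[OF mv] int] integral_unique[OF mv] by simp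
    then have "ennreal (cmod (g 0)) \<le> ennreal (integral {0..1} (\<lambda>t. cmod (g (c t))))" by (rule ennreal_leI)
    also have "\<dots> = (\<integral>\<^sup>+t. ennreal (indicator {0..1} t * cmod (g (c t))) \<partial>lborel)"
    proof -
      have "(\<lambda>t. indicator {0..1} t *\<^sub>R cmod (g (c t))) \<in> borel_measurable borel"
        using cont by (intro borel_measurable_continuous_on_indicator) auto
      moreover have "((\<lambda>t. if t \<in> {0..1} then cmod (g (c t)) else 0) has_integral integral {0..1} (\<lambda>t. cmod (g (c t)))) UNIV"
        using integrable_integral[OF int] by (simp only: has_integral_restrict_UNIV)
      moreover have "(\<lambda>t. if t \<in> {0..1} then cmod (g (c t)) else 0) = (\<lambda>t. indicator {0..1} t * cmod (g (c t)))"
        by (auto simp: indicator_def)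
      ultimately have "(\<integral>\<^sup>+t. ennreal (indicator {0..1} t * cmod (g (c t))) \<partial>lborel) = ennreal (integral {0..1} (\<lambda>t. cmod (g (c t))))"
        by (intro nn_integral_has_integral_lborel) simp_all
      then show ?thesis by simp
    qed
    also have "\<dots> = (\<integral>\<^sup>+t. H (v, t) \<partial>lborel)"
      using True by (intro nn_integral_cong) (auto simp: H_def h_def g_def cN indicator_def norm_power)
    finally show ?thesis using True by (simp add: g_def norm_power)
  qed simp
  have "ennreal ((cmod (f z))\<^sup>2) * emeasure lborel N = (\<integral>\<^sup>+v. ennreal ((cmod (f z))\<^sup>2) * indicator N v \<partial>lborel)"
    using N by (simp add: nn_integral_cmult)
  also have "\<dots> \<le> (\<integral>\<^sup>+v. (\<integral>\<^sup>+t. H (v, t) \<partial>lborel) \<partial>lborel)" by (intro nn_integral_mono step)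
  also have "\<dots> = (\<integral>\<^sup>+t. (\<integral>\<^sup>+v. H (v, t) \<partial>lborel) \<partial>lborel)"
    using lborel_pair.Fubini'[of "\<lambda>v t. H (v, t)"] Hm by simp
  also have "\<dots> = (\<integral>\<^sup>+t. (\<integral>\<^sup>+v. h v \<partial>lborel) * indicator {0..1} (t::real) \<partial>lborel)"
  proof (rule nn_integral_cong)
    fix t :: real
    have lin: "linear ((*s) (c t) :: complex^'n \<Rightarrow> _)"
      using bounded_linear_smult_right[of "c t"] bounded_linear.linear by auto
    have "surj ((*s) (c t) :: complex^'n \<Rightarrow> _)"
    proof (rule surjI[where f="(*s) (inverse (c t))"])
      fix x :: "complex^'n" 
      have "c t \<noteq> 0" using c1[of t] by auto
      then show "c t *s (inverse (c t) *s x) = x" by (simp add: vector_smult_assoc)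
    qed
    from nn_integral_isometry[OF lin this _ hm]
    have "(\<integral>\<^sup>+v. h (c t *s v) \<partial>lborel) = (\<integral>\<^sup>+v. h v \<partial>lborel)" by (simp add: norm_vector_smult c1)
    moreover have "(\<lambda>v. h (c t *s v)) \<in> borel_measurable borel"
      by (rule measurable_compose[OF borel_measurable_continuous_onI hm]) (intro continuous_intros)
    ultimately show "(\<integral>\<^sup>+v. H (v, t) \<partial>lborel) = (\<integral>\<^sup>+v. h v \<partial>lborel) * indicator {0..1} t"
      by (simp add: H_def nn_integral_multc)
  qed
  also have "\<dots> = (\<integral>\<^sup>+v. h v \<partial>lborel)" by (simp add: nn_integral_cmult)
  finally show ?thesis unfolding h_def .
qed


section \<open>Linear forms and slabs\<close>

definition lform :: "complex^'n \<Rightarrow> complex^'n \<Rightarrow> complex" where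
  "lform a z = (\<Sum>i\<in>UNIV. a $ i * z $ i)"

lemma lform_add: "lform a (x + y) = lform a x + lform a y"
  by (simp add: lform_def algebra_simps sum.distrib)

lemma lform_smult: "lform a (c *s x) = c * lform a x"
  by (simp add: lform_def sum_distrib_left algebra_simps)

lemma lform_scaleR: "lform a (r *\<^sub>R x) = of_real r * lform a x"
  by (simp only: of_real_smult[symmetric] lform_smult)

lemma continuous_on_lform [continuous_intros]: "continuous_on A g \<Longrightarrow> continuous_on A (\<lambda>x. lform a (g x))"
  unfolding lform_def by (intro continuous_intros)

lemma lform_axis: "lform a (axis i c) = a $ i * c"
proof -
  have "lform a (axis i c) = (\<Sum>j\<in>UNIV. if j = i then a $ i * c else 0)"
    unfolding lform_def by (rule sum.cong) (auto simp: axis_def)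
  then show ?thesis by simp
qed

text \<open>A balanced set around 0 in which the form takes the place of coordinate \<open>i\<close>
  and has its own width \<open>r\<close>. Moved to a point where the form differs from
  \<open>b\<close> by at least \<open>r\<close>, it misses the hyperplane; for fixed
  \<open>d\<close> its volume is still at least a multiple of \<open>r\<^sup>2\<close> when
  \<open>a $ i \<noteq> 0\<close>.\<close>

definition slab :: "complex^'n \<Rightarrow> 'n \<Rightarrow> real \<Rightarrow> real \<Rightarrow> (complex^'n) set" where
  "slab a i d r = {w. (\<forall>j. j \<noteq> i \<longrightarrow> cmod (w $ j) < d) \<and> cmod (lform a w) < r}"

lemma open_slab: "open (slab a i d r)"
proof -
  have "slab a i d r = (\<Inter>j\<in>- {i}. {w. cmod (w $ j) < d}) \<inter> {w. cmod (lform a w) < r}"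
    by (auto simp: slab_def)
  moreover have "open {w. cmod (w $ j) < d}" for j by (intro open_Collect_less continuous_intros)
  moreover have "open {w. cmod (lform a w) < r}" by (intro open_Collect_less continuous_intros)
  ultimately show ?thesis by (simp only:) (intro open_Int open_INT, auto)
qed

lemma slab_balanced: "cmod c \<le> 1 \<Longrightarrow> v \<in> slab a i d r \<Longrightarrow> c *s v \<in> slab a i d r"
  by (auto simp: slab_def lform_smult norm_mult intro: le_less_trans[OF mult_left_le_one_le])


text \<open>\<open>T\<close> replaces coordinate \<open>i\<close> by the form and turns the slab
  into a product of discs. This product contains a box with two sides proportional to
  \<open>r\<close>, whence \<open>r\<^sup>2\<close> with \<open>c\<close> independent of
  \<open>r\<close>.\<close>

lemma slab_volume:
  fixes a :: "complex^'n"
  assumes ai: "a $ i \<noteq> 0" and d: "0 < d"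
  obtains c where "c > 0" "\<And>r. 0 < r \<Longrightarrow> emeasure lborel (slab a i d r) \<ge> c * ennreal (r\<^sup>2)"
proof -
  define T :: "complex^'n \<Rightarrow> complex^'n" where "T w = (\<chi> j. if j = i then lform a w else w $ j)" for w
  have lin: "linear T"
    by (rule linearI) (simp_all add: T_def vec_eq_iff lform_add lform_scaleR scaleR_conv_of_real[where 'a=complex])
  have "surj T"
  proof (rule surjI)
    fix u :: "complex^'n"
    have "lform a (u + axis i ((u $ i - lform a u) / a $ i)) = u $ i"
      using ai by (simp add: lform_add lform_axis)
    then show "T (u + axis i ((u $ i - lform a u) / a $ i)) = u"
      by (auto simp: T_def vec_eq_iff axis_def)
  qed
  then obtain c where c: "c > 0" "\<And>A. A \<in> sets borel \<Longrightarrow> emeasure lborel (T -` A) = c * emeasure lborel A"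
    using emeasure_linear_vimage[OF lin] by blast
  \<comment> \<open>Chosen so that \<open>e * r\<^sup>2\<close> is the volume of the box below: two
    sides \<open>r/2\<close>, the others \<open>d/2\<close>.\<close>
  define e where "e = (1/4) * (d/2) ^ (card (Basis - {axis i 1, axis i \<i>} :: (complex^'n) set))"
  have e: "e > 0" using d by (simp add: e_def)
  show thesis
  proof (rule that[of "c * ennreal e"])
    show "c * ennreal e > 0" using c e by (simp add: ennreal_zero_less_mult_iff)
    fix r :: real assume r: "0 < r"
    \<comment> \<open>Half lengths: a complex number whose real and imaginary parts lie between 0
      and \<open>s/2\<close> has modulus below \<open>s\<close>.\<close>
    define h where "h b = (if b \<in> {axis i 1, axis i \<i>} then r/2 else d/2)" for b :: "complex^'n"
    define u where "u = (\<Sum>b\<in>Basis. h b *\<^sub>R b)"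
    have ub: "u \<bullet> b = h b" if "b \<in> Basis" for b using that by (simp add: u_def)
    have hpos: "h b > 0" for b using r d by (simp add: h_def)
    have B: "axis i 1 \<in> (Basis :: (complex^'n) set)" "axis i \<i> \<in> (Basis :: (complex^'n) set)"
      by (auto simp: axis_in_Basis_iff Basis_complex_def)
    have ne: "axis i (1::complex) \<noteq> axis i \<i>" by (simp add: axis_eq_axis complex_eq_iff)
    have "emeasure lborel (box 0 u) = ennreal (\<Prod>b\<in>Basis. h b)"
      using hpos by (simp add: emeasure_lborel_box_eq ub less_imp_le)
    also have "(\<Prod>b\<in>Basis. h b) = (\<Prod>b\<in>{axis i 1, axis i \<i>}. h b) * (\<Prod>b\<in>Basis - {axis i 1, axis i \<i>}. h b)"
      using B by (subst prod.union_disjoint[symmetric]) (auto intro!: prod.cong)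
    also have "(\<Prod>b\<in>{axis i 1, axis i \<i>}. h b) = (r/2)\<^sup>2" using ne by (simp add: h_def power2_eq_square)
    also have "(\<Prod>b\<in>Basis - {axis i 1, axis i \<i>}. h b) = 4 * e"
      unfolding e_def by (simp add: prod_constant[symmetric] h_def del: prod_constant)
    also have "(r/2)\<^sup>2 * (4 * e) = e * r\<^sup>2" by (simp add: power2_eq_square)
    finally have vol: "emeasure lborel (box 0 u) = ennreal e * ennreal (r\<^sup>2)" using e by (simp add: ennreal_mult)
    have sub: "T -` box 0 u \<subseteq> {w. (\<forall>j. j \<noteq> i \<longrightarrow> cmod (w $ j) < d) \<and> cmod (lform a w) < r}"
    proof
      fix w assume "w \<in> T -` box 0 u"
      then have *: "0 < T w \<bullet> b" "T w \<bullet> b < h b" if "b \<in> Basis" for b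
        using that by (auto simp: box_def ub)
      have comp: "cmod (T w $ j) < s" if "\<And>k. k \<in> Basis \<Longrightarrow> h (axis j k) \<le> s/2" for j s
      proof -
        have "axis j 1 \<in> (Basis :: (complex^'n) set)" "axis j \<i> \<in> (Basis :: (complex^'n) set)"
          by (auto simp: axis_in_Basis_iff Basis_complex_def)
        from *[OF this(1)] *[OF this(2)] that[of 1] that[of \<i>]
        have "0 < Re (T w $ j)" "Re (T w $ j) < s/2" "0 < Im (T w $ j)" "Im (T w $ j) < s/2"
          by (auto simp: inner_axis Basis_complex_def)
        then show ?thesis using cmod_le[of "T w $ j"] by linarith
      qed
      have "cmod (T w $ i) < r" by (rule comp) (auto simp: h_def Basis_complex_def)
      moreover have "cmod (T w $ j) < d" if "j \<noteq> i" for j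
        using that by (intro comp) (auto simp: h_def Basis_complex_def axis_eq_axis)
      ultimately show "w \<in> {w. (\<forall>j. j \<noteq> i \<longrightarrow> cmod (w $ j) < d) \<and> cmod (lform a w) < r}"
        by (auto simp: T_def) 
    qed
    note op = open_slab[of a i d r, unfolded slab_def]
    have "c * ennreal e * ennreal (r\<^sup>2) = emeasure lborel (T -` box 0 u)" using c(2)[of "box 0 u"] vol by (simp add: mult.assoc)
    also have "\<dots> \<le> emeasure lborel {w. (\<forall>j. j \<noteq> i \<longrightarrow> cmod (w $ j) < d) \<and> cmod (lform a w) < r}"
      using sub op by (intro emeasure_mono) auto
    finally show "emeasure lborel (slab a i d r) \<ge> c * ennreal e * ennreal (r\<^sup>2)" unfolding slab_def .
  qed
qed

section \<open>Removable singularities along a hyperplane\<close>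

text \<open>A closed \<open>e\<close>-neighbourhood of the compact curve
  \<open>z + \<gamma> t\<close> is compact in \<open>H\<close>, so one bound \<open>M\<close> holds
  near all its points. The remainder estimates with this \<open>M\<close> are integrated over
  \<open>t\<close>, and the integral of the differentials is the differential.\<close>

lemma holomorphic_Cn_integral:
  fixes f :: "complex^'n \<Rightarrow> complex"
  assumes hol: "holomorphic_Cn f H" and H: "open H" and \<gamma>: "continuous_on {0..1::real} \<gamma>"
    and sub: "\<And>t. t \<in> {0..1} \<Longrightarrow> z + \<gamma> t \<in> H"
  shows "\<exists>L. ((\<lambda>z. integral {0..1} (\<lambda>t. f (z + \<gamma> t))) has_derivative L) (at z) \<and> (\<forall>c v. L (c *s v) = c * L v)"
proof -
  define K where "K = (\<lambda>t. z + \<gamma> t) ` {0..1}"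
  have K: "compact K" "K \<subseteq> H" unfolding K_def
    using sub \<gamma> by (auto intro!: compact_continuous_image continuous_intros)
  obtain e where e: "e > 0" "(\<Union>x\<in>K. cball x e) \<subseteq> H"
    using compact_subset_open_imp_cball_epsilon_subset[OF K(1) H K(2)] by metis
  have "compact {x + y | x y. x \<in> K \<and> y \<in> cball 0 e}" by (rule compact_sums[OF K(1) compact_cball])
  moreover have eq: "{x + y | x y. x \<in> K \<and> y \<in> cball 0 e} = (\<Union>x\<in>K. cball x e)"
  proof (intro set_eqI iffI)
    fix p assume "p \<in> (\<Union>x\<in>K. cball x e)"
    then obtain x where "x \<in> K" "dist x p \<le> e" by auto
    then show "p \<in> {x + y | x y. x \<in> K \<and> y \<in> cball 0 e}"
      by (intro CollectI exI[of _ x] exI[of _ "p - x"]) (auto simp: dist_norm norm_minus_commute)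
  qed (force simp: dist_norm)
  ultimately have "compact (f ` (\<Union>x\<in>K. cball x e))"
    by (intro compact_continuous_image continuous_on_subset[OF holomorphic_Cn_continuous_on[OF hol] e(2)]) simp
  then have "bounded (f ` (\<Union>x\<in>K. cball x e))" by (rule compact_imp_bounded)
  then obtain M where "\<forall>y\<in>f ` (\<Union>x\<in>K. cball x e). cmod y \<le> M" unfolding bounded_iff by blast
  then have M: "cmod (f p) \<le> M" if "p \<in> (\<Union>x\<in>K. cball x e)" for p using that by blast
  have ballK: "ball (x + z) e \<subseteq> (\<Union>x\<in>K. cball x e)" "ball (x + z) e \<subseteq> H" if "x \<in> \<gamma> ` {0..1}" for x
  proof -
    have "x + z \<in> K" using that by (auto simp: K_def add.commute)
    then show "ball (x + z) e \<subseteq> (\<Union>x\<in>K. cball x e)" using ball_subset_cball by blast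
    then show "ball (x + z) e \<subseteq> H" using e(2) by blast
  qed
  define L where "L h = integral {0..1} (\<lambda>t. hderiv f (z + \<gamma> t) h)" for h
  have contf: "continuous_on H f" by (rule holomorphic_Cn_continuous_on[OF hol])
  have cont1: "continuous_on {0..1} (\<lambda>t. hderiv f (z + \<gamma> t) h)" for h
    using sub by (intro continuous_on_compose2[OF holomorphic_Cn_continuous_on[OF holomorphic_Cn_hderiv[OF hol H]]]
        continuous_intros \<gamma>) auto
  note int1 = integrable_continuous_real[OF cont1]
  have int2: "(\<lambda>t. f (z + h + \<gamma> t)) integrable_on {0..1}" if "norm h < e" for h
  proof (intro integrable_continuous_real continuous_on_compose2[OF contf] continuous_intros \<gamma>)
    show "(\<lambda>t. z + h + \<gamma> t) ` {0..1} \<subseteq> H"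
    proof clarify
      fix t assume t: "t \<in> {0..1::real}"
      have "z + h + \<gamma> t \<in> ball (\<gamma> t + z) e" using that by (simp add: dist_norm)
      then show "z + h + \<gamma> t \<in> H" using ballK(2)[of "\<gamma> t"] t by blast
    qed
  qed
  have bl: "bounded_linear (hderiv f (z + \<gamma> t))" if "t \<in> {0..1}" for t
    using bounded_linear_hderiv[OF hol H sub[OF that]] .
  have Lc: "L (c *s v) = c * L v" for c v
  proof -
    have "L (c *s v) = integral {0..1} (\<lambda>t. c * hderiv f (z + \<gamma> t) v)"
      unfolding L_def by (rule integral_cong) (use hderiv_smult[OF hol H sub] in auto)
    then show ?thesis by (simp add: L_def)
  qed
  have "linear L"
  proof (rule linearI)
    fix x y
    have "L (x + y) = integral {0..1} (\<lambda>t. hderiv f (z + \<gamma> t) x + hderiv f (z + \<gamma> t) y)"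
      unfolding L_def by (rule integral_cong) (use linear_simps(1)[OF bl] in auto)
    then show "L (x + y) = L x + L y" unfolding L_def by (simp add: integral_add int1)
  next
    fix c x show "L (c *\<^sub>R x) = c *\<^sub>R L x"
      using Lc[of "of_real c" x] by (simp only: of_real_smult scaleR_conv_of_real[where 'a=complex])
  qed
  then have "bounded_linear L" by (simp add: linear_conv_bounded_linear)
  moreover have "cmod (integral {0..1} (\<lambda>t. f (z + h + \<gamma> t)) - integral {0..1} (\<lambda>t. f (z + \<gamma> t)) - L h)
      \<le> (8 * M / e\<^sup>2) * (norm h)\<^sup>2" if h: "norm h < e/4" for h
  proof -
    have he: "norm h < e" using h e by linarith
    note i2 = int2[OF he] and i0 = int2[of 0, simplified, OF e(1)]
    have "integral {0..1} (\<lambda>t. f (z + h + \<gamma> t)) - integral {0..1} (\<lambda>t. f (z + \<gamma> t)) - L h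
      = integral {0..1} (\<lambda>t. f (z + h + \<gamma> t) - f (z + \<gamma> t) - hderiv f (z + \<gamma> t) h)"
      unfolding L_def by (simp add: integral_diff i2 i0 int1 integrable_diff)
    also have "cmod \<dots> \<le> integral {0..1} (\<lambda>t::real. (8 * M / e\<^sup>2) * (norm h)\<^sup>2)"
    proof (rule integral_norm_bound_integral)
      fix t assume t: "t \<in> {0..1::real}"
      have eq: "z + \<gamma> t = \<gamma> t + z" by simp
      have "cmod (f (\<gamma> t + z + h) - f (\<gamma> t + z) - hderiv f (\<gamma> t + z) h) \<le> 8 * M * (norm h)\<^sup>2 / e\<^sup>2"
      proof (rule hderiv_remainder)
        show "holomorphic_Cn f (ball (\<gamma> t + z) e)" using ballK(2)[of "\<gamma> t"] t hol holomorphic_Cn_subset by blast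
        show "0 < e" by fact
        show "norm h \<le> e/4" using h by simp
        fix x assume "x \<in> ball (\<gamma> t + z) e"
        then show "cmod (f x) \<le> M" using ballK(1)[of "\<gamma> t"] t M by blast
      qed
      then show "cmod (f (z + h + \<gamma> t) - f (z + \<gamma> t) - hderiv f (z + \<gamma> t) h) \<le> (8 * M / e\<^sup>2) * (norm h)\<^sup>2"
        by (simp add: algebra_simps)
    qed (use i2 i0 int1 in \<open>auto intro!: integrable_diff\<close>)
    finally show ?thesis by simp
  qed
  ultimately have "((\<lambda>z. integral {0..1} (\<lambda>t. f (z + \<gamma> t))) has_derivative L) (at z)"
    by (intro has_derivative_quadratic[where r="e/4" and C="8 * M / e\<^sup>2"]) (use e in auto)
  then show ?thesis using Lc by blast
qed

text \<open>The extension is the circular mean of \<open>f\<close> in a direction transversal to the hyperplane, so it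
  can be differentiated under the integral sign by the quadratic remainder estimate.\<close>

theorem removable_hyperplane:
  fixes \<Omega> S :: "(complex^'n) set"
  assumes \<Omega>: "open \<Omega>" and S: "S = {z. lform a z = b}" and e: "lform a e = 1"
    and hol: "holomorphic_Cn f (\<Omega> - S)"
    and lim: "\<And>q. q \<in> \<Omega> \<inter> S \<Longrightarrow> ((\<lambda>\<zeta>. \<zeta> * f (q + \<zeta> *s e)) \<longlongrightarrow> 0) (at 0)"
  obtains F where "holomorphic_Cn F \<Omega>" "\<And>z. z \<in> \<Omega> - S \<Longrightarrow> F z = f z"
    "\<And>z. z \<in> \<Omega> \<Longrightarrow> \<exists>\<gamma>. continuous_on {0..1::real} \<gamma> \<and> (\<forall>t\<in>{0..1}. z + \<gamma> t \<in> \<Omega> - S) \<and>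
        F z = integral {0..1} (\<lambda>t. f (z + \<gamma> t))"
proof -
  have "closed S" unfolding S using continuous_on_lform[OF continuous_on_id]
    by (intro closed_Collect_eq continuous_intros)
  then have H: "open (\<Omega> - S)" using \<Omega> by (simp add: open_Diff)
  \<comment> \<open>At points of \<open>\<Omega> \<inter> S\<close> this \<open>Lim\<close> is a
    genuine limit: \<open>slice\<close> identifies it with the value of the one-variable extension
    along \<open>e\<close>.\<close>
  define F where "F z = (if z \<in> S then Lim (at 0) (\<lambda>\<zeta>. f (z + \<zeta> *s e)) else f z)" for z
  define E where "E = norm e + 1"
  have E: "E > 0" "norm e \<le> E" by (auto simp: E_def add_nonneg_pos)
  have slice: "\<exists>g. g holomorphic_on {\<zeta>. z + \<zeta> *s e \<in> \<Omega>} \<and> (\<forall>\<zeta>. z + \<zeta> *s e \<in> \<Omega> - S \<longrightarrow> g \<zeta> = f (z + \<zeta> *s e)) \<and> g 0 = F z"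
    and open_slice: "open {\<zeta>. z + \<zeta> *s e \<in> \<Omega>}"
    if z: "z \<in> \<Omega>" for z
  proof -
    define U where "U = {\<zeta>. z + \<zeta> *s e \<in> \<Omega>}"
    have "continuous_on UNIV (\<lambda>\<zeta>. z + \<zeta> *s e)" by (intro continuous_intros)
    then have U: "open U" unfolding U_def using \<Omega> open_vimage[of \<Omega> "\<lambda>\<zeta>. z + \<zeta> *s e"] by (simp add: vimage_def)
    then show "open {\<zeta>. z + \<zeta> *s e \<in> \<Omega>}" by (simp add: U_def)
    \<comment> \<open>The only parameter at which the line through \<open>z\<close> in direction
      \<open>e\<close> meets \<open>S\<close>, because \<open>lform a e = 1\<close>.\<close>
    define \<zeta>0 where "\<zeta>0 = b - lform a z"
    have inS: "z + \<zeta> *s e \<in> S \<longleftrightarrow> \<zeta> = \<zeta>0" for \<zeta>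
      by (auto simp: S lform_add lform_smult e \<zeta>0_def)
    have hg: "(\<lambda>\<zeta>. f (z + \<zeta> *s e)) holomorphic_on U - {\<zeta>0}"
      by (rule holomorphic_on_slice[OF hol H]) (auto simp: U_def inS)
    have 0: "0 \<in> U" using z by (simp add: U_def)
    obtain g where g: "g holomorphic_on U" "\<And>\<zeta>. \<zeta> \<in> U - {\<zeta>0} \<Longrightarrow> g \<zeta> = f (z + \<zeta> *s e)"
    proof (cases "\<zeta>0 \<in> U")
      case True
      define q where "q = z + \<zeta>0 *s e"
      have "q \<in> \<Omega> \<inter> S" using True inS[of \<zeta>0] by (auto simp: q_def U_def)
      from lim[OF this] have "((\<lambda>\<zeta>. (\<zeta> - \<zeta>0) * f (q + (\<zeta> - \<zeta>0) *s e)) \<longlongrightarrow> 0) (at \<zeta>0)"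
        using LIM_offset_zero_iff[of "\<zeta>0" "\<lambda>\<zeta>. (\<zeta> - \<zeta>0) * f (q + (\<zeta> - \<zeta>0) *s e)" 0] by simp
      moreover have "q + (\<zeta> - \<zeta>0) *s e = z + \<zeta> *s e" for \<zeta>
        by (simp add: q_def vec_eq_iff algebra_simps)
      ultimately have "((\<lambda>\<zeta>. (\<zeta> - \<zeta>0) * f (z + \<zeta> *s e)) \<longlongrightarrow> 0) (at \<zeta>0)" by (simp only:)
      then show thesis using holomorphic_on_extend_lim[OF hg] True U that by (auto simp: interior_open)
    next
      case False
      then show thesis using hg that by auto
    qed
    have g0: "g 0 = F z"
    proof (cases "z \<in> S")
      case True
      then have z0: "\<zeta>0 = 0" using inS[of 0] by simp
      have "(g \<longlongrightarrow> g 0) (at 0)"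
        using holomorphic_on_imp_continuous_on[OF g(1)] U 0 by (simp add: continuous_on_eq_continuous_at isCont_def)
      moreover have "eventually (\<lambda>\<zeta>. \<zeta> \<in> U - {0}) (at 0)"
        using eventually_at_in_open[OF U 0] .
      then have "eventually (\<lambda>\<zeta>. g \<zeta> = f (z + \<zeta> *s e)) (at 0)"
        by eventually_elim (use g(2) z0 in auto)
      ultimately have "((\<lambda>\<zeta>. f (z + \<zeta> *s e)) \<longlongrightarrow> g 0) (at 0)" by (simp add: tendsto_cong)
      then show ?thesis using True by (simp add: F_def tendsto_Lim)
    next
      case False
      then have "\<zeta>0 \<noteq> 0" using inS[of 0] by auto
      then show ?thesis using g(2)[of 0] 0 False by (simp add: F_def)
    qed
    show "\<exists>g. g holomorphic_on {\<zeta>. z + \<zeta> *s e \<in> \<Omega>} \<and> (\<forall>\<zeta>. z + \<zeta> *s e \<in> \<Omega> - S \<longrightarrow> g \<zeta> = f (z + \<zeta> *s e)) \<and> g 0 = F z"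
      using g g0 inS by (intro exI[of _ g]) (auto simp: U_def)
  qed
  have local: "\<exists>\<gamma> \<rho>. \<rho> > 0 \<and> continuous_on {0..1::real} \<gamma> \<and> (\<forall>t\<in>{0..1}. z0 + \<gamma> t \<in> \<Omega> - S) \<and>
       (\<forall>z\<in>ball z0 \<rho>. F z = integral {0..1} (\<lambda>t. f (z + \<gamma> t)))" if z0: "z0 \<in> \<Omega>" for z0
  proof -
    obtain R where R: "R > 0" "ball z0 R \<subseteq> \<Omega>" using \<Omega> z0 open_contains_ball by blast
    \<comment> \<open>Shifts \<open>\<zeta> *s e\<close> with \<open>cmod \<zeta> \<le> s\<close>
      have norm at most \<open>R/4\<close>, which fits beside the \<open>R/2\<close> allowed for
      \<open>z\<close> in the ball of radius \<open>R\<close>.\<close>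
    define s where "s = R / (4 * E)"
    have s: "s > 0" using R E by (simp add: s_def)
    define \<beta> where "\<beta> = cmod (b - lform a z0)"
    \<comment> \<open>The circle of radius \<open>r\<close> about \<open>z0\<close> in direction
      \<open>e\<close> meets \<open>S\<close> only if \<open>r = \<beta>\<close>, so a different
      radius is taken. The gap \<open>k\<close> keeps the same circle off \<open>S\<close> for all
      centres at which the form moves by less than \<open>k\<close>.\<close>
    define r where "r = (if s = \<beta> then s/2 else s)"
    have r: "r > 0" "r \<le> s" "r \<noteq> \<beta>" using s by (auto simp: r_def)
    define k where "k = \<bar>r - \<beta>\<bar>"
    have "open {z. cmod (lform a z - lform a z0) < k}" by (intro open_Collect_less continuous_intros)
    moreover have "z0 \<in> {z. cmod (lform a z - lform a z0) < k}" using r by (simp add: k_def)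
    ultimately obtain \<rho>1 where \<rho>1: "\<rho>1 > 0" "ball z0 \<rho>1 \<subseteq> {z. cmod (lform a z - lform a z0) < k}"
      using open_contains_ball by blast
    define \<rho> where "\<rho> = min \<rho>1 (R/2)"
    have \<rho>: "\<rho> > 0" using \<rho>1 R by (simp add: \<rho>_def)
    define c where "c t = of_real r * exp (2 * of_real pi * \<i> * complex_of_real t)" for t
    have cc: "cmod (c t) = r" for t using r by (simp add: c_def norm_mult)
    define \<gamma> where "\<gamma> t = c t *s e" for t
    have in\<Omega>: "z + \<zeta> *s e \<in> \<Omega>" if "z \<in> ball z0 \<rho>" "cmod \<zeta> \<le> r" for z \<zeta>
    proof -
      have "norm (\<zeta> *s e) \<le> s * E" unfolding norm_vector_smult
        using that r E s by (intro mult_mono) auto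
      also have "\<dots> = R/4" using E by (simp add: s_def)
      finally have "dist z0 (z + \<zeta> *s e) < R/2 + R/4" 
        using dist_add_le[of z0 z "\<zeta> *s e"] that(1) by (simp add: \<rho>_def)
      then show ?thesis using R by auto
    qed
    have notS: "z + \<gamma> t \<notin> S" if "z \<in> ball z0 \<rho>" for z t
    proof
      assume "z + \<gamma> t \<in> S"
      then have "c t = (b - lform a z0) - (lform a z - lform a z0)" by (simp add: S \<gamma>_def lform_add lform_smult e algebra_simps)
      then have "cmod (c t - (b - lform a z0)) < k" using that \<rho>1 by (auto simp: \<rho>_def norm_minus_commute)
      moreover have "\<bar>cmod (c t) - \<beta>\<bar> \<le> cmod (c t - (b - lform a z0))" unfolding \<beta>_def by (rule norm_triangle_ineq3)
      ultimately show False by (simp add: cc k_def)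
    qed
    have F: "F z = integral {0..1} (\<lambda>t. f (z + \<gamma> t))" if z: "z \<in> ball z0 \<rho>" for z
    proof -
      have "z \<in> \<Omega>" using in\<Omega>[OF z, of 0] r by simp
      from slice[OF this] obtain g where g: "g holomorphic_on {\<zeta>. z + \<zeta> *s e \<in> \<Omega>}"
        "\<And>\<zeta>. z + \<zeta> *s e \<in> \<Omega> - S \<Longrightarrow> g \<zeta> = f (z + \<zeta> *s e)" "g 0 = F z" by blast
      have "((\<lambda>t. g (c t)) has_integral g 0) {0..1}"
        unfolding c_def by (rule circle_mean_value[OF g(1) _ r(1)]) (use in\<Omega>[OF z] in auto)
      moreover have "g (c t) = f (z + \<gamma> t)" for t
        using g(2)[of "c t"] in\<Omega>[OF z, of "c t"] notS[OF z, of t] cc by (simp add: \<gamma>_def)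
      ultimately show ?thesis using g(3) by (simp add: integral_unique)
    qed
    have "continuous_on {0..1} \<gamma>" unfolding \<gamma>_def c_def by (intro continuous_intros)
    moreover have "\<forall>t\<in>{0..1}. z0 + \<gamma> t \<in> \<Omega> - S"
      using notS[of z0] in\<Omega>[of z0 "c _"] cc \<rho> by (simp add: \<gamma>_def)
    ultimately show ?thesis using F \<rho> by blast
  qed
  show thesis
  proof (rule that[of F])
    show "F z = f z" if "z \<in> \<Omega> - S" for z using that by (simp add: F_def)
    show "\<exists>\<gamma>. continuous_on {0..1::real} \<gamma> \<and> (\<forall>t\<in>{0..1}. z + \<gamma> t \<in> \<Omega> - S) \<and>
        F z = integral {0..1} (\<lambda>t. f (z + \<gamma> t))" if z: "z \<in> \<Omega>" for z
    proof -
      obtain \<gamma> \<rho> where "\<rho> > 0" "continuous_on {0..1::real} \<gamma>" "\<forall>t\<in>{0..1}. z + \<gamma> t \<in> \<Omega> - S"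
       "\<forall>z\<in>ball z \<rho>. F z = integral {0..1} (\<lambda>t. f (z + \<gamma> t))" using local[OF z] by blast
      then show ?thesis by auto
    qed
    show "holomorphic_Cn F \<Omega>" unfolding holomorphic_Cn_iff[OF \<Omega>]
    proof
      fix z assume z: "z \<in> \<Omega>"
      obtain \<gamma> \<rho> where *: "\<rho> > 0" "continuous_on {0..1::real} \<gamma>" "\<And>t. t\<in>{0..1} \<Longrightarrow> z + \<gamma> t \<in> \<Omega> - S"
       "\<And>x. x\<in>ball z \<rho> \<Longrightarrow> F x = integral {0..1} (\<lambda>t. f (x + \<gamma> t))" using local[OF z] by blast
      from holomorphic_Cn_integral[OF hol H *(2,3)] obtain L where
        L: "((\<lambda>z. integral {0..1} (\<lambda>t. f (z + \<gamma> t))) has_derivative L) (at z)" "\<forall>c v. L (c *s v) = c * L v" by blast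
      have "(F has_derivative L) (at z)"
        by (rule has_derivative_transform_within[OF L(1) *(1)]) (use * in \<open>auto simp: dist_commute\<close>)
      then show "\<exists>L. (F has_derivative L) (at z) \<and> (\<forall>c v. L (c *s v) = c * L v)" using L(2) by blast
    qed
  qed
qed

section \<open>Extension of bounded and of square-integrable functions\<close>

lemma complex_hyperplaneE:
  fixes S :: "(complex^'n) set"
  assumes "complex_hyperplane S"
  obtains a b i where "a $ i \<noteq> 0" "S = {z. lform a z = b}"
proof -
  obtain a b where "a \<noteq> 0" "S = {z. lform a z = b}"
    using assms unfolding complex_hyperplane_def lform_def by blast
  then show thesis using that by (metis vec_eq_iff zero_index)
qed

lemma closed_hyperplane: "closed {z. lform a z = b}"
  by (intro closed_Collect_eq continuous_intros)

text \<open>The set lies in the real hyperplane where the real part of the form equals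
  \<open>Re b\<close>; \<open>a'\<close> carries the conjugates that the real inner product puts on
  one factor.\<close>

lemma hyperplane_null_sets:
  assumes "a $ i \<noteq> 0" shows "{z. lform a z = b} \<in> null_sets lborel"
proof -
  define a' where "a' = (\<chi> i. cnj (a $ i))"
  have "a' $ i \<noteq> 0 $ i" using assms by (simp add: a'_def)
  then have "a' \<noteq> 0" by metis
  then have "negligible {x. a' \<bullet> x = Re b}" by (intro negligible_hyperplane) simp
  moreover have "Re (lform a z) = a' \<bullet> z" for z
    by (simp add: lform_def inner_vec_def a'_def inner_complex_def)
  then have "{z. lform a z = b} \<subseteq> {x. a' \<bullet> x = Re b}" by auto
  ultimately have "negligible {z. lform a z = b}" by (rule negligible_subset)
  moreover have "{z. lform a z = b} \<in> sets lborel" using closed_hyperplane[of a b] by simp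
  ultimately show ?thesis
    by (simp add: negligible_iff_null_sets null_sets_completion_iff)
qed

text \<open>Boundedness makes \<open>\<zeta> * f\<close> tend to 0 at once. The strict bound for the
  extension comes from the mean representation: on a compact curve that avoids \<open>S\<close>, the
  modulus of \<open>f\<close> attains a maximum, which is below 1.\<close>

lemma bounded_extension:
  fixes \<Omega> S :: "(complex^'n) set"
  assumes \<Omega>: "open \<Omega>" and S: "complex_hyperplane S"
    and hol: "holomorphic_Cn f (\<Omega> - S)" and bd: "f ` (\<Omega> - S) \<subseteq> ball 0 1"
  obtains F where "holomorphic_Cn F \<Omega>" "\<And>z. z \<in> \<Omega> - S \<Longrightarrow> F z = f z" "F ` \<Omega> \<subseteq> ball 0 1"
proof -
  obtain a b i where ai: "a $ i \<noteq> 0" and S': "S = {z. lform a z = b}" using complex_hyperplaneE[OF S] .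
  define e where "e = axis i (1 / a $ i)"
  have e: "lform a e = 1" using ai by (simp add: e_def lform_axis)
  have lim: "((\<lambda>\<zeta>. \<zeta> * f (q + \<zeta> *s e)) \<longlongrightarrow> 0) (at 0)" if q: "q \<in> \<Omega> \<inter> S" for q
  proof (rule Lim_null_comparison)
    have "continuous_on UNIV (\<lambda>\<zeta>. q + \<zeta> *s e)" by (intro continuous_intros)
    then have "open {\<zeta>. q + \<zeta> *s e \<in> \<Omega>}" using \<Omega> open_vimage[of \<Omega> "\<lambda>\<zeta>. q + \<zeta> *s e"] by (simp add: vimage_def)
    moreover have "0 \<in> {\<zeta>. q + \<zeta> *s e \<in> \<Omega>}" using q by simp
    ultimately have "eventually (\<lambda>\<zeta>. \<zeta> \<in> {\<zeta>. q + \<zeta> *s e \<in> \<Omega>} - {0}) (at 0)" by (rule eventually_at_in_open)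
    then show "eventually (\<lambda>\<zeta>. norm (\<zeta> * f (q + \<zeta> *s e)) \<le> norm \<zeta>) (at 0)"
    proof eventually_elim
      case (elim \<zeta>)
      then have "q + \<zeta> *s e \<in> \<Omega> - S" using q by (auto simp: S' lform_add lform_smult e)
      then have "cmod (f (q + \<zeta> *s e)) < 1" using bd by auto
      then show ?case by (simp add: norm_mult mult_left_le)
    qed
    show "((\<lambda>\<zeta>. norm \<zeta>) \<longlongrightarrow> 0) (at (0::complex))" by (auto intro!: tendsto_eq_intros)
  qed
  obtain F where F: "holomorphic_Cn F \<Omega>" "\<And>z. z \<in> \<Omega> - S \<Longrightarrow> F z = f z"
    "\<And>z. z \<in> \<Omega> \<Longrightarrow> \<exists>\<gamma>. continuous_on {0..1::real} \<gamma> \<and> (\<forall>t\<in>{0..1}. z + \<gamma> t \<in> \<Omega> - S) \<and>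
        F z = integral {0..1} (\<lambda>t. f (z + \<gamma> t))"
    using removable_hyperplane[OF \<Omega> S' e hol lim] by blast
  have "F z \<in> ball 0 1" if z: "z \<in> \<Omega>" for z
  proof -
    obtain \<gamma> where \<gamma>: "continuous_on {0..1::real} \<gamma>" "\<forall>t\<in>{0..1}. z + \<gamma> t \<in> \<Omega> - S" "F z = integral {0..1} (\<lambda>t. f (z + \<gamma> t))"
      using F(3)[OF z] by blast
    have c: "continuous_on {0..1} (\<lambda>t. f (z + \<gamma> t))"
      using \<gamma>(1,2) by (intro continuous_on_compose2[OF holomorphic_Cn_continuous_on[OF hol]] continuous_intros) auto
    have "\<exists>x\<in>{0..1}. \<forall>y\<in>{0..1}. cmod (f (z + \<gamma> y)) \<le> cmod (f (z + \<gamma> x))"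
      by (rule continuous_attains_sup) (use c in \<open>auto intro: continuous_intros\<close>)
    then obtain x where x: "x \<in> {0..1}" "\<And>y. y \<in> {0..1} \<Longrightarrow> cmod (f (z + \<gamma> y)) \<le> cmod (f (z + \<gamma> x))" by blast
    have "cmod (F z) \<le> integral {0..1} (\<lambda>t::real. cmod (f (z + \<gamma> x)))"
      unfolding \<gamma>(3) by (rule integral_norm_bound_integral) (use x(2) c in \<open>auto intro: integrable_continuous_real\<close>)
    also have "\<dots> = cmod (f (z + \<gamma> x))" by simp
    also have "f (z + \<gamma> x) \<in> ball 0 1" using \<gamma>(2) x(1) bd by blast
    then have "cmod (f (z + \<gamma> x)) < 1" by simp
    finally show ?thesis by simp
  qed
  then show thesis using that F by blast
qed

text \<open>\<open>lform a w\<close> and the other coordinates determine \<open>w $ i\<close> at the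
  cost of the factor \<open>(1 + A) / cmod (a $ i)\<close>; the \<open>+ 1\<close> in
  \<open>C\<close> makes \<open>C * d\<close> a bound for every coordinate. Summing over
  \<open>N\<close> coordinates gives \<open>\<rho> / 2\<close>.\<close>

lemma slab_subset_ball:
  fixes a :: "complex^'n"
  assumes ai: "a $ i \<noteq> 0" and \<rho>: "\<rho> > 0"
  obtains d where "d > 0" "slab a i d d \<subseteq> ball 0 \<rho>"
proof -
  define A where "A = (\<Sum>j\<in>UNIV. cmod (a $ j))"
  have A: "A \<ge> 0" by (simp add: A_def sum_nonneg)
  define C where "C = (1 + A) / cmod (a $ i) + 1"
  have C: "C \<ge> 1" using A by (simp add: C_def)
  define N where "N = real (CARD('n))"
  have N: "N > 0" by (simp add: N_def)
  define d where "d = \<rho> / (2 * N * C)"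
  have d: "d > 0" using \<rho> N C by (simp add: d_def)
  have "norm w < \<rho>" if w: "w \<in> slab a i d d" for w
  proof -
    have wj: "cmod (w $ j) < d" if "j \<noteq> i" for j using w that by (simp add: slab_def)
    have "a $ i * w $ i = lform a w - (\<Sum>j\<in>UNIV - {i}. a $ j * w $ j)"
      unfolding lform_def by (subst sum.remove[of UNIV i]) auto
    then have "cmod (a $ i) * cmod (w $ i) \<le> cmod (lform a w) + cmod (\<Sum>j\<in>UNIV - {i}. a $ j * w $ j)"
      by (metis norm_mult norm_triangle_ineq4)
    also have "cmod (\<Sum>j\<in>UNIV - {i}. a $ j * w $ j) \<le> (\<Sum>j\<in>UNIV - {i}. cmod (a $ j) * d)"
      proof (rule sum_norm_le)
        fix j assume "j \<in> UNIV - {i}"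
        then have "cmod (w $ j) \<le> d" using wj[of j] by simp
        then show "cmod (a $ j * w $ j) \<le> cmod (a $ j) * d" by (simp add: norm_mult mult_left_mono)
      qed
    also have "\<dots> \<le> (\<Sum>j\<in>UNIV. cmod (a $ j) * d)" by (rule sum_mono2) (use d in auto)
    also have "\<dots> = A * d" by (simp add: A_def sum_distrib_right)
    also have "cmod (lform a w) < d" using w by (simp add: slab_def)
    finally have "cmod (a $ i) * cmod (w $ i) \<le> (1 + A) * d" by (simp add: algebra_simps)
    then have "cmod (w $ i) \<le> (1 + A) / cmod (a $ i) * d" using ai by (simp add: field_simps)
    also have "\<dots> \<le> C * d" using d by (simp add: C_def distrib_right)
    finally have wi: "cmod (w $ i) \<le> C * d" .
    have "cmod (w $ j) \<le> C * d" for j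
    proof (cases "j = i")
      case False
      have "1 * d \<le> C * d" using C d by (intro mult_right_mono) auto
      then show ?thesis using wj[OF False] by linarith
    qed (use wi in simp)
    then have "(\<Sum>j\<in>UNIV. cmod (w $ j)) \<le> (\<Sum>j\<in>(UNIV::'n set). C * d)" by (intro sum_mono)
    moreover have "norm w \<le> (\<Sum>j\<in>UNIV. cmod (w $ j))" unfolding norm_vec_def by (rule L2_set_le_sum) auto
    ultimately have "norm w \<le> N * (C * d)" by (simp add: N_def)
    also have "\<dots> = \<rho> / 2" using N C by (simp add: d_def)
    finally show ?thesis using \<rho> by linarith
  qed
  then have "slab a i d d \<subseteq> ball 0 \<rho>" by (simp add: subset_iff)
  then show thesis by (rule that[OF d])
qed

lemma slab_mono: "r \<le> r' \<Longrightarrow> slab a i d r \<subseteq> slab a i d r'"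
  by (auto simp: slab_def)

lemma holomorphic_Cn_measurable:
  assumes "holomorphic_Cn f G" "open G"
  shows "(\<lambda>x. indicator G x *\<^sub>R f x) \<in> borel_measurable borel"
  using assms by (intro borel_measurable_continuous_on_indicator holomorphic_Cn_continuous_on) auto

text \<open>On the slab of width \<open>cmod \<zeta>\<close> about \<open>q + \<zeta> *s e\<close>
  the form differs from \<open>b\<close> by \<zeta> plus a smaller term, so the slab misses
  \<open>S\<close> and stays where this difference is below \<open>2 * cmod \<zeta>\<close>. The
  mean value inequality bounds \<open>(cmod (\<zeta> * f))\<^sup>2\<close> by a multiple of
  \<open>I (2 * cmod \<zeta>)\<close>, which tends to 0 by dominated convergence because
  \<open>\<phi>\<close> vanishes on \<open>S\<close>.\<close>

lemma square_integrable_pole_bound: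
  fixes \<Omega> S :: "(complex^'n) set"
  assumes \<Omega>: "open \<Omega>" and ai: "a $ i \<noteq> 0" and S: "S = {z. lform a z = b}" and e: "lform a e = 1"
    and f: "f \<in> bergman_space (\<Omega> - S)" and q: "q \<in> \<Omega> \<inter> S"
  shows "((\<lambda>\<zeta>. \<zeta> * f (q + \<zeta> *s e)) \<longlongrightarrow> 0) (at 0)"
proof -
  have H: "open (\<Omega> - S)" using \<Omega> closed_hyperplane[of a b] by (simp add: S open_Diff)
  have hol: "holomorphic_Cn f (\<Omega> - S)" using f by (simp add: bergman_space_def)
  define \<phi> where "\<phi> x = ennreal ((cmod (indicator (\<Omega> - S) x *\<^sub>R f x))\<^sup>2)" for x
  have \<phi>m [measurable]: "\<phi> \<in> borel_measurable borel"
    unfolding \<phi>_def using holomorphic_Cn_measurable[OF hol H] by measurable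
  have "integrable lborel (\<lambda>x. indicator (\<Omega> - S) x *\<^sub>R (cmod (f x))\<^sup>2)"
    using f by (simp add: bergman_space_def set_integrable_def)
  then have "(\<integral>\<^sup>+x. ennreal (norm (indicator (\<Omega> - S) x *\<^sub>R (cmod (f x))\<^sup>2)) \<partial>lborel) < \<infinity>"
    by (simp add: integrable_iff_bounded)
  moreover have "ennreal (norm (indicator (\<Omega> - S) x *\<^sub>R (cmod (f x))\<^sup>2)) = \<phi> x" for x
    by (auto simp: \<phi>_def indicator_def)
  ultimately have \<phi>fin: "(\<integral>\<^sup>+x. \<phi> x \<partial>lborel) < \<infinity>" by simp
  obtain \<rho> where \<rho>: "\<rho> > 0" "ball q \<rho> \<subseteq> \<Omega>" using \<Omega> q open_contains_ball by blast
  obtain d where d: "d > 0" "slab a i d d \<subseteq> ball 0 (\<rho>/2)" using slab_subset_ball[OF ai, of "\<rho>/2"] \<rho> by auto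
  obtain c0 where c0: "c0 > 0" "\<And>r. 0 < r \<Longrightarrow> emeasure lborel (slab a i d r) \<ge> c0 * ennreal (r\<^sup>2)"
    using slab_volume[OF ai d(1)] by blast
  \<comment> \<open>\<open>c0\<close> is positive but possibly infinite; a value strictly below it
    is finite and yields a real constant.\<close>
  obtain c1 where c1: "0 < c1" "c1 < c0" using dense[OF c0(1)] by blast
  define c where "c = enn2real c1"
  have "c1 < top" using c1(2) top_greatest by (rule less_le_trans)
  then have c1c: "c1 = ennreal c" by (simp add: c_def)
  have c: "c > 0" using c1 c1c by (metis ennreal_0 ennreal_less_zero_iff)
  define I where "I r = (\<integral>\<^sup>+x. \<phi> x * indicator {x. cmod (lform a x - b) < r} x \<partial>lborel)" for r
  \<comment> \<open>The first entry keeps the slab inside \<open>slab a i d d\<close>, the second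
    keeps \<open>\<zeta> *s e\<close> shorter than \<open>\<rho> / 2\<close>.\<close>
  define \<eta> where "\<eta> = min d (\<rho> / (2 * (norm e + 1)))"
  have \<eta>: "\<eta> > 0" using d \<rho> by (simp add: \<eta>_def add_nonneg_pos)
  have bound: "ennreal (c * (cmod (\<zeta> * f (q + \<zeta> *s e)))\<^sup>2) \<le> I (2 * cmod \<zeta>)"
    if \<zeta>: "\<zeta> \<noteq> 0" "cmod \<zeta> < \<eta>" for \<zeta>
  proof -
    define z where "z = q + \<zeta> *s e"
    define N where "N = slab a i d (cmod \<zeta>)"
    have lz: "lform a z - b = \<zeta>" using q by (simp add: z_def lform_add lform_smult e S)
    have "N \<subseteq> slab a i d d" unfolding N_def using \<zeta> by (intro slab_mono) (simp add: \<eta>_def)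
    then have N: "N \<subseteq> ball 0 (\<rho>/2)" using d(2) by blast
    have "norm (\<zeta> *s e) < \<rho>/2"
    proof -
      have "cmod \<zeta> * norm e \<le> cmod \<zeta> * (norm e + 1)" by (intro mult_left_mono) auto
      also have "\<dots> < \<eta> * (norm e + 1)" using \<zeta> by (intro mult_strict_right_mono) (auto simp: add_nonneg_pos)
      also have "\<dots> \<le> \<rho> / (2 * (norm e + 1)) * (norm e + 1)" by (intro mult_right_mono) (auto simp: \<eta>_def)
      also have "\<dots> = \<rho>/2" using norm_ge_zero[of e] by (simp add: field_simps add_nonneg_eq_0_iff)
      finally show ?thesis by (simp add: norm_vector_smult)
    qed
    then have zin: "z + v \<in> \<Omega>" if "v \<in> N" for v
    proof -
      have "norm v < \<rho>/2" using N that by auto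
      then have "dist q (z + v) < \<rho>" using dist_add_le[of q z v] dist_add_le[of q q "\<zeta> *s e"] \<open>norm (\<zeta> *s e) < \<rho>/2\<close>
        by (simp add: z_def)
      then show ?thesis using \<rho> by auto
    qed
    have lv: "lform a (z + v) - b = \<zeta> + lform a v" for v using lz by (simp add: lform_add algebra_simps)
    have zS: "z + v \<notin> S" if "v \<in> N" for v
    proof
      assume "z + v \<in> S"
      then have "lform a v = - \<zeta>" using lv[of v] by (simp add: S eq_neg_iff_add_eq_0 add.commute)
      then show False using that by (simp add: N_def slab_def)
    qed
    have "ennreal (c * (cmod (\<zeta> * f z))\<^sup>2) = ennreal ((cmod (f z))\<^sup>2) * (ennreal c * ennreal ((cmod \<zeta>)\<^sup>2))"
      using c by (simp add: norm_mult power_mult_distrib mult.commute mult.left_commute flip: ennreal_mult)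
    also have "\<dots> \<le> ennreal ((cmod (f z))\<^sup>2) * emeasure lborel N"
    proof (rule mult_left_mono)
      have "ennreal c * ennreal ((cmod \<zeta>)\<^sup>2) \<le> c0 * ennreal ((cmod \<zeta>)\<^sup>2)"
        using c1 c1c by (intro mult_right_mono) auto
      also have "\<dots> \<le> emeasure lborel N" unfolding N_def using \<zeta> by (intro c0(2)) simp
      finally show "ennreal c * ennreal ((cmod \<zeta>)\<^sup>2) \<le> emeasure lborel N" .
    qed simp
    also have "\<dots> \<le> (\<integral>\<^sup>+v. ennreal ((cmod (f (z + v)))\<^sup>2) * indicator N v \<partial>lborel)"
      by (rule mean_value_inequality[OF hol H]) (use zin zS in \<open>auto simp: N_def open_slab slab_balanced\<close>)
    also have "\<dots> \<le> (\<integral>\<^sup>+v. \<phi> (z + v) * indicator {x. cmod (lform a x - b) < 2 * cmod \<zeta>} (z + v) \<partial>lborel)"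
    proof (rule nn_integral_mono)
      fix v
      show "ennreal ((cmod (f (z + v)))\<^sup>2) * indicator N v \<le> \<phi> (z + v) * indicator {x. cmod (lform a x - b) < 2 * cmod \<zeta>} (z + v)"
      proof (cases "v \<in> N")
        case True
        then have "cmod (lform a v) < cmod \<zeta>" by (simp add: N_def slab_def)
        then have "cmod (lform a (z + v) - b) < 2 * cmod \<zeta>" unfolding lv using norm_triangle_ineq[of \<zeta> "lform a v"] by linarith
        then show ?thesis using True zin zS by (simp add: \<phi>_def)
      qed simp
    qed
    also have "\<dots> = I (2 * cmod \<zeta>)" unfolding I_def
    proof (rule nn_integral_lborel_translate)
      have [measurable]: "{x. cmod (lform a x - b) < 2 * cmod \<zeta>} \<in> sets borel"
        by (intro borel_open open_Collect_less continuous_intros)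
      show "(\<lambda>x. \<phi> x * indicator {x. cmod (lform a x - b) < 2 * cmod \<zeta>} x) \<in> borel_measurable borel" by measurable
    qed
    finally show ?thesis by (simp add: z_def)
  qed
  have I0: "(\<lambda>n. I (2 * cmod (X n))) \<longlonglongrightarrow> 0" if X: "X \<longlonglongrightarrow> 0" for X :: "nat \<Rightarrow> complex"
  proof -
    have X2: "(\<lambda>n. 2 * cmod (X n)) \<longlonglongrightarrow> 0" using X by (auto intro!: tendsto_eq_intros)
    have "(\<lambda>n. \<integral>\<^sup>+x. \<phi> x * indicator {x. cmod (lform a x - b) < 2 * cmod (X n)} x \<partial>lborel) \<longlonglongrightarrow> (\<integral>\<^sup>+(x::complex^'n). 0 \<partial>lborel)"
    proof (rule nn_integral_dominated_convergence[where w=\<phi>])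
      have [measurable]: "{x. cmod (lform a x - b) < 2 * cmod (X n)} \<in> sets borel" for n
        by (intro borel_open open_Collect_less continuous_intros)
      show "(\<lambda>x. \<phi> x * indicator {x. cmod (lform a x - b) < 2 * cmod (X n)} x) \<in> borel_measurable lborel" for n by measurable
      show "AE x in lborel. (\<lambda>n. \<phi> x * indicator {x. cmod (lform a x - b) < 2 * cmod (X n)} x) \<longlonglongrightarrow> 0"
      proof (rule AE_I2)
        fix x
        show "(\<lambda>n. \<phi> x * indicator {x. cmod (lform a x - b) < 2 * cmod (X n)} x) \<longlonglongrightarrow> 0"
        proof (cases "x \<in> S")
          case True
          then show ?thesis by (simp add: \<phi>_def)
        next
          case False
          then have "cmod (lform a x - b) > 0" by (simp add: S)
          from order_tendstoD(2)[OF X2 this]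
          have "eventually (\<lambda>n. \<phi> x * indicator {x. cmod (lform a x - b) < 2 * cmod (X n)} x = 0) sequentially"
            by eventually_elim simp
          then show ?thesis by (rule tendsto_eventually)
        qed
      qed
    qed (use \<phi>fin in \<open>auto simp: indicator_def\<close>)
    then show ?thesis by (simp add: I_def)
  qed
  show ?thesis unfolding tendsto_at_iff_sequentially
  proof (intro allI impI)
    fix X :: "nat \<Rightarrow> complex" assume X: "\<forall>i. X i \<in> UNIV - {0}" "X \<longlonglongrightarrow> 0"
    define Y where "Y n = X n * f (q + X n *s e)" for n
    have "eventually (\<lambda>n. cmod (X n) < \<eta>) sequentially"
      using order_tendstoD(2)[OF tendsto_norm[OF X(2)], of \<eta>] \<eta> by simp
    then have ev: "eventually (\<lambda>n. ennreal (c * (cmod (Y n))\<^sup>2) \<le> I (2 * cmod (X n))) sequentially"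
      by eventually_elim (use bound X in \<open>auto simp: Y_def\<close>)
    have "(\<lambda>n. ennreal (c * (cmod (Y n))\<^sup>2)) \<longlonglongrightarrow> 0"
      by (rule tendsto_sandwich[OF _ ev tendsto_const I0[OF X(2)]]) simp
    then have "(\<lambda>n. c * (cmod (Y n))\<^sup>2) \<longlonglongrightarrow> 0"
      using c by (simp flip: ennreal_0 add: tendsto_ennreal_iff)
    then have "(\<lambda>n. sqrt (inverse c * (c * (cmod (Y n))\<^sup>2))) \<longlonglongrightarrow> sqrt (inverse c * 0)"
      by (intro tendsto_intros)
    moreover have "inverse c * (c * x) = x" for x :: real using c by simp
    ultimately have "Y \<longlonglongrightarrow> 0" by (simp add: tendsto_norm_zero_iff)
    then show "((\<lambda>\<zeta>. \<zeta> * f (q + \<zeta> *s e)) \<circ> X) \<longlonglongrightarrow> 0" by (simp add: comp_def Y_def[abs_def])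
  qed
qed

lemma AE_not_in_hyperplane:
  assumes "complex_hyperplane S" shows "AE x in lborel. x \<notin> S"
proof -
  obtain a b i where "a $ i \<noteq> 0" "S = {z. lform a z = b}" using complex_hyperplaneE[OF assms] .
  then have "S \<in> null_sets lborel" using hyperplane_null_sets by blast
  then show ?thesis by (rule AE_not_in)
qed

lemma set_integrable_Diff_hyperplane:
  fixes g :: "complex^'n \<Rightarrow> 'b::{banach,second_countable_topology}"
  assumes S: "complex_hyperplane S"
    and m: "(\<lambda>x. indicator \<Omega> x *\<^sub>R g x) \<in> borel_measurable lborel" "(\<lambda>x. indicator (\<Omega> - S) x *\<^sub>R h x) \<in> borel_measurable lborel"
    and eq: "\<And>z. z \<in> \<Omega> - S \<Longrightarrow> g z = h z"
  shows "set_integrable lborel \<Omega> g \<longleftrightarrow> set_integrable lborel (\<Omega> - S) h"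
    and "(LINT z:\<Omega>|lborel. g z) = (LINT z:\<Omega> - S|lborel. h z)"
proof -
  have ae: "AE x in lborel. indicator \<Omega> x *\<^sub>R g x = indicator (\<Omega> - S) x *\<^sub>R h x"
    using AE_not_in_hyperplane[OF S] by eventually_elim (auto simp: indicator_def eq)
  show "set_integrable lborel \<Omega> g \<longleftrightarrow> set_integrable lborel (\<Omega> - S) h"
    unfolding set_integrable_def by (rule integrable_cong_AE[OF m ae])
  show "(LINT z:\<Omega>|lborel. g z) = (LINT z:\<Omega> - S|lborel. h z)"
    unfolding set_lebesgue_integral_def by (rule integral_cong_AE[OF m ae])
qed

lemma open_Diff_hyperplane:
  assumes "open \<Omega>" "complex_hyperplane S" shows "open (\<Omega> - S)"
proof -
  obtain a b i where "a $ i \<noteq> 0" "S = {z. lform a z = b}" using complex_hyperplaneE[OF assms(2)] .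
  then show ?thesis using assms(1) by (simp add: open_Diff closed_hyperplane)
qed

lemma holomorphic_Cn_measurable_norm:
  assumes "holomorphic_Cn f G" "open G"
  shows "(\<lambda>x. indicator G x *\<^sub>R (cmod (f x))\<^sup>2) \<in> borel_measurable lborel"
  unfolding measurable_lborel2 using assms
  by (intro borel_measurable_continuous_on_indicator continuous_intros holomorphic_Cn_continuous_on) auto

lemma bergman_space_Diff:
  assumes \<Omega>: "open \<Omega>" and S: "complex_hyperplane S" and F: "holomorphic_Cn F \<Omega>"
    and eq: "\<And>z. z \<in> \<Omega> - S \<Longrightarrow> F z = f z"
  shows "f \<in> bergman_space (\<Omega> - S) \<longleftrightarrow> F \<in> bergman_space \<Omega>"
proof -
  note H = open_Diff_hyperplane[OF \<Omega> S]
  have hf: "holomorphic_Cn f (\<Omega> - S)"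
    using holomorphic_Cn_subset[OF F, of "\<Omega> - S"] holomorphic_Cn_cong[of "\<Omega> - S" F f] eq by blast
  have "set_integrable lborel \<Omega> (\<lambda>z. (cmod (F z))\<^sup>2) \<longleftrightarrow> set_integrable lborel (\<Omega> - S) (\<lambda>z. (cmod (f z))\<^sup>2)"
    by (rule set_integrable_Diff_hyperplane(1)[OF S holomorphic_Cn_measurable_norm[OF F \<Omega>] holomorphic_Cn_measurable_norm[OF hf H]])
       (simp add: eq)
  then show ?thesis using F hf by (simp add: bergman_space_def)
qed

lemma bergman_space_extension:
  assumes \<Omega>: "open \<Omega>" and S: "complex_hyperplane S" and f: "f \<in> bergman_space (\<Omega> - S)"
  obtains F where "F \<in> bergman_space \<Omega>" "\<And>z. z \<in> \<Omega> - S \<Longrightarrow> F z = f z"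
proof -
  obtain a b i where ai: "a $ i \<noteq> 0" and S': "S = {z. lform a z = b}" using complex_hyperplaneE[OF S] .
  define e where "e = axis i (1 / a $ i)"
  have e: "lform a e = 1" using ai by (simp add: e_def lform_axis)
  have hol: "holomorphic_Cn f (\<Omega> - S)" using f by (simp add: bergman_space_def)
  show thesis
  proof (rule removable_hyperplane[OF \<Omega> S' e hol])
    show "((\<lambda>\<zeta>. \<zeta> * f (q + \<zeta> *s e)) \<longlongrightarrow> 0) (at 0)" if "q \<in> \<Omega> \<inter> S" for q
      by (rule square_integrable_pole_bound[OF \<Omega> ai S' e f that])
    fix F assume F: "holomorphic_Cn F \<Omega>" "\<And>z. z \<in> \<Omega> - S \<Longrightarrow> F z = f z"
    have "F \<in> bergman_space \<Omega>" using f bergman_space_Diff[OF \<Omega> S F(1), of f] F(2) by simp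
    then show thesis using F(2) by (rule that)
  qed
qed

section \<open>The Bergman kernel\<close>

definition bnorm2 :: "(complex^'n) set \<Rightarrow> (complex^'n \<Rightarrow> complex) \<Rightarrow> real" where
  "bnorm2 G f = (LINT z:G|lborel. (cmod (f z))\<^sup>2)"

definition binner :: "(complex^'n) set \<Rightarrow> (complex^'n \<Rightarrow> complex) \<Rightarrow> (complex^'n \<Rightarrow> complex) \<Rightarrow> complex" where
  "binner G f g = (LINT z:G|lborel. f z * cnj (g z))"

lemma bergman_space_cong:
  assumes "\<And>z. z \<in> G \<Longrightarrow> f z = g z" shows "f \<in> bergman_space G \<longleftrightarrow> g \<in> bergman_space G"
proof -
  have "set_integrable lborel G (\<lambda>z. (cmod (f z))\<^sup>2) \<longleftrightarrow> set_integrable lborel G (\<lambda>z. (cmod (g z))\<^sup>2)"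
    unfolding set_integrable_def by (rule Bochner_Integration.integrable_cong) (auto simp: indicator_def assms)
  then show ?thesis unfolding bergman_space_def using holomorphic_Cn_cong[OF assms, of G] by simp
qed

lemma binner_cong:
  assumes "\<And>z. z \<in> G \<Longrightarrow> f z = f' z" "\<And>z. z \<in> G \<Longrightarrow> g z = g' z"
  shows "binner G f g = binner G f' g'"
  unfolding binner_def set_lebesgue_integral_def
  by (rule Bochner_Integration.integral_cong) (auto simp: indicator_def assms)

context
  fixes G :: "(complex^'n) set"
  assumes G: "open G"
begin

lemma bergman_mult_integrable:
  assumes f: "f \<in> bergman_space G" and g: "g \<in> bergman_space G"
  shows "set_integrable lborel G (\<lambda>z. f z * cnj (g z))"
  unfolding set_integrable_def
proof (rule Bochner_Integration.integrable_bound)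
  show "integrable lborel (\<lambda>z. indicator G z *\<^sub>R (cmod (f z))\<^sup>2 + indicator G z *\<^sub>R (cmod (g z))\<^sup>2)"
    using f g by (intro Bochner_Integration.integrable_add) (simp_all add: bergman_space_def set_integrable_def)
  show "(\<lambda>z. indicator G z *\<^sub>R (f z * cnj (g z))) \<in> borel_measurable lborel"
    using f g G unfolding measurable_lborel2
    by (intro borel_measurable_continuous_on_indicator continuous_intros holomorphic_Cn_continuous_on) (auto simp: bergman_space_def)
  have "x * y \<le> x\<^sup>2 + y\<^sup>2" for x y :: real
    using sum_squares_bound[of x y] zero_le_power2[of x] zero_le_power2[of y] by linarith
  then show "AE z in lborel. norm (indicator G z *\<^sub>R (f z * cnj (g z))) \<le> norm (indicator G z *\<^sub>R (cmod (f z))\<^sup>2 + indicator G z *\<^sub>R (cmod (g z))\<^sup>2)"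
    by (intro AE_I2) (auto simp: indicator_def norm_mult)
qed

lemma bergman_space_add:
  assumes f: "f \<in> bergman_space G" and g: "g \<in> bergman_space G"
  shows "(\<lambda>z. f z + g z) \<in> bergman_space G"
proof -
  have hol: "holomorphic_Cn (\<lambda>z. f z + g z) G" using f g by (auto simp: bergman_space_def intro: holomorphic_Cn_add)
  have "integrable lborel (\<lambda>z. indicator G z *\<^sub>R (cmod (f z + g z))\<^sup>2)"
  proof (rule Bochner_Integration.integrable_bound)
    show "integrable lborel (\<lambda>z. 2 * (indicator G z *\<^sub>R (cmod (f z))\<^sup>2) + 2 * (indicator G z *\<^sub>R (cmod (g z))\<^sup>2))"
      using f g by (intro Bochner_Integration.integrable_add Bochner_Integration.integrable_mult_right) (simp_all add: bergman_space_def set_integrable_def)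
    show "(\<lambda>z. indicator G z *\<^sub>R (cmod (f z + g z))\<^sup>2) \<in> borel_measurable lborel"
      by (rule holomorphic_Cn_measurable_norm[OF hol G])
    have "(cmod (x + y))\<^sup>2 \<le> 2 * (cmod x)\<^sup>2 + 2 * (cmod y)\<^sup>2" for x y
    proof -
      have "(cmod (x + y))\<^sup>2 \<le> (cmod x + cmod y)\<^sup>2" by (intro power_mono norm_triangle_ineq) auto
      then show ?thesis using sum_squares_bound[of "cmod x" "cmod y"] by (simp add: power2_sum)
    qed
    then show "AE z in lborel. norm (indicator G z *\<^sub>R (cmod (f z + g z))\<^sup>2) \<le> norm (2 * (indicator G z *\<^sub>R (cmod (f z))\<^sup>2) + 2 * (indicator G z *\<^sub>R (cmod (g z))\<^sup>2))"
      by (intro AE_I2) (auto simp: indicator_def)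
  qed
  then show ?thesis using hol by (simp add: bergman_space_def set_integrable_def)
qed

lemma bergman_space_cmult:
  assumes f: "f \<in> bergman_space G" shows "(\<lambda>z. c * f z) \<in> bergman_space G"
proof -
  have "set_integrable lborel G (\<lambda>z. (cmod c)\<^sup>2 * (cmod (f z))\<^sup>2)"
    using f by (intro set_integrable_mult_right) (simp add: bergman_space_def)
  then show ?thesis using f by (auto simp: bergman_space_def norm_mult power_mult_distrib intro: holomorphic_Cn_mult)
qed

lemma binner_add_left:
  assumes "f \<in> bergman_space G" "g \<in> bergman_space G" "h \<in> bergman_space G"
  shows "binner G (\<lambda>z. f z + g z) h = binner G f h + binner G g h"
  unfolding binner_def using set_integral_add(2)[OF bergman_mult_integrable[OF assms(1,3)] bergman_mult_integrable[OF assms(2,3)]]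
  by (simp add: distrib_right)

lemma binner_cmult_left: "binner G (\<lambda>z. c * f z) h = c * binner G f h"
  unfolding binner_def by (simp add: mult.assoc)

lemma binner_cmult_right: "binner G f (\<lambda>z. c * h z) = cnj c * binner G f h"
  unfolding binner_def by (simp add: mult.left_commute)

lemma binner_commute: "binner G f g = cnj (binner G g f)"
proof -
  have "cnj (binner G g f) = (LINT z|lborel. cnj (indicator G z *\<^sub>R (g z * cnj (f z))))"
    unfolding binner_def set_lebesgue_integral_def by (rule Bochner_Integration.integral_cnj[symmetric])
  also have "\<dots> = binner G f g" unfolding binner_def set_lebesgue_integral_def
    by (rule Bochner_Integration.integral_cong) (auto simp: mult.commute)
  finally show ?thesis by simp
qed

lemma binner_self: "binner G f f = of_real (bnorm2 G f)"
  unfolding binner_def bnorm2_def set_lebesgue_integral_def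
  by (subst integral_complex_of_real[symmetric], rule Bochner_Integration.integral_cong)
     (auto simp: scaleR_conv_of_real complex_norm_square simp del: of_real_power)

lemma bnorm2_nonneg: "bnorm2 G f \<ge> 0"
  unfolding bnorm2_def set_lebesgue_integral_def by (rule Bochner_Integration.integral_nonneg) auto

lemma bnorm2_cmult: "bnorm2 G (\<lambda>z. c * f z) = (cmod c)\<^sup>2 * bnorm2 G f"
  unfolding bnorm2_def by (simp add: norm_mult power_mult_distrib)

lemma bnorm2_add:
  assumes f: "f \<in> bergman_space G" and g: "g \<in> bergman_space G"
  shows "bnorm2 G (\<lambda>z. f z + g z) = bnorm2 G f + 2 * Re (binner G g f) + bnorm2 G g"
proof -
  have "binner G (\<lambda>z. f z + g z) (\<lambda>z. f z + g z)
      = cnj (binner G (\<lambda>z. f z + g z) f) + cnj (binner G (\<lambda>z. f z + g z) g)"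
    by (metis binner_add_left binner_commute bergman_space_add f g complex_cnj_add)
  also have "\<dots> = cnj (binner G f f) + cnj (binner G g f) + (binner G g f + cnj (binner G g g))"
    using binner_commute[of f g] by (simp add: binner_add_left f g)
  finally have "Re (binner G (\<lambda>z. f z + g z) (\<lambda>z. f z + g z)) = bnorm2 G f + 2 * Re (binner G g f) + bnorm2 G g"
    by (simp add: binner_self)
  then show ?thesis by (simp add: binner_self)
qed

lemma bergman_nn_integral:
  assumes f: "f \<in> bergman_space G"
  shows "(\<integral>\<^sup>+z. ennreal ((cmod (f z))\<^sup>2) * indicator G z \<partial>lborel) = ennreal (bnorm2 G f)"
proof -
  have "integrable lborel (\<lambda>z. indicator G z *\<^sub>R (cmod (f z))\<^sup>2)" using f by (simp add: bergman_space_def set_integrable_def)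
  from nn_integral_eq_integral[OF this] have "(\<integral>\<^sup>+z. ennreal (indicator G z *\<^sub>R (cmod (f z))\<^sup>2) \<partial>lborel) = ennreal (bnorm2 G f)"
    by (simp add: bnorm2_def set_lebesgue_integral_def)
  moreover have "ennreal (indicator G z *\<^sub>R (cmod (f z))\<^sup>2) = ennreal ((cmod (f z))\<^sup>2) * indicator G z" for z
    by (auto simp: indicator_def)
  ultimately show ?thesis by simp
qed

lemma bergman_spaceI_nn:
  assumes hol: "holomorphic_Cn f G"
    and le: "(\<integral>\<^sup>+z. ennreal ((cmod (f z))\<^sup>2) * indicator G z \<partial>lborel) \<le> ennreal m" and m: "m \<ge> 0"
  shows "f \<in> bergman_space G" "bnorm2 G f \<le> m"
proof -
  have eq: "ennreal (norm (indicator G z *\<^sub>R (cmod (f z))\<^sup>2)) = ennreal ((cmod (f z))\<^sup>2) * indicator G z" for z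
    by (auto simp: indicator_def)
  have "integrable lborel (\<lambda>z. indicator G z *\<^sub>R (cmod (f z))\<^sup>2)"
    unfolding integrable_iff_bounded eq
    using holomorphic_Cn_measurable_norm[OF hol G] le le_less_trans[OF le] by simp
  then show f: "f \<in> bergman_space G" using hol by (simp add: bergman_space_def set_integrable_def)
  show "bnorm2 G f \<le> m" using le bergman_nn_integral[OF f] m by (simp add: ennreal_le_iff)
qed

text \<open>The dimension is fixed by the type in the context, so outside the context this constant
  takes a \<open>TYPE\<close> argument.\<close>

definition ball_vol :: "real \<Rightarrow> real" where "ball_vol r = measure lborel (ball (0::complex^'n) r)"

lemma ball_vol_pos: "r > 0 \<Longrightarrow> ball_vol r > 0"
  using emeasure_lborel_ball_pos[of r "0::complex^'n"] emeasure_lborel_ball_finite[of "0::complex^'n" r]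
  by (simp add: ball_vol_def measure_def enn2real_positive_iff)

text \<open>The mean value inequality on a ball makes point evaluation bounded, with a constant that
  depends only on the radius; norm convergence therefore forces locally uniform convergence.\<close>

lemma bergman_point_bound:
  assumes f: "f \<in> bergman_space G" and r: "r > 0" "ball z r \<subseteq> G"
  shows "(cmod (f z))\<^sup>2 \<le> bnorm2 G f / ball_vol r"
proof -
  have hol: "holomorphic_Cn f G" using f by (simp add: bergman_space_def)
  have zG: "z + v \<in> G" if "v \<in> ball 0 r" for v using r(2) that by (auto simp: subset_iff dist_norm)
  have fin: "emeasure lborel (ball (0::complex^'n) r) = ennreal (ball_vol r)"
    unfolding ball_vol_def using emeasure_lborel_ball_finite[of "0::complex^'n" r] by (intro emeasure_eq_ennreal_measure) auto
  have "ennreal ((cmod (f z))\<^sup>2) * ennreal (ball_vol r) \<le> (\<integral>\<^sup>+v. ennreal ((cmod (f (z + v)))\<^sup>2) * indicator (ball 0 r) v \<partial>lborel)"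
    unfolding fin[symmetric]
    by (rule mean_value_inequality[OF hol G open_ball])
       (use zG in \<open>auto simp: norm_vector_smult intro: le_less_trans[OF mult_left_le_one_le]\<close>)
  also have "\<dots> \<le> (\<integral>\<^sup>+v. ennreal ((cmod (f (z + v)))\<^sup>2) * indicator G (z + v) \<partial>lborel)"
    by (rule nn_integral_mono) (use zG in \<open>auto simp: indicator_def\<close>)
  also have "\<dots> = (\<integral>\<^sup>+v. ennreal ((cmod (f v))\<^sup>2) * indicator G v \<partial>lborel)"
  proof (rule nn_integral_lborel_translate)
    have "(\<lambda>z. ennreal (indicator G z *\<^sub>R (cmod (f z))\<^sup>2)) \<in> borel_measurable borel"
      using holomorphic_Cn_measurable_norm[OF hol G] by simp
    moreover have "(\<lambda>z. ennreal (indicator G z *\<^sub>R (cmod (f z))\<^sup>2)) = (\<lambda>z. ennreal ((cmod (f z))\<^sup>2) * indicator G z)"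
      by (auto simp: indicator_def)
    ultimately show "(\<lambda>v. ennreal ((cmod (f v))\<^sup>2) * indicator G v) \<in> borel_measurable borel" by (simp only:)
  qed
  also have "\<dots> = ennreal (bnorm2 G f)" by (rule bergman_nn_integral[OF f])
  finally have "(cmod (f z))\<^sup>2 * ball_vol r \<le> bnorm2 G f"
    using bnorm2_nonneg by (simp flip: ennreal_mult add: ennreal_le_iff ball_vol_def)
  then show ?thesis using ball_vol_pos[OF r(1)] by (simp add: field_simps)
qed

lemma bergman_space_const:
  assumes "bounded G" shows "(\<lambda>z. c) \<in> bergman_space G"
proof -
  have "emeasure lborel G < \<infinity>" using assms by (rule emeasure_bounded_finite)
  then show ?thesis using G by (simp add: bergman_space_def set_integrable_def integrable_mult_left_iff)
qed

text \<open>Direct method. The parallelogram law makes a minimising sequence Cauchy, since midpoints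
  again take the value 1 at \<open>w\<close>; point bounds turn this into locally uniform
  convergence, and Fatou's lemma bounds the squared norm of the limit by \<open>m\<close>.\<close>

lemma bergman_extremal:
  assumes bd: "bounded G" and w: "w \<in> G"
  obtains F where "F \<in> bergman_space G" "F w = 1"
    "\<And>f. f \<in> bergman_space G \<Longrightarrow> f w = 1 \<Longrightarrow> bnorm2 G F \<le> bnorm2 G f"
proof -
  define E where "E = {f \<in> bergman_space G. f w = 1}"
  have E1: "(\<lambda>z. 1) \<in> E" using bergman_space_const[OF bd] by (simp add: E_def)
  define m where "m = (INF f\<in>E. bnorm2 G f)"
  have bb: "bdd_below (bnorm2 G ` E)" using bnorm2_nonneg by (intro bdd_belowI[of _ 0]) auto
  have m: "m \<le> bnorm2 G f" if "f \<in> E" for f unfolding m_def using that bb by (intro cINF_lower)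
  have m0: "m \<ge> 0" unfolding m_def using E1 bnorm2_nonneg by (intro cINF_greatest) auto
  have "\<exists>f\<in>E. bnorm2 G f < m + 1 / real (Suc k)" for k
    using cINF_less_iff[of E "bnorm2 G" "m + 1 / real (Suc k)"] E1 bb by (auto simp: m_def)
  then obtain f where fE: "\<And>k. f k \<in> E" and fk: "\<And>k. bnorm2 G (f k) < m + 1 / real (Suc k)" by metis
  have fB: "f k \<in> bergman_space G" and fw: "f k w = 1" for k using fE[of k] by (auto simp: E_def)
  have dB: "(\<lambda>z. f j z - f k z) \<in> bergman_space G" for j k
    using bergman_space_add[OF fB[of j] bergman_space_cmult[OF fB[of k], of "-1"]] by simp
  \<comment> \<open>Parallelogram law: the squared norm is at most
    \<open>2 * (m + 1 / (j + 1)) + 2 * (m + 1 / (k + 1)) - 4 * m\<close>, where the last term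
    expresses that the midpoint has squared norm at least \<open>m\<close>.\<close>
  have d: "bnorm2 G (\<lambda>z. f j z - f k z) \<le> 4 / real (Suc n)" if "j \<ge> n" "k \<ge> n" for j k n
  proof -
    have s1: "bnorm2 G (\<lambda>z. f j z + f k z) = bnorm2 G (f j) + 2 * Re (binner G (f k) (f j)) + bnorm2 G (f k)"
      by (rule bnorm2_add) (rule fB)+
    have s2: "bnorm2 G (\<lambda>z. f j z + (-1) * f k z) = bnorm2 G (f j) - 2 * Re (binner G (f k) (f j)) + bnorm2 G (f k)"
      by (subst bnorm2_add[OF fB bergman_space_cmult[OF fB]]) (simp only: binner_cmult_left bnorm2_cmult, simp)
    have "(\<lambda>z. (1/2) * (f j z + f k z)) \<in> E"
  unfolding E_def mem_Collect_eq
      by (intro conjI bergman_space_cmult[OF bergman_space_add[OF fB fB]]) (simp add: fw)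
    from m[OF this] have "m \<le> bnorm2 G (\<lambda>z. f j z + f k z) / 4" by (simp only: bnorm2_cmult) (simp add: power2_eq_square)
    moreover have "1 / real (Suc j) \<le> 1 / real (Suc n)" "1 / real (Suc k) \<le> 1 / real (Suc n)"
      using that by (auto intro!: divide_left_mono)
    ultimately show ?thesis using s1 s2 fk[of j] fk[of k] by simp
  qed
  have pt: "cmod (f j z - f k z) \<le> sqrt (4 / real (Suc n) / ball_vol r)"
    if "j \<ge> n" "k \<ge> n" "r > 0" "ball z r \<subseteq> G" for j k n r z
  proof (rule real_le_rsqrt)
    have "(cmod (f j z - f k z))\<^sup>2 \<le> bnorm2 G (\<lambda>z. f j z - f k z) / ball_vol r"
      by (rule bergman_point_bound[OF dB that(3,4)])
    also have "\<dots> \<le> 4 / real (Suc n) / ball_vol r"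
      using d[OF that(1,2)] ball_vol_pos[OF that(3)] by (intro divide_right_mono) auto
    finally show "(cmod (f j z - f k z))\<^sup>2 \<le> 4 / real (Suc n) / ball_vol r" .
  qed
  have lim0: "(\<lambda>n. sqrt (4 / real (Suc n) / ball_vol r)) \<longlonglongrightarrow> 0" for r
  proof -
    have "(\<lambda>n. sqrt (inverse (real (Suc n)) * (4 / ball_vol r))) \<longlonglongrightarrow> sqrt (0 * (4 / ball_vol r))"
      by (intro tendsto_intros LIMSEQ_inverse_real_of_nat)
    then show ?thesis by (simp add: divide_inverse mult.commute mult.left_commute)
  qed
  define F where "F z = lim (\<lambda>k. f k z)" for z
  have F: "(\<lambda>k. f k z) \<longlonglongrightarrow> F z" if z: "z \<in> G" for z
  proof -
    obtain r where r: "r > 0" "ball z r \<subseteq> G" using G z open_contains_ball by blast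
    have "Cauchy (\<lambda>k. f k z)"
    proof (rule metric_CauchyI)
      fix e :: real assume "e > 0"
      then obtain n where "sqrt (4 / real (Suc n) / ball_vol r) < e"
        using order_tendstoD(2)[OF lim0] unfolding eventually_sequentially by blast
      then show "\<exists>M. \<forall>m\<ge>M. \<forall>n\<ge>M. dist (f m z) (f n z) < e"
        using le_less_trans[OF pt[OF _ _ r]] by (intro exI[of _ n]) (simp add: dist_norm)
    qed
    then show ?thesis by (simp add: F_def Cauchy_convergent_iff convergent_LIMSEQ_iff)
  qed
  have hol: "holomorphic_Cn F G"
  proof (rule holomorphic_Cn_uniform_limit[OF G])
    show "holomorphic_Cn (f k) G" for k using fB by (simp add: bergman_space_def)
    fix z assume "z \<in> G"
    then obtain R where R: "R > 0" "ball z R \<subseteq> G" using G open_contains_ball by blast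
    define r where "r = R/2"
    have r: "r > 0" "ball x r \<subseteq> G" if "x \<in> ball z r" for x
    proof -
      show "r > 0" using R by (simp add: r_def)
      have "ball x r \<subseteq> ball z R"
      proof
        fix y assume "y \<in> ball x r"
        then show "y \<in> ball z R" using that dist_triangle[of z y x] by (simp add: r_def)
      qed
      then show "ball x r \<subseteq> G" using R by blast
    qed
    have "uniform_limit (ball z r) f F sequentially"
      unfolding uniform_limit_iff
    proof (intro allI impI)
      fix e :: real assume "e > 0"
      from order_tendstoD(2)[OF lim0[of r] this]
      show "\<forall>\<^sub>F n in sequentially. \<forall>x\<in>ball z r. dist (f n x) (F x) < e"
      proof eventually_elim
        case (elim n)
        show ?case
        proof
          fix x assume x: "x \<in> ball z r"
          have "(\<lambda>k. cmod (f n x - f k x)) \<longlonglongrightarrow> cmod (f n x - F x)"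
            using r(2)[OF x] r(1)[OF x] by (intro tendsto_intros F) auto
          moreover have "\<forall>k\<ge>n. cmod (f n x - f k x) \<le> sqrt (4 / real (Suc n) / ball_vol r)"
            using pt[OF _ _ r[OF x]] by simp
          ultimately have "cmod (f n x - F x) \<le> sqrt (4 / real (Suc n) / ball_vol r)" by (meson LIMSEQ_le_const2)
          then show "dist (f n x) (F x) < e" using elim by (simp add: dist_norm)
        qed
      qed
    qed
    moreover have "r > 0" "ball z r \<subseteq> G" using R by (auto simp: r_def)
    ultimately show "\<exists>r>0. ball z r \<subseteq> G \<and> uniform_limit (ball z r) f F sequentially" by blast
  qed
  define \<phi> where "\<phi> f z = ennreal ((cmod (f z))\<^sup>2) * indicator G z" for f :: "complex^'n \<Rightarrow> complex" and z
  have \<phi>m: "\<phi> g \<in> borel_measurable lborel" if "holomorphic_Cn g G" for g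
  proof -
    have "(\<lambda>z. ennreal (indicator G z *\<^sub>R (cmod (g z))\<^sup>2)) \<in> borel_measurable lborel"
      using holomorphic_Cn_measurable_norm[OF that G] by simp
    moreover have "(\<lambda>z. ennreal (indicator G z *\<^sub>R (cmod (g z))\<^sup>2)) = \<phi> g"
      by (auto simp: indicator_def \<phi>_def)
    ultimately show ?thesis by (simp only:)
  qed
  have "(\<integral>\<^sup>+z. \<phi> F z \<partial>lborel) = (\<integral>\<^sup>+z. liminf (\<lambda>k. \<phi> (f k) z) \<partial>lborel)"
  proof (rule nn_integral_cong)
    fix z
    have "(\<lambda>k. \<phi> (f k) z) \<longlonglongrightarrow> \<phi> F z"
      by (cases "z \<in> G") (auto simp: \<phi>_def intro!: tendsto_intros F)
    then show "\<phi> F z = liminf (\<lambda>k. \<phi> (f k) z)" by (simp add: lim_imp_Liminf)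
  qed
  also have "\<dots> \<le> liminf (\<lambda>k. \<integral>\<^sup>+z. \<phi> (f k) z \<partial>lborel)"
    by (rule nn_integral_liminf) (use \<phi>m fB in \<open>auto simp: bergman_space_def\<close>)
  also have "\<dots> = liminf (\<lambda>k. ennreal (bnorm2 G (f k)))" by (simp add: \<phi>_def bergman_nn_integral[OF fB])
  also have "\<dots> \<le> liminf (\<lambda>k. ennreal (m + 1 / real (Suc k)))"
    by (intro Liminf_mono always_eventually allI ennreal_leI less_imp_le fk)
  also have "\<dots> = ennreal m"
  proof -
    have "(\<lambda>k. ennreal (m + 1 / real (Suc k))) \<longlonglongrightarrow> ennreal (m + 0)"
      using LIMSEQ_inverse_real_of_nat by (intro tendsto_intros) (simp add: inverse_eq_divide)
    then show ?thesis by (simp add: lim_imp_Liminf)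
  qed
  finally have le: "(\<integral>\<^sup>+z. ennreal ((cmod (F z))\<^sup>2) * indicator G z \<partial>lborel) \<le> ennreal m" by (simp add: \<phi>_def)
  show thesis
  proof (rule that)
    show "F \<in> bergman_space G" by (rule bergman_spaceI_nn(1)[OF hol le m0])
    show "F w = 1" using F[OF w] by (simp add: fw LIMSEQ_const_iff)
    show "bnorm2 G F \<le> bnorm2 G g" if "g \<in> bergman_space G" "g w = 1" for g
      using bergman_spaceI_nn(2)[OF hol le m0] m[of g] that by (simp add: E_def)
  qed
qed

text \<open>Minimality makes \<open>F\<close> orthogonal to all functions that vanish at
  \<open>w\<close>, among them \<open>f - f w * F\<close>. Hence the inner product of
  \<open>f\<close> with \<open>F\<close> is \<open>f w * bnorm2 G F\<close>, and \<open>F\<close>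
  divided by its squared norm reproduces.\<close>

lemma bergman_reproducing:
  assumes bd: "bounded G" and w: "w \<in> G"
  obtains k where "k \<in> bergman_space G" "\<And>f. f \<in> bergman_space G \<Longrightarrow> f w = binner G f k"
proof -
  obtain F where F: "F \<in> bergman_space G" "F w = 1"
    "\<And>f. f \<in> bergman_space G \<Longrightarrow> f w = 1 \<Longrightarrow> bnorm2 G F \<le> bnorm2 G f"
    by (rule bergman_extremal[OF bd w]) (rule that)
  have orth: "binner G g F = 0" if g: "g \<in> bergman_space G" "g w = 0" for g
  proof -
    define c where "c = binner G g F"
    \<comment> \<open>Step length for the variation \<open>F + t * g\<close> with
      \<open>t = - s * cnj c\<close>: to first order it lowers the squared norm by
      \<open>2 * s * (cmod c)\<^sup>2\<close>, and \<open>s * bnorm2 G g < 1\<close> keeps the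
      second-order term within half of that.\<close>
    define s where "s = 1 / (bnorm2 G g + 1)"
    have s: "s > 0" "s * bnorm2 G g < 1" using bnorm2_nonneg[of g] by (auto simp: s_def add_nonneg_pos)
    define t where "t = - complex_of_real s * cnj c"
    have "bnorm2 G F \<le> bnorm2 G (\<lambda>z. F z + t * g z)"
      by (rule F(3)) (use F g bergman_space_add bergman_space_cmult in auto)
    also have "\<dots> = bnorm2 G F + 2 * Re (t * c) + (cmod t)\<^sup>2 * bnorm2 G g"
      by (simp add: bnorm2_add[OF F(1) bergman_space_cmult[OF g(1)]] binner_cmult_left bnorm2_cmult c_def)
    also have "t * c = - of_real (s * (cmod c)\<^sup>2)"
      using complex_norm_square[of c] by (simp add: t_def mult.commute)
    also have "(cmod t)\<^sup>2 = s\<^sup>2 * (cmod c)\<^sup>2" by (simp add: t_def norm_mult power_mult_distrib)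
    finally have "2 * (s * (cmod c)\<^sup>2) \<le> s\<^sup>2 * (cmod c)\<^sup>2 * bnorm2 G g" by simp
    then have "s * (2 * (cmod c)\<^sup>2) \<le> s * ((s * bnorm2 G g) * (cmod c)\<^sup>2)" by (simp add: power2_eq_square mult_ac)
    then have "2 * (cmod c)\<^sup>2 \<le> (s * bnorm2 G g) * (cmod c)\<^sup>2" using s by simp
    also have "\<dots> \<le> 1 * (cmod c)\<^sup>2" using s by (intro mult_right_mono) auto
    finally have "(cmod c)\<^sup>2 \<le> 0" by simp
    then show ?thesis by (simp add: c_def)
  qed
  obtain r where r: "r > 0" "ball w r \<subseteq> G" using G w open_contains_ball by blast
  have "bnorm2 G F / ball_vol r \<ge> 1" using bergman_point_bound[OF F(1) r] F(2) by simp
  then have pos: "bnorm2 G F \<noteq> 0" by auto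
  define c where "c = complex_of_real (1 / bnorm2 G F)"
  show thesis
  proof (rule that[of "\<lambda>z. c * F z"])
    show "(\<lambda>z. c * F z) \<in> bergman_space G" by (rule bergman_space_cmult[OF F(1)])
    fix f assume f: "f \<in> bergman_space G"
    have fz: "(\<lambda>z. f z + - f w * F z) \<in> bergman_space G" by (intro bergman_space_add bergman_space_cmult f F(1))
    then have "0 = binner G (\<lambda>z. f z + - f w * F z) F" using orth F(2) by simp
    also have "\<dots> = binner G f F + - f w * of_real (bnorm2 G F)"
      unfolding binner_add_left[OF f bergman_space_cmult[OF F(1)] F(1)] binner_cmult_left binner_self ..
    finally have "binner G f F = f w * of_real (bnorm2 G F)" by simp
    then show "f w = binner G f (\<lambda>z. c * F z)" using pos unfolding binner_cmult_right by (simp add: c_def)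
  qed
qed

end

text \<open>The property inside the definite description \<open>bergman_kernel\<close>, named so
  that existence and uniqueness can be proved separately.\<close>

definition is_bergman_kernel :: "(complex^'n) set \<Rightarrow> (complex^'n \<Rightarrow> complex^'n \<Rightarrow> complex) \<Rightarrow> bool" where
  "is_bergman_kernel G K \<longleftrightarrow>
     (\<forall>w\<in>G. (\<lambda>z. K z w) \<in> bergman_space G \<and> (\<forall>f\<in>bergman_space G. f w = binner G f (\<lambda>z. K z w))) \<and>
     (\<forall>z w. z \<notin> G \<or> w \<notin> G \<longrightarrow> K z w = 0)"

text \<open>The inner product of \<open>K\<close> at \<open>w\<close> with \<open>K'\<close> at
  \<open>z\<close> is evaluated by either reproducing property. Allowing two kernels yields
  uniqueness as well as Hermitian symmetry.\<close>

lemma is_bergman_kernel_hermitian: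
  assumes G: "open G" and K: "is_bergman_kernel G K" "is_bergman_kernel G K'" and zw: "z \<in> G" "w \<in> G"
  shows "K z w = cnj (K' w z)"
proof -
  have KB: "(\<lambda>z. K z w) \<in> bergman_space G" "(\<lambda>x. K' x z) \<in> bergman_space G"
    and rep: "\<And>f. f \<in> bergman_space G \<Longrightarrow> f w = binner G f (\<lambda>z. K z w)"
      "\<And>f. f \<in> bergman_space G \<Longrightarrow> f z = binner G f (\<lambda>x. K' x z)"
    using K zw by (simp_all add: is_bergman_kernel_def)
  have "K z w = binner G (\<lambda>z. K z w) (\<lambda>x. K' x z)" by (rule rep(2)[OF KB(1)])
  also have "\<dots> = cnj (binner G (\<lambda>x. K' x z) (\<lambda>z. K z w))" by (rule binner_commute[OF G])
  also have "binner G (\<lambda>x. K' x z) (\<lambda>z. K z w) = K' w z" by (rule rep(1)[OF KB(2), symmetric])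
  finally show ?thesis .
qed

lemma is_bergman_kernel_unique:
  assumes G: "open G" and K: "is_bergman_kernel G K" "is_bergman_kernel G K'"
  shows "K = K'"
proof (intro ext)
  fix z w
  show "K z w = K' z w"
  proof (cases "z \<in> G \<and> w \<in> G")
    case True
    then have "K z w = cnj (K' w z)" "K' z w = cnj (K' w z)"
      using is_bergman_kernel_hermitian[OF G K(1) K(2)] is_bergman_kernel_hermitian[OF G K(2) K(2)] by blast+
    then show ?thesis by (rule trans[OF _ sym])
  next
    case False
    then show ?thesis using K by (auto simp: is_bergman_kernel_def)
  qed
qed

lemma bergman_kernel_eqI:
  assumes "open G" "is_bergman_kernel G K" shows "bergman_kernel G = K"
  unfolding bergman_kernel_def binner_def[symmetric] is_bergman_kernel_def[symmetric]
  using assms is_bergman_kernel_unique by blast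

lemma is_bergman_kernel_bergman_kernel:
  assumes G: "open G" "bounded G" shows "is_bergman_kernel G (bergman_kernel G)"
proof -
  have "\<forall>w\<in>G. \<exists>k. k \<in> bergman_space G \<and> (\<forall>f\<in>bergman_space G. f w = binner G f k)"
  proof
    fix w assume w: "w \<in> G"
    show "\<exists>k. k \<in> bergman_space G \<and> (\<forall>f\<in>bergman_space G. f w = binner G f k)"
      by (rule bergman_reproducing[OF G w]) blast
  qed
  then obtain k where k: "\<forall>w\<in>G. k w \<in> bergman_space G \<and> (\<forall>f\<in>bergman_space G. f w = binner G f (k w))"
    unfolding bchoice_iff by blast
  define K where "K z w = (if z \<in> G \<and> w \<in> G then k w z else 0)" for z w
  have "is_bergman_kernel G K"
    unfolding is_bergman_kernel_def
  proof (intro conjI ballI allI impI)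
    fix w assume w: "w \<in> G"
    have eq: "K z w = k w z" if "z \<in> G" for z using that w by (simp add: K_def)
    show "(\<lambda>z. K z w) \<in> bergman_space G" using k w bergman_space_cong[of G "\<lambda>z. K z w" "k w"] eq by simp
    fix f assume "f \<in> bergman_space G"
    then have "f w = binner G f (k w)" using k w by blast
    then show "f w = binner G f (\<lambda>z. K z w)" using binner_cong[of G f f "k w" "\<lambda>z. K z w"] eq by simp
  qed (auto simp: K_def)
  then show ?thesis using bergman_kernel_eqI[OF G(1)] by simp
qed

text \<open>The kernel of \<Omega>, cut to 0 outside \<open>\<Omega> - S\<close>, reproduces every
  square-integrable \<open>f\<close> on \<open>\<Omega> - S\<close>: \<open>f\<close> extends to
  \<Omega>, is reproduced there, and the integrals agree because \<open>S\<close> is a null set.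
  Uniqueness does the rest.\<close>

lemma bergman_kernel_Diff_hyperplane:
  assumes \<Omega>: "open \<Omega>" "bounded \<Omega>" and S: "complex_hyperplane S" and zw: "z \<in> \<Omega> - S" "w \<in> \<Omega> - S"
  shows "bergman_kernel (\<Omega> - S) z w = bergman_kernel \<Omega> z w"
proof -
  note H = open_Diff_hyperplane[OF \<Omega>(1) S]
  note K = is_bergman_kernel_bergman_kernel[OF \<Omega>]
  define K' where "K' z w = (if z \<in> \<Omega> - S \<and> w \<in> \<Omega> - S then bergman_kernel \<Omega> z w else 0)" for z w
  have "is_bergman_kernel (\<Omega> - S) K'"
    unfolding is_bergman_kernel_def
  proof (intro conjI ballI allI impI)
    fix w assume w: "w \<in> \<Omega> - S"
    have KB: "(\<lambda>z. bergman_kernel \<Omega> z w) \<in> bergman_space \<Omega>" using K w by (auto simp: is_bergman_kernel_def)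
    then have Khol: "holomorphic_Cn (\<lambda>z. bergman_kernel \<Omega> z w) \<Omega>" by (simp add: bergman_space_def)
    have eq: "bergman_kernel \<Omega> z w = K' z w" if "z \<in> \<Omega> - S" for z using that w by (simp add: K'_def)
    show K'B: "(\<lambda>z. K' z w) \<in> bergman_space (\<Omega> - S)" using bergman_space_Diff[OF \<Omega>(1) S Khol eq] KB by simp
    fix f assume f: "f \<in> bergman_space (\<Omega> - S)"
    obtain F where F: "F \<in> bergman_space \<Omega>" "\<And>z. z \<in> \<Omega> - S \<Longrightarrow> F z = f z"
      by (rule bergman_space_extension[OF \<Omega>(1) S f]) (rule that)
    have "f w = F w" using F(2) w by simp
    also have "\<dots> = binner \<Omega> F (\<lambda>z. bergman_kernel \<Omega> z w)" using K w F(1) by (simp add: is_bergman_kernel_def)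
    also have "\<dots> = binner (\<Omega> - S) f (\<lambda>z. K' z w)" unfolding binner_def
    proof (rule set_integrable_Diff_hyperplane(2)[OF S])
      show "(\<lambda>x. indicator \<Omega> x *\<^sub>R (F x * cnj (bergman_kernel \<Omega> x w))) \<in> borel_measurable lborel"
        using bergman_mult_integrable[OF \<Omega>(1) F(1) KB] unfolding set_integrable_def by (rule borel_measurable_integrable)
      show "(\<lambda>x. indicator (\<Omega> - S) x *\<^sub>R (f x * cnj (K' x w))) \<in> borel_measurable lborel"
        using bergman_mult_integrable[OF H f K'B] unfolding set_integrable_def by (rule borel_measurable_integrable)
    qed (simp add: F(2) eq)
    finally show "f w = binner (\<Omega> - S) f (\<lambda>z. K' z w)" .
  qed (auto simp: K'_def)
  from bergman_kernel_eqI[OF H this] show ?thesis using zw by (simp add: K'_def)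
qed

section \<open>Smoothness of the Bergman metric\<close>

text \<open>The model is a kernel: holomorphic in \<open>z\<close>, antiholomorphic in
  \<open>w\<close>. The joint local bound is required explicitly because it is what Cauchy estimates
  in one variable convert into uniformity in the other.\<close>

definition sesquiholomorphic :: "(complex^'n) set \<Rightarrow> (complex^'n \<Rightarrow> complex^'n \<Rightarrow> complex) \<Rightarrow> bool" where
  "sesquiholomorphic G F \<longleftrightarrow>
     (\<forall>w\<in>G. holomorphic_Cn (\<lambda>z. F z w) G) \<and> (\<forall>z\<in>G. holomorphic_Cn (\<lambda>w. cnj (F z w)) G) \<and>
     (\<forall>p\<in>G. \<forall>q\<in>G. \<exists>r>0. \<exists>M. ball p r \<subseteq> G \<and> ball q r \<subseteq> G \<and> (\<forall>z\<in>ball p r. \<forall>w\<in>ball q r. cmod (F z w) \<le> M))"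

definition deriv_fst :: "complex^'n \<Rightarrow> (complex^'n \<Rightarrow> complex^'n \<Rightarrow> complex) \<Rightarrow> complex^'n \<Rightarrow> complex^'n \<Rightarrow> complex" where
  "deriv_fst v F z w = hderiv (\<lambda>z. F z w) z v"

text \<open>The derivative in the antiholomorphic variable is taken by swapping the arguments and
  conjugating, so that facts about \<open>deriv_fst\<close> transfer through
  \<open>sesquiholomorphic_swap\<close>.\<close>

definition deriv_snd :: "complex^'n \<Rightarrow> (complex^'n \<Rightarrow> complex^'n \<Rightarrow> complex) \<Rightarrow> complex^'n \<Rightarrow> complex^'n \<Rightarrow> complex" where
  "deriv_snd v F z w = cnj (deriv_fst v (\<lambda>w z. cnj (F z w)) w z)"

text \<open>On the diagonal this is the derivative of \<open>\<lambda>z. F z z\<close> in the real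
  direction \<open>v\<close>; it is kept as a function of two arguments so that it can be
  differentiated again.\<close>

definition deriv_diag :: "complex^'n \<Rightarrow> (complex^'n \<Rightarrow> complex^'n \<Rightarrow> complex) \<Rightarrow> complex^'n \<Rightarrow> complex^'n \<Rightarrow> complex" where
  "deriv_diag v F z w = deriv_fst v F z w + deriv_snd v F z w"

lemma sesquiholomorphicE:
  assumes "sesquiholomorphic G F" "p \<in> G" "q \<in> G"
  obtains r M where "r > 0" "ball p r \<subseteq> G" "ball q r \<subseteq> G"
    "\<And>z w. z \<in> ball p r \<Longrightarrow> w \<in> ball q r \<Longrightarrow> cmod (F z w) \<le> M"
  using assms unfolding sesquiholomorphic_def by meson

lemma sesquiholomorphic_swap:
  assumes "sesquiholomorphic G F" shows "sesquiholomorphic G (\<lambda>w z. cnj (F z w))"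
  unfolding sesquiholomorphic_def
proof (intro conjI ballI)
  show "holomorphic_Cn (\<lambda>z. cnj (F w z)) G" if "w \<in> G" for w
    using assms that by (simp add: sesquiholomorphic_def)
  show "holomorphic_Cn (\<lambda>w. cnj (cnj (F w z))) G" if "z \<in> G" for z
    using assms that by (simp add: sesquiholomorphic_def)
  fix p q assume pq: "p \<in> G" "q \<in> G"
  obtain r M where "r > 0" "ball q r \<subseteq> G" "ball p r \<subseteq> G"
    "\<And>z w. z \<in> ball q r \<Longrightarrow> w \<in> ball p r \<Longrightarrow> cmod (F z w) \<le> M"
    using sesquiholomorphicE[OF assms pq(2,1)] by metis
  then show "\<exists>r>0. \<exists>M. ball p r \<subseteq> G \<and> ball q r \<subseteq> G \<and> (\<forall>z\<in>ball p r. \<forall>w\<in>ball q r. cmod (cnj (F w z)) \<le> M)"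
    by (intro exI[of _ r] conjI exI[of _ M]) auto
qed

lemma sesquiholomorphic_add:
  assumes "sesquiholomorphic G F" "sesquiholomorphic G H"
  shows "sesquiholomorphic G (\<lambda>z w. F z w + H z w)"
  unfolding sesquiholomorphic_def
proof (intro conjI ballI)
  show "holomorphic_Cn (\<lambda>z. F z w + H z w) G" if "w \<in> G" for w
    using assms that by (intro holomorphic_Cn_add) (auto simp: sesquiholomorphic_def)
  show "holomorphic_Cn (\<lambda>w. cnj (F z w + H z w)) G" if "z \<in> G" for z
    using assms that unfolding complex_cnj_add by (intro holomorphic_Cn_add) (auto simp: sesquiholomorphic_def)
  fix p q assume pq: "p \<in> G" "q \<in> G"
  obtain r M where 1: "r > 0" "ball p r \<subseteq> G" "ball q r \<subseteq> G"
    "\<And>z w. z \<in> ball p r \<Longrightarrow> w \<in> ball q r \<Longrightarrow> cmod (F z w) \<le> M"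
    by (rule sesquiholomorphicE[OF assms(1) pq]) blast
  obtain r' M' where 2: "r' > 0" "ball p r' \<subseteq> G" "ball q r' \<subseteq> G"
    "\<And>z w. z \<in> ball p r' \<Longrightarrow> w \<in> ball q r' \<Longrightarrow> cmod (H z w) \<le> M'"
    by (rule sesquiholomorphicE[OF assms(2) pq]) blast
  have "cmod (F z w + H z w) \<le> M + M'" if "z \<in> ball p (min r r')" "w \<in> ball q (min r r')" for z w
    using 1(4)[of z w] 2(4)[of z w] that norm_triangle_ineq[of "F z w" "H z w"] by auto
  then show "\<exists>r>0. \<exists>M. ball p r \<subseteq> G \<and> ball q r \<subseteq> G \<and> (\<forall>z\<in>ball p r. \<forall>w\<in>ball q r. cmod (F z w + H z w) \<le> M)"
    using 1(1-3) 2(1) by (intro exI[of _ "min r r'"] conjI exI[of _ "M + M'"] ballI) auto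
qed

lemma ball_half_subset: "x \<in> ball z (r/2) \<Longrightarrow> ball x (r/2) \<subseteq> ball (z::'a::metric_space) r"
proof
  fix y assume "x \<in> ball z (r/2)" "y \<in> ball x (r/2)"
  then show "y \<in> ball z r" using dist_triangle[of z y x] by simp
qed

text \<open>Antiholomorphy in \<open>w\<close> survives because the difference quotients in
  \<open>z\<close> converge uniformly in \<open>w\<close>, which is
  \<open>difference_quotient_uniform\<close> with \<open>w\<close> as parameter. The new local bound
  is Cauchy's estimate on half the radius.\<close>

lemma sesquiholomorphic_deriv_fst:
  assumes F: "sesquiholomorphic G F" and G: "open G"
  shows "sesquiholomorphic G (deriv_fst v F)"
  unfolding sesquiholomorphic_def
proof (intro conjI ballI)
  have hol: "holomorphic_Cn (\<lambda>z. F z w) G" if "w \<in> G" for w using F that by (simp add: sesquiholomorphic_def)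
  have ahol: "holomorphic_Cn (\<lambda>w. cnj (F z w)) G" if "z \<in> G" for z using F that by (simp add: sesquiholomorphic_def)
  show "holomorphic_Cn (\<lambda>z. deriv_fst v F z w) G" if "w \<in> G" for w
    unfolding deriv_fst_def by (rule holomorphic_Cn_hderiv[OF hol[OF that] G])
  show "holomorphic_Cn (\<lambda>w. cnj (deriv_fst v F z w)) G" if z: "z \<in> G" for z
  proof (rule holomorphic_Cn_local[OF G])
    fix q assume q: "q \<in> G"
    obtain r M where r: "r > 0" "ball z r \<subseteq> G" "ball q r \<subseteq> G"
      "\<And>x w. x \<in> ball z r \<Longrightarrow> w \<in> ball q r \<Longrightarrow> cmod (F x w) \<le> M"
      by (rule sesquiholomorphicE[OF F z q]) blast
    define s where "s = r/2"
    have s: "s > 0" "2 * s = r" using r by (auto simp: s_def)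
    have U: "uniform_limit (ball q r \<times> ball z s) (\<lambda>n (w,x). of_nat n * (F (x + v /\<^sub>R real n) w - F x w))
           (\<lambda>(w,x). hderiv (\<lambda>x. F x w) x v) sequentially"
    proof (rule difference_quotient_uniform[where f="\<lambda>w x. F x w" and M=M])
      show "s > 0" by (rule s)
      fix w assume w: "w \<in> ball q r"
      then have "w \<in> G" using r by blast
      then show "holomorphic_Cn (\<lambda>x. F x w) (ball z (2 * s))"
        unfolding s using hol r(2) holomorphic_Cn_subset by blast
      fix x assume "x \<in> ball z (2 * s)"
      then show "cmod (F x w) \<le> M" using r(4) w s by simp
    qed
    have U1: "uniform_limit (ball q r) (\<lambda>n w. cnj (of_nat n * (F (z + v /\<^sub>R real n) w - F z w))) (\<lambda>w. cnj (deriv_fst v F z w)) sequentially"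
      unfolding uniform_limit_iff
    proof (intro allI impI)
      fix e :: real assume "e > 0"
      with U have "\<forall>\<^sub>F n in sequentially. \<forall>p\<in>ball q r \<times> ball z s. dist (case p of (w,x) \<Rightarrow> of_nat n * (F (x + v /\<^sub>R real n) w - F x w))
           (case p of (w,x) \<Rightarrow> hderiv (\<lambda>x. F x w) x v) < e"
        unfolding uniform_limit_iff by blast
      then show "\<forall>\<^sub>F n in sequentially. \<forall>w\<in>ball q r. dist (cnj (of_nat n * (F (z + v /\<^sub>R real n) w - F z w))) (cnj (deriv_fst v F z w)) < e"
      proof eventually_elim
        case (elim n)
        show ?case
        proof
          fix w assume "w \<in> ball q r"
          then have "dist (of_nat n * (F (z + v /\<^sub>R real n) w - F z w)) (deriv_fst v F z w) < e"
            using elim s by (auto simp: deriv_fst_def)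
          then show "dist (cnj (of_nat n * (F (z + v /\<^sub>R real n) w - F z w))) (cnj (deriv_fst v F z w)) < e"
            by (simp only: dist_norm complex_cnj_diff[symmetric] complex_mod_cnj)
        qed
      qed
    qed
    obtain N where N: "\<And>n. n \<ge> N \<Longrightarrow> norm v / real n < r"
      using order_tendstoD(2)[OF lim_const_over_n[of "norm v"] r(1)] unfolding eventually_sequentially by blast
    note U2 = uniform_limit_shift[OF U1, of N]
    have "holomorphic_Cn (\<lambda>w. cnj (deriv_fst v F z w)) (ball q r)"
    proof (rule holomorphic_Cn_uniform_limit[OF open_ball])
      fix k
      have "norm (v /\<^sub>R real (k+N)) < r" using N[of "k+N"] by (simp add: divide_inverse_commute)
      then have "z + v /\<^sub>R real (k+N) \<in> ball z r" by (simp add: dist_norm)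
      then have zv: "z + v /\<^sub>R real (k+N) \<in> G" using r by blast
      have "holomorphic_Cn (\<lambda>w. of_nat (k+N) * (cnj (F (z + v /\<^sub>R real (k+N)) w) - cnj (F z w))) G"
        by (intro holomorphic_Cn_mult holomorphic_Cn_const holomorphic_Cn_diff ahol zv z)
      then show "holomorphic_Cn (\<lambda>w. cnj (of_nat (k+N) * (F (z + v /\<^sub>R real (k+N)) w - F z w))) (ball q r)"
        using holomorphic_Cn_subset[OF _ r(3)] by simp
    next
      fix y assume y: "y \<in> ball q r"
      then obtain s where "s > 0" "ball y s \<subseteq> ball q r" by (meson open_ball open_contains_ball)
      then show "\<exists>s>0. ball y s \<subseteq> ball q r \<and> uniform_limit (ball y s) (\<lambda>n w. cnj (of_nat (n+N) * (F (z + v /\<^sub>R real (n+N)) w - F z w)))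
             (\<lambda>w. cnj (deriv_fst v F z w)) sequentially"
        using uniform_limit_on_subset[OF U2, of "ball y s"] by (intro exI[of _ s]) simp
    qed
    then show "\<exists>r>0. holomorphic_Cn (\<lambda>w. cnj (deriv_fst v F z w)) (ball q r)" using r(1) by blast
  qed
  fix p q assume pq: "p \<in> G" "q \<in> G"
  obtain r M where r: "r > 0" "ball p r \<subseteq> G" "ball q r \<subseteq> G"
    "\<And>x w. x \<in> ball p r \<Longrightarrow> w \<in> ball q r \<Longrightarrow> cmod (F x w) \<le> M"
    by (rule sesquiholomorphicE[OF F pq]) blast
  have "cmod (deriv_fst v F z w) \<le> 2 * M * norm v / (r/2)" if "z \<in> ball p (r/2)" "w \<in> ball q (r/2)" for z w
    unfolding deriv_fst_def
  proof (rule hderiv_bound)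
    have sub: "ball z (r/2) \<subseteq> ball p r" using that(1) by (rule ball_half_subset)
    have w: "w \<in> ball q r" using that(2) r(1) by simp
    show "holomorphic_Cn (\<lambda>z. F z w) (ball z (r/2))"
      using hol[of w] w r(2,3) sub holomorphic_Cn_subset by (meson subsetD subset_trans)
    show "0 < r/2" using r by simp
    fix x assume "x \<in> ball z (r/2)"
    then show "cmod (F x w) \<le> M" using sub w r(4) by blast
  qed
  moreover have "ball p (r/2) \<subseteq> G" "ball q (r/2) \<subseteq> G" using r(1-3) by (auto simp: subset_iff)
  ultimately show "\<exists>r>0. \<exists>M. ball p r \<subseteq> G \<and> ball q r \<subseteq> G \<and> (\<forall>z\<in>ball p r. \<forall>w\<in>ball q r. cmod (deriv_fst v F z w) \<le> M)"
    using r(1) by (intro exI[of _ "r/2"] conjI exI[of _ "2 * M * norm v / (r/2)"]) auto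
qed

lemma sesquiholomorphic_deriv_snd:
  assumes F: "sesquiholomorphic G F" and G: "open G"
  shows "sesquiholomorphic G (deriv_snd v F)"
  using sesquiholomorphic_swap[OF sesquiholomorphic_deriv_fst[OF sesquiholomorphic_swap[OF F] G, of v]]
  unfolding deriv_snd_def[abs_def] .

lemma sesquiholomorphic_deriv_diag:
  assumes F: "sesquiholomorphic G F" and G: "open G"
  shows "sesquiholomorphic G (deriv_diag v F)"
  unfolding deriv_diag_def[abs_def] by (intro sesquiholomorphic_add sesquiholomorphic_deriv_fst sesquiholomorphic_deriv_snd assms)

lemma sesquiholomorphic_continuous_right:
  assumes F: "sesquiholomorphic G F" and z: "z \<in> G"
  shows "continuous_on G (\<lambda>w. F z w)"
proof -
  have "continuous_on G (\<lambda>w. cnj (cnj (F z w)))"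
    using F z by (intro continuous_on_cnj holomorphic_Cn_continuous_on) (simp add: sesquiholomorphic_def)
  then show ?thesis by simp
qed

text \<open>An expansion in the first argument with one constant for all second arguments near
  \<open>z\<close>, so that on the diagonal both arguments may move together.\<close>

lemma sesquiholomorphic_remainder:
  assumes F: "sesquiholomorphic G F" and G: "open G" and z: "z \<in> G"
  obtains r C where "r > 0" "ball z r \<subseteq> G"
    "\<And>h w. norm h < r \<Longrightarrow> w \<in> ball z r \<Longrightarrow> cmod (F (z + h) w - F z w - deriv_fst h F z w) \<le> C * (norm h)\<^sup>2"
    "\<And>h w. w \<in> ball z r \<Longrightarrow> cmod (deriv_fst h F z w) \<le> C * norm h"
proof -
  obtain r M where r: "r > 0" "ball z r \<subseteq> G" 
    "\<And>x w. x \<in> ball z r \<Longrightarrow> w \<in> ball z r \<Longrightarrow> cmod (F x w) \<le> M"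
    by (rule sesquiholomorphicE[OF F z z]) blast
  have hol: "holomorphic_Cn (\<lambda>z. F z w) (ball z r)" if "w \<in> ball z r" for w
    using F that r(2) holomorphic_Cn_subset unfolding sesquiholomorphic_def by blast
  have M: "M \<ge> 0" using r(3)[of z z] r(1) norm_ge_zero[of "F z z"] by (simp add: order_trans[OF norm_ge_zero])
  define C where "C = 8 * M / r\<^sup>2 + 2 * M / r"
  show thesis
  proof (rule that[of "r/4" C])
    show "r/4 > 0" "ball z (r/4) \<subseteq> G" using r by (auto simp: subset_iff)
    fix h w assume w: "w \<in> ball z (r/4)"
    then have w': "w \<in> ball z r" using r(1) by simp
    show "cmod (deriv_fst h F z w) \<le> C * norm h"
    proof -
      have "cmod (deriv_fst h F z w) \<le> 2 * M * norm h / r"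
        unfolding deriv_fst_def by (rule hderiv_bound[OF hol[OF w'] r(1)]) (use r(3) w' in blast)
      also have "\<dots> \<le> C * norm h" using M by (simp add: C_def distrib_right)
      finally show ?thesis .
    qed
    assume h: "norm h < r/4"
    have "cmod (F (z + h) w - F z w - deriv_fst h F z w) \<le> 8 * M * (norm h)\<^sup>2 / r\<^sup>2"
      unfolding deriv_fst_def by (rule hderiv_remainder[OF hol[OF w'] r(1)]) (use r(3) w' h in auto)
    also have "\<dots> \<le> C * (norm h)\<^sup>2" using M r(1) by (simp add: C_def distrib_right)
    finally show "cmod (F (z + h) w - F z w - deriv_fst h F z w) \<le> C * (norm h)\<^sup>2" .
  qed
qed

lemma sesquiholomorphic_diag_continuous:
  assumes F: "sesquiholomorphic G F" and G: "open G"
  shows "continuous_on G (\<lambda>z. F z z)"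
  unfolding continuous_on_eq_continuous_at[OF G]
proof
  fix p assume p: "p \<in> G"
  obtain r C where r: "r > 0" "ball p r \<subseteq> G"
    "\<And>h w. norm h < r \<Longrightarrow> w \<in> ball p r \<Longrightarrow> cmod (F (p + h) w - F p w - deriv_fst h F p w) \<le> C * (norm h)\<^sup>2"
    "\<And>h w. w \<in> ball p r \<Longrightarrow> cmod (deriv_fst h F p w) \<le> C * norm h"
    by (rule sesquiholomorphic_remainder[OF F G p]) blast
  have "((\<lambda>z. F z z - F p z) \<longlongrightarrow> 0) (at p)"
  proof (rule Lim_null_comparison)
    have "eventually (\<lambda>z. z \<in> ball p r) (at p)"
      using r(1) by (intro eventually_at_in_open') auto
    then show "\<forall>\<^sub>F z in at p. norm (F z z - F p z) \<le> C * (norm (z - p))\<^sup>2 + C * norm (z - p)"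
    proof eventually_elim
      case (elim z)
      then have "cmod (F z z - F p z - deriv_fst (z - p) F p z) \<le> C * (norm (z - p))\<^sup>2" "cmod (deriv_fst (z - p) F p z) \<le> C * norm (z - p)"
        using r(3)[of "z - p" z] r(4)[of z "z - p"] by (auto simp: dist_norm norm_minus_commute)
      then show ?case using norm_triangle_sub[of "F z z - F p z" "deriv_fst (z - p) F p z"] by linarith
    qed
    show "((\<lambda>z. C * (norm (z - p))\<^sup>2 + C * norm (z - p)) \<longlongrightarrow> 0) (at p)" by (auto intro!: tendsto_eq_intros)
  qed
  moreover have "((\<lambda>z. F p z) \<longlongrightarrow> F p p) (at p)"
    using sesquiholomorphic_continuous_right[OF F p, unfolded continuous_on_eq_continuous_at[OF G]] p
    by (simp add: isCont_def)
  ultimately have "((\<lambda>z. (F z z - F p z) + F p z) \<longlongrightarrow> 0 + F p p) (at p)" by (rule tendsto_add)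
  then show "isCont (\<lambda>z. F z z) p" by (simp add: isCont_def)
qed

lemma has_vector_derivative_zeroI:
  fixes f :: "real \<Rightarrow> 'a::real_normed_vector"
  assumes "((\<lambda>t. (f t - f 0 - t *\<^sub>R d) /\<^sub>R \<bar>t\<bar>) \<longlongrightarrow> 0) (at 0)"
  shows "(f has_vector_derivative d) (at 0)"
  unfolding has_vector_derivative_def has_derivative_at
  using tendsto_norm_zero[OF assms]
  by (simp add: bounded_linear_scaleR_left divide_inverse mult.commute)

text \<open>The increment splits at \<open>F z w\<close> with \<open>w = z + t *\<^sub>R u\<close>.
  The change in the second argument alone is a conjugated holomorphic derivative. For the change in
  the first, the remainder is uniform in \<open>w\<close>, and \<open>deriv_fst u F z w\<close>
  tends to its value at \<open>w = z\<close>.\<close>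

lemma sesquiholomorphic_diag_derivative:
  assumes F: "sesquiholomorphic G F" and G: "open G" and z: "z \<in> G"
  shows "((\<lambda>t. F (z + t *\<^sub>R u) (z + t *\<^sub>R u)) has_vector_derivative deriv_diag u F z z) (at 0)"
proof -
  have lin: "((\<lambda>t. z + t *\<^sub>R u) has_derivative (\<lambda>t. t *\<^sub>R u)) (at 0)" by (auto intro!: derivative_eq_intros)
  have hz: "holomorphic_Cn (\<lambda>w. cnj (F z w)) G" using F z by (simp add: sesquiholomorphic_def)
  define L where "L = hderiv (\<lambda>w. cnj (F z w)) z"
  have "((\<lambda>t. cnj (F z (z + t *\<^sub>R u))) has_derivative (\<lambda>t. L (t *\<^sub>R u))) (at 0)"
    using has_derivative_compose[OF lin, of "\<lambda>w. cnj (F z w)" L] holomorphic_Cn_has_derivative[OF hz G z] by (simp add: L_def)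
  moreover have "L (t *\<^sub>R u) = t *\<^sub>R L u" for t
    using linear_simps(5)[OF bounded_linear_hderiv[OF hz G z]] by (simp add: L_def)
  ultimately have "((\<lambda>t. cnj (F z (z + t *\<^sub>R u))) has_vector_derivative L u) (at 0)"
    by (simp add: has_vector_derivative_def)
  then have "((\<lambda>t. cnj (cnj (F z (z + t *\<^sub>R u)))) has_vector_derivative cnj (L u)) (at 0)"
    by (rule has_vector_derivative_cnj)
  then have 2: "((\<lambda>t. F z (z + t *\<^sub>R u)) has_vector_derivative deriv_snd u F z z) (at 0)"
    by (simp add: deriv_snd_def deriv_fst_def L_def)
  obtain r C where r: "r > 0" "ball z r \<subseteq> G"
    "\<And>h w. norm h < r \<Longrightarrow> w \<in> ball z r \<Longrightarrow> cmod (F (z + h) w - F z w - deriv_fst h F z w) \<le> C * (norm h)\<^sup>2"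
    by (rule sesquiholomorphic_remainder[OF F G z]) blast
  have d1c: "continuous_on G (\<lambda>w. deriv_fst u F z w)"
    by (rule sesquiholomorphic_continuous_right[OF sesquiholomorphic_deriv_fst[OF F G] z])
  have 1: "((\<lambda>t. F (z + t *\<^sub>R u) (z + t *\<^sub>R u) - F z (z + t *\<^sub>R u)) has_vector_derivative deriv_fst u F z z) (at 0)"
  proof (rule has_vector_derivative_zeroI, rule Lim_null_comparison)
    have t0: "((\<lambda>t. z + t *\<^sub>R u) \<longlongrightarrow> z) (at 0)" by (auto intro!: tendsto_eq_intros)
    have "eventually (\<lambda>t. z + t *\<^sub>R u \<in> ball z r) (at 0)"
      by (rule topological_tendstoD[OF t0]) (use r in auto)
    moreover have "eventually (\<lambda>t. t \<noteq> (0::real)) (at 0)" by (rule eventually_neq_at_within)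
    ultimately show "\<forall>\<^sub>F t in at 0. norm ((F (z + t *\<^sub>R u) (z + t *\<^sub>R u) - F z (z + t *\<^sub>R u) - (F (z + 0 *\<^sub>R u) (z + 0 *\<^sub>R u) - F z (z + 0 *\<^sub>R u)) - t *\<^sub>R deriv_fst u F z z) /\<^sub>R \<bar>t\<bar>)
       \<le> C * \<bar>t\<bar> * (norm u)\<^sup>2 + cmod (deriv_fst u F z (z + t *\<^sub>R u) - deriv_fst u F z z)"
    proof eventually_elim
      case (elim t)
      define w where "w = z + t *\<^sub>R u"
      have w: "w \<in> ball z r" "w \<in> G" using elim r by (auto simp: w_def)
      have hw: "holomorphic_Cn (\<lambda>z. F z w) G" using F w by (simp add: sesquiholomorphic_def)
      have l: "deriv_fst (t *\<^sub>R u) F z w = t *\<^sub>R deriv_fst u F z w"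
        unfolding deriv_fst_def using linear_simps(5)[OF bounded_linear_hderiv[OF hw G z]] by simp
      have "norm (t *\<^sub>R u) < r" using elim by (simp add: dist_norm)
      from r(3)[OF this w(1)] have R: "cmod (F w w - F z w - t *\<^sub>R deriv_fst u F z w) \<le> C * (norm (t *\<^sub>R u))\<^sup>2"
        unfolding l by (simp add: w_def)
      have eq: "F w w - F z w - t *\<^sub>R deriv_fst u F z z = (F w w - F z w - t *\<^sub>R deriv_fst u F z w) + t *\<^sub>R (deriv_fst u F z w - deriv_fst u F z z)"
        by (simp add: scaleR_diff_right)
      have "cmod (F w w - F z w - t *\<^sub>R deriv_fst u F z z) \<le> cmod (F w w - F z w - t *\<^sub>R deriv_fst u F z w) + cmod (t *\<^sub>R (deriv_fst u F z w - deriv_fst u F z z))"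
        unfolding eq by (rule norm_triangle_ineq)
      also have "\<dots> \<le> \<bar>t\<bar> * (C * \<bar>t\<bar> * (norm u)\<^sup>2 + cmod (deriv_fst u F z w - deriv_fst u F z z))"
      proof -
        have "C * (norm (t *\<^sub>R u))\<^sup>2 = \<bar>t\<bar> * (C * \<bar>t\<bar> * (norm u)\<^sup>2)" by (simp add: power2_eq_square)
        then show ?thesis using R by (simp only: norm_scaleR distrib_left add_le_cancel_right)
      qed
      finally have "cmod (F w w - F z w - t *\<^sub>R deriv_fst u F z z) / \<bar>t\<bar> \<le> C * \<bar>t\<bar> * (norm u)\<^sup>2 + cmod (deriv_fst u F z w - deriv_fst u F z z)"
        using elim by (simp add: pos_divide_le_eq mult.commute)
      then show ?case by (simp add: w_def[symmetric] divide_inverse mult.commute)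
    qed
    have "((\<lambda>t. deriv_fst u F z (z + t *\<^sub>R u)) \<longlongrightarrow> deriv_fst u F z z) (at 0)"
      using continuous_on_tendsto_compose[OF d1c t0 z] r topological_tendstoD[OF t0 G z] by blast
    then show "((\<lambda>t. C * \<bar>t\<bar> * (norm u)\<^sup>2 + cmod (deriv_fst u F z (z + t *\<^sub>R u) - deriv_fst u F z z)) \<longlongrightarrow> 0) (at 0)"
      by (auto intro!: tendsto_eq_intros)
  qed
  from has_vector_derivative_add[OF 1 2] show ?thesis by (simp add: deriv_diag_def)
qed

lemma open_line: 
  assumes "open (G :: 'a::real_normed_vector set)" shows "open {t. z + t *\<^sub>R u \<in> G}"
proof -
  have "continuous_on UNIV (\<lambda>t. z + t *\<^sub>R u)" by (intro continuous_intros)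
  then show ?thesis using open_vimage[OF assms, of "\<lambda>t. z + t *\<^sub>R u"] by (simp add: vimage_def)
qed

lemma has_vector_derivative_divide_complex:
  fixes f g :: "real \<Rightarrow> complex"
  assumes f: "(f has_vector_derivative f') (at x)" and g: "(g has_vector_derivative g') (at x)" and nz: "g x \<noteq> 0"
  shows "((\<lambda>t. f t / g t) has_vector_derivative (f' * g x - f x * g') / (g x)\<^sup>2) (at x)"
proof -
  have "(inverse has_field_derivative - (inverse (g x) * inverse (g x))) (at (g x))"
    using DERIV_inverse'[OF DERIV_ident nz] by simp
  from field_vector_diff_chain_at[OF g this]
  have "((\<lambda>t. inverse (g t)) has_vector_derivative g' * - (inverse (g x) * inverse (g x))) (at x)" by (simp add: comp_def)
  from has_vector_derivative_mult[OF f this]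
  have "((\<lambda>t. f t * inverse (g t)) has_vector_derivative f x * (g' * - (inverse (g x) * inverse (g x))) + f' * inverse (g x)) (at x)" .
  moreover have "f x * (g' * - (inverse (g x) * inverse (g x))) + f' * inverse (g x) = (f' * g x - f x * g') / (g x)\<^sup>2"
    using nz by (simp add: field_simps power2_eq_square)
  ultimately show ?thesis by (simp only: divide_inverse[symmetric])
qed

lemma axis_of_real: "axis j (complex_of_real t) = t *\<^sub>R axis j 1" "axis j (\<i> * complex_of_real t) = t *\<^sub>R axis j \<i>"
  by (auto simp: vec_eq_iff axis_def scaleR_conv_of_real[where 'a=complex])

section \<open>The logarithm of a positive diagonal\<close>

definition log_diag_deriv :: "(complex^'n \<Rightarrow> complex^'n \<Rightarrow> complex) \<Rightarrow> complex^'n \<Rightarrow> complex^'n \<Rightarrow> complex" where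
  "log_diag_deriv F u z = deriv_diag u F z z / F z z"

text \<open>The quotient rule for \<open>log_diag_deriv F u\<close> in direction \<open>v\<close>.
  The explicit form in terms of \<open>deriv_diag\<close> makes the second derivatives visibly
  continuous.\<close>

definition log_diag_deriv2 :: "(complex^'n \<Rightarrow> complex^'n \<Rightarrow> complex) \<Rightarrow> complex^'n \<Rightarrow> complex^'n \<Rightarrow> complex^'n \<Rightarrow> complex" where
  "log_diag_deriv2 F v u z = (deriv_diag v (deriv_diag u F) z z * F z z - deriv_diag u F z z * deriv_diag v F z z) / (F z z)\<^sup>2"

definition log_diag :: "(complex^'n \<Rightarrow> complex^'n \<Rightarrow> complex) \<Rightarrow> complex^'n \<Rightarrow> complex" where
  "log_diag F z = complex_of_real (ln (Re (F z z)))"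

context
  fixes G :: "(complex^'n) set" and F :: "complex^'n \<Rightarrow> complex^'n \<Rightarrow> complex"
  assumes F: "sesquiholomorphic G F" and G: "open G"
    and pos: "\<And>z. z \<in> G \<Longrightarrow> Re (F z z) > 0" and real: "\<And>z. z \<in> G \<Longrightarrow> F z z = of_real (Re (F z z))"
begin

lemma nonzero: "z \<in> G \<Longrightarrow> F z z \<noteq> 0"
  using pos[of z] by auto

text \<open>The complex logarithm is differentiated along the line and then identified with the real
  one; a positive diagonal stays off its branch cut.\<close>

lemma log_diag_has_derivative:
  assumes z: "z \<in> G" shows "((\<lambda>t. log_diag F (z + t *\<^sub>R u)) has_vector_derivative log_diag_deriv F u z) (at 0)"
proof -
  have "F z z \<notin> \<real>\<^sub>\<le>\<^sub>0" using pos[OF z] by (auto simp: complex_nonpos_Reals_iff)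
  then have "(Ln has_field_derivative inverse (F (z + 0 *\<^sub>R u) (z + 0 *\<^sub>R u))) (at (F (z + 0 *\<^sub>R u) (z + 0 *\<^sub>R u)))"
    using has_field_derivative_Ln by simp
  from field_vector_diff_chain_at[OF sesquiholomorphic_diag_derivative[OF F G z, of u] this]
  have *: "((\<lambda>t. Ln (F (z + t *\<^sub>R u) (z + t *\<^sub>R u))) has_vector_derivative log_diag_deriv F u z) (at 0)"
    by (simp add: comp_def log_diag_deriv_def divide_inverse)
  show ?thesis
  proof (rule has_vector_derivative_transform_within_open[OF * open_line[OF G]])
    show "0 \<in> {t. z + t *\<^sub>R u \<in> G}" using z by simp
    fix t assume "t \<in> {t. z + t *\<^sub>R u \<in> G}"
    then have t: "z + t *\<^sub>R u \<in> G" by simp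
    show "Ln (F (z + t *\<^sub>R u) (z + t *\<^sub>R u)) = log_diag F (z + t *\<^sub>R u)"
      unfolding log_diag_def by (subst real[OF t]) (rule Ln_of_real[OF pos[OF t]])
  qed
qed

lemma log_diag_deriv_has_derivative:
  assumes z: "z \<in> G" shows "((\<lambda>t. log_diag_deriv F u (z + t *\<^sub>R v)) has_vector_derivative log_diag_deriv2 F v u z) (at 0)"
  unfolding log_diag_deriv_def log_diag_deriv2_def
  using has_vector_derivative_divide_complex[OF sesquiholomorphic_diag_derivative[OF sesquiholomorphic_deriv_diag[OF F G] G z]
      sesquiholomorphic_diag_derivative[OF F G z], of v u] nonzero[OF z] by simp

lemma log_diag_deriv2_continuous: "continuous_on G (log_diag_deriv2 F v u)"
  unfolding log_diag_deriv2_def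
  by (intro continuous_intros sesquiholomorphic_diag_continuous sesquiholomorphic_deriv_diag F G) (simp add: nonzero)

lemma wirtinger_bar_log_diag:
  assumes z: "z \<in> G"
  shows "wirtinger_bar k (log_diag F) z = (log_diag_deriv F (axis k 1) z + \<i> * log_diag_deriv F (axis k \<i>) z) / 2"
  unfolding wirtinger_bar_def partial_x_def partial_y_def axis_of_real
  by (simp only: vector_derivative_at[OF log_diag_has_derivative[OF z]])

lemma wirtinger_wirtinger_bar_log_diag:
  assumes z: "z \<in> G"
  shows "wirtinger j (wirtinger_bar k (log_diag F)) z =
    ((log_diag_deriv2 F (axis j 1) (axis k 1) z + \<i> * log_diag_deriv2 F (axis j 1) (axis k \<i>) z) / 2
      - \<i> * ((log_diag_deriv2 F (axis j \<i>) (axis k 1) z + \<i> * log_diag_deriv2 F (axis j \<i>) (axis k \<i>) z) / 2)) / 2"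
proof -
  have *: "((\<lambda>t. wirtinger_bar k (log_diag F) (z + t *\<^sub>R v)) has_vector_derivative (log_diag_deriv2 F v (axis k 1) z + \<i> * log_diag_deriv2 F v (axis k \<i>) z) / 2) (at 0)" for v
  proof (rule has_vector_derivative_transform_within_open[OF _ open_line[OF G]])
    show "((\<lambda>t. (log_diag_deriv F (axis k 1) (z + t *\<^sub>R v) + \<i> * log_diag_deriv F (axis k \<i>) (z + t *\<^sub>R v)) / 2) has_vector_derivative (log_diag_deriv2 F v (axis k 1) z + \<i> * log_diag_deriv2 F v (axis k \<i>) z) / 2) (at 0)"
      by (intro has_vector_derivative_divide has_vector_derivative_add has_vector_derivative_mult_right log_diag_deriv_has_derivative z)
    show "0 \<in> {t. z + t *\<^sub>R v \<in> G}" using z by simp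
  qed (simp add: wirtinger_bar_log_diag)
  show ?thesis
    unfolding wirtinger_def[of j] partial_x_def[of j] partial_y_def[of j] axis_of_real
    by (simp only: vector_derivative_at[OF *])
qed

lemma wirtinger_log_diag_continuous: "continuous_on G (wirtinger j (wirtinger_bar k (log_diag F)))"
proof (rule continuous_on_eq)
  show "continuous_on G (\<lambda>z. ((log_diag_deriv2 F (axis j 1) (axis k 1) z + \<i> * log_diag_deriv2 F (axis j 1) (axis k \<i>) z) / 2
      - \<i> * ((log_diag_deriv2 F (axis j \<i>) (axis k 1) z + \<i> * log_diag_deriv2 F (axis j \<i>) (axis k \<i>) z) / 2)) / 2)"
    by (intro continuous_intros log_diag_deriv2_continuous) simp_all
qed (simp add: wirtinger_wirtinger_bar_log_diag)

end

text \<open>The diagonal value is the squared norm of the kernel function. If it were 0, the point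
  bound would annihilate this function, and the constant 1, which is square integrable on a bounded
  set, would be reproduced as 0.\<close>

lemma bergman_kernel_diag:
  assumes G: "open G" "bounded G" and w: "w \<in> G"
  shows "bergman_kernel G w w = of_real (bnorm2 G (\<lambda>z. bergman_kernel G z w))"
    and "Re (bergman_kernel G w w) > 0"
proof -
  note K = is_bergman_kernel_bergman_kernel[OF G]
  have KB: "(\<lambda>z. bergman_kernel G z w) \<in> bergman_space G" using K w by (simp add: is_bergman_kernel_def)
  have rep: "f w = binner G f (\<lambda>z. bergman_kernel G z w)" if "f \<in> bergman_space G" for f
    using K w that by (simp add: is_bergman_kernel_def)
  show 1: "bergman_kernel G w w = of_real (bnorm2 G (\<lambda>z. bergman_kernel G z w))"
    using rep[OF KB] binner_self[OF G(1)] by simp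
  have "bnorm2 G (\<lambda>z. bergman_kernel G z w) \<noteq> 0"
  proof
    assume 0: "bnorm2 G (\<lambda>z. bergman_kernel G z w) = 0"
    have z0: "bergman_kernel G z w = 0" if z: "z \<in> G" for z
    proof -
      obtain r where "r > 0" "ball z r \<subseteq> G" using G z open_contains_ball by blast
      from bergman_point_bound[OF G(1) KB this] show ?thesis using 0 by simp
    qed
    have "binner G (\<lambda>z. 1) (\<lambda>z. bergman_kernel G z w) = binner G (\<lambda>z. 1) (\<lambda>z. 0)"
      by (rule binner_cong) (simp_all add: z0)
    also have "\<dots> = 0" by (simp add: binner_def)
    finally show False using rep[OF bergman_space_const[OF G, of 1]] by simp
  qed
  then show "Re (bergman_kernel G w w) > 0" using 1 bnorm2_nonneg[OF G(1), of "\<lambda>z. bergman_kernel G z w"] by simp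
qed

text \<open>Antiholomorphy in the second variable is Hermitian symmetry. For the joint bound, let
  \<open>N\<close> be the diagonal value at \<open>w\<close>: the point bound at \<open>w\<close>
  gives \<open>N * N \<le> N / c\<close>, hence \<open>N \<le> 1 / c\<close>, and the point bound at
  \<open>z\<close> then gives modulus at most \<open>1 / c\<close>.\<close>

lemma sesquiholomorphic_bergman_kernel:
  assumes G: "open G" "bounded G"
  shows "sesquiholomorphic G (bergman_kernel G)"
  unfolding sesquiholomorphic_def
proof (intro conjI ballI)
  note K = is_bergman_kernel_bergman_kernel[OF G]
  have KB: "(\<lambda>z. bergman_kernel G z w) \<in> bergman_space G" if "w \<in> G" for w
    using K that by (simp add: is_bergman_kernel_def)
  then show hol: "holomorphic_Cn (\<lambda>z. bergman_kernel G z w) G" if "w \<in> G" for w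
    using that by (simp add: bergman_space_def)
  show "holomorphic_Cn (\<lambda>w. cnj (bergman_kernel G z w)) G" if z: "z \<in> G" for z
    using hol[OF z] holomorphic_Cn_cong[of G "\<lambda>w. bergman_kernel G w z" "\<lambda>w. cnj (bergman_kernel G z w)"]
      is_bergman_kernel_hermitian[OF G(1) K K] z by blast
  fix p q assume pq: "p \<in> G" "q \<in> G"
  obtain r1 where r1: "r1 > 0" "ball p r1 \<subseteq> G" using G pq open_contains_ball by blast
  obtain r2 where r2: "r2 > 0" "ball q r2 \<subseteq> G" using G pq open_contains_ball by blast
  define r where "r = min r1 r2 / 2"
  have r: "r > 0" using r1 r2 by (simp add: r_def)
  have "ball p (2 * r) \<subseteq> ball p r1" "ball q (2 * r) \<subseteq> ball q r2" by (auto simp: r_def)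
  then have R: "ball p (2 * r) \<subseteq> G" "ball q (2 * r) \<subseteq> G" using r1 r2 by auto
  define c where "c = ball_vol TYPE('a) r"
  have c: "c > 0" using ball_vol_pos[OF G(1) r] by (simp add: c_def)
  have in_p: "ball z r \<subseteq> G" "z \<in> G" if "z \<in> ball p r" for z
    using ball_half_subset[of z p "2 * r"] that R r by (auto simp: subset_iff)
  have in_q: "ball z r \<subseteq> G" "z \<in> G" if "z \<in> ball q r" for z
    using ball_half_subset[of z q "2 * r"] that R r by (auto simp: subset_iff)
  have "cmod (bergman_kernel G z w) \<le> 1 / c" if zw: "z \<in> ball p r" "w \<in> ball q r" for z w
  proof -
    define N where "N = bnorm2 G (\<lambda>z. bergman_kernel G z w)"
    have "bergman_kernel G w w = of_real N" using bergman_kernel_diag(1)[OF G in_q(2)[OF zw(2)]] by (simp add: N_def)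
    moreover have "N > 0" using bergman_kernel_diag(2)[OF G in_q(2)[OF zw(2)]] calculation by simp
    moreover have "(cmod (bergman_kernel G w w))\<^sup>2 \<le> N / c"
      unfolding N_def c_def by (rule bergman_point_bound[OF G(1) KB r in_q(1)]) (use in_q zw in auto)
    ultimately have "N * N \<le> N / c" by (simp add: power2_eq_square)
    then have "N \<le> 1 / c" using \<open>N > 0\<close> c by (simp add: field_simps)
    have "(cmod (bergman_kernel G z w))\<^sup>2 \<le> N / c"
      unfolding N_def c_def by (rule bergman_point_bound[OF G(1) KB r in_p(1)]) (use in_q zw in auto)
    also have "\<dots> \<le> (1 / c) / c" using \<open>N \<le> 1 / c\<close> c by (intro divide_right_mono) auto
    also have "\<dots> = (1 / c)\<^sup>2" by (simp add: power2_eq_square)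
    finally show ?thesis by (rule power2_le_imp_le) (use c in simp)
  qed
  then show "\<exists>r>0. \<exists>M. ball p r \<subseteq> G \<and> ball q r \<subseteq> G \<and> (\<forall>z\<in>ball p r. \<forall>w\<in>ball q r. cmod (bergman_kernel G z w) \<le> M)"
    using r in_p in_q by (intro exI[of _ r] conjI exI[of _ "1 / c"]) auto
qed

lemma wirtinger_log_bergman_continuous:
  assumes G: "open G" "bounded G"
  shows "continuous_on G (wirtinger j (wirtinger_bar k (log_bergman G)))"
proof -
  have "log_bergman G = log_diag (bergman_kernel G)" by (simp add: fun_eq_iff log_bergman_def log_diag_def)
  moreover have "bergman_kernel G z z = of_real (Re (bergman_kernel G z z))" if "z \<in> G" for z
    using bergman_kernel_diag(1)[OF G that] by simp
  ultimately show ?thesis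
    using wirtinger_log_diag_continuous[OF sesquiholomorphic_bergman_kernel[OF G] G(1) bergman_kernel_diag(2)[OF G]] by simp
qed

lemma bergman_metric_continuous:
  assumes G: "open G" "bounded G"
  shows "continuous_on (G \<times> UNIV) (\<lambda>(z, X). bergman_metric G z X)"
  \<comment> \<open>\<open>sqrt\<close> is continuous on all of the reals, so continuity holds
    whatever the sign of the quadratic form.\<close>
  unfolding bergman_metric_def split_beta
  by (intro continuous_intros continuous_on_compose2[OF wirtinger_log_bergman_continuous[OF G]]) auto

lemma bergman_metric_scale:
  assumes "c \<ge> 0" shows "bergman_metric G z (c *\<^sub>R X) = c * bergman_metric G z X"
proof -
  have "(\<Sum>j\<in>UNIV. \<Sum>k\<in>UNIV. wirtinger j (wirtinger_bar k (log_bergman G)) z * (c *\<^sub>R X) $ j * cnj ((c *\<^sub>R X) $ k))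
    = of_real (c\<^sup>2) * (\<Sum>j\<in>UNIV. \<Sum>k\<in>UNIV. wirtinger j (wirtinger_bar k (log_bergman G)) z * X $ j * cnj (X $ k))"
    by (simp add: sum_distrib_left power2_eq_square scaleR_conv_of_real[where 'a=complex] mult_ac)
  then show ?thesis unfolding bergman_metric_def using assms by (simp add: real_sqrt_mult del: of_real_power)
qed

text \<open>The kernels agree on the open set \<open>\<Omega> - S\<close>, so their logarithms have
  the same partial derivatives there; the argument is run once for each of the two
  differentiations.\<close>

lemma bergman_metric_Diff_hyperplane:
  assumes \<Omega>: "open \<Omega>" "bounded \<Omega>" and S: "complex_hyperplane S" and z: "z \<in> \<Omega> - S"
  shows "bergman_metric (\<Omega> - S) z X = bergman_metric \<Omega> z X"
proof -
  note H = open_Diff_hyperplane[OF \<Omega>(1) S]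
  note bH = bounded_subset[OF \<Omega>(2) Diff_subset, of S]
  have ev: "eventually (\<lambda>t. z + t *\<^sub>R u \<in> \<Omega> - S) (nhds (0::real))" if "z \<in> \<Omega> - S" for u z
    using eventually_nhds_in_open[OF open_line[OF H, of z u]] that by simp
  have log: "log_bergman (\<Omega> - S) z = log_bergman \<Omega> z" if "z \<in> \<Omega> - S" for z
    using bergman_kernel_Diff_hyperplane[OF \<Omega> S that that] by (simp add: log_bergman_def)
  have vd: "vector_derivative (\<lambda>t. f (z + t *\<^sub>R u)) (at (0::real)) = vector_derivative (\<lambda>t. g (z + t *\<^sub>R u)) (at 0)"
    if "\<And>z. z \<in> \<Omega> - S \<Longrightarrow> f z = g z" "z \<in> \<Omega> - S" for f g :: "complex^'a \<Rightarrow> complex" and z u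
  proof (rule vector_derivative_cong_eq)
    show "\<forall>\<^sub>F t in nhds 0. t \<in> UNIV \<longrightarrow> f (z + t *\<^sub>R u) = g (z + t *\<^sub>R u)"
      using ev[OF that(2), of u] by eventually_elim (simp add: that(1))
  qed auto
  have wb: "wirtinger_bar k (log_bergman (\<Omega> - S)) z = wirtinger_bar k (log_bergman \<Omega>) z" if "z \<in> \<Omega> - S" for k z
    unfolding wirtinger_bar_def partial_x_def partial_y_def axis_of_real
    using vd[of "log_bergman (\<Omega> - S)" "log_bergman \<Omega>", OF log that] by simp
  have "wirtinger j (wirtinger_bar k (log_bergman (\<Omega> - S))) z = wirtinger j (wirtinger_bar k (log_bergman \<Omega>)) z" for j k
    unfolding wirtinger_def partial_x_def[of j] partial_y_def[of j] axis_of_real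
    using vd[of "wirtinger_bar k (log_bergman (\<Omega> - S))" "wirtinger_bar k (log_bergman \<Omega>)", OF wb z] by simp
  then show ?thesis by (simp add: bergman_metric_def)
qed

section \<open>Lengths of curves\<close>

definition flen :: "('a::real_normed_vector \<Rightarrow> 'a \<Rightarrow> real) \<Rightarrow> (real \<Rightarrow> 'a) \<Rightarrow> real" where
  "flen \<beta> \<alpha> = integral {0..1} (\<lambda>t. \<beta> (\<alpha> t) (vector_derivative \<alpha> (at t within {0..1})))"

text \<open>The working form of a piecewise \<open>C\<^sup>1\<close> curve: a finite set
  \<open>T\<close> is discarded, and elsewhere \<open>\<alpha>'\<close> is the two-sided derivative,
  continuous and bounded. The end points belong to \<open>T\<close> so that no one-sided derivative
  remains.\<close>

definition smooth_except :: "(real \<Rightarrow> 'a::real_normed_vector) \<Rightarrow> (real \<Rightarrow> 'a) \<Rightarrow> real set \<Rightarrow> real \<Rightarrow> bool" where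
  "smooth_except \<alpha> \<alpha>' T M \<longleftrightarrow> finite T \<and> {0,1} \<subseteq> T \<and> continuous_on {0..1} \<alpha> \<and> continuous_on ({0..1} - T) \<alpha>' \<and>
     (\<forall>t\<in>{0..1} - T. (\<alpha> has_vector_derivative \<alpha>' t) (at t) \<and> norm (\<alpha>' t) \<le> M)"

lemma partition_cell:
  fixes p :: "nat \<Rightarrow> real"
  assumes "p 0 < t" "t < p k" "t \<notin> p ` {..k}"
  shows "\<exists>i<k. p i < t \<and> t < p (Suc i)"
  using assms
proof (induction k)
  case (Suc k)
  show ?case
  proof (cases "t < p k")
    case True
    moreover have "t \<notin> p ` {..k}" using Suc.prems(3) by (auto simp: atMost_Suc)
    ultimately obtain i where "i < k" "p i < t" "t < p (Suc i)" using Suc.IH Suc.prems(1) by blast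
    then show ?thesis using less_SucI by blast
  next
    case False
    then have "p k < t" using Suc.prems(3) by (metis atMost_iff image_eqI le_SucI linorder_neqE order_refl)
    then show ?thesis using Suc.prems by blast
  qed
qed simp

lemma piecewise_C1_smooth_except:
  fixes \<alpha> :: "real \<Rightarrow> 'a::real_normed_vector"
  assumes "piecewise_C1_curve \<alpha>"
  obtains \<alpha>' T M where "smooth_except \<alpha> \<alpha>' T M"
proof -
  obtain m p where p: "p 0 = 0" "p m = 1" "\<forall>i<m. p i < p (Suc i)"
    and ex: "\<forall>i<m. \<exists>\<alpha>'. continuous_on {p i..p (Suc i)} \<alpha>' \<and>
           (\<forall>t\<in>{p i..p (Suc i)}. (\<alpha> has_vector_derivative \<alpha>' t) (at t within {p i..p (Suc i)}))"
    and path: "path \<alpha>"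
    using assms unfolding piecewise_C1_curve_def by blast
  obtain a where a: "\<And>i. i < m \<Longrightarrow> continuous_on {p i..p (Suc i)} (a i)"
    "\<And>i t. i < m \<Longrightarrow> t \<in> {p i..p (Suc i)} \<Longrightarrow> (\<alpha> has_vector_derivative a i t) (at t within {p i..p (Suc i)})"
    using ex by metis
  define T where "T = p ` {..m}"
  define \<alpha>' where "\<alpha>' t = vector_derivative \<alpha> (at t)" for t
  have T: "finite T" "{0,1} \<subseteq> T" using p by (auto simp: T_def image_iff intro: exI)
  have vd: "(\<alpha> has_vector_derivative a i t) (at t)" "\<alpha>' t = a i t" if "i < m" "t \<in> {p i<..<p (Suc i)}" for i t
  proof -
    have "at t within {p i..p (Suc i)} = at t" using that(2) by (auto intro: at_within_Icc_at)
    then show "(\<alpha> has_vector_derivative a i t) (at t)" using a(2)[OF that(1), of t] that(2) by auto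
    then show "\<alpha>' t = a i t" unfolding \<alpha>'_def by (rule vector_derivative_at)
  qed
  have cover: "{0..1} - T \<subseteq> (\<Union>i\<in>{..<m}. {p i<..<p (Suc i)})"
  proof
    fix t assume t: "t \<in> {0..1} - T"
    then have "t \<noteq> 0" "t \<noteq> 1" using T by auto
    then have "\<exists>i<m. p i < t \<and> t < p (Suc i)" using t p by (intro partition_cell) (auto simp: T_def)
    then show "t \<in> (\<Union>i\<in>{..<m}. {p i<..<p (Suc i)})" by auto
  qed
  have "continuous_on (\<Union>i\<in>{..<m}. {p i<..<p (Suc i)}) \<alpha>'"
  proof (rule continuous_on_open_UN)
    fix i assume "i \<in> {..<m}"
    then have i: "i < m" by simp
    have "continuous_on {p i<..<p (Suc i)} (a i)" by (rule continuous_on_subset[OF a(1)[OF i]]) auto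
    then show "continuous_on {p i<..<p (Suc i)} \<alpha>'" by (rule continuous_on_eq) (use vd(2)[OF i] in simp)
  qed simp
  then have cont: "continuous_on ({0..1} - T) \<alpha>'" using cover continuous_on_subset by blast
  have "bounded (\<Union>i\<in>{..<m}. a i ` {p i..p (Suc i)})"
    by (intro bounded_UN ballI compact_imp_bounded compact_continuous_image a) auto
  then obtain M where M: "\<forall>x\<in>(\<Union>i\<in>{..<m}. a i ` {p i..p (Suc i)}). norm x \<le> M" unfolding bounded_iff by blast
  have "(\<alpha> has_vector_derivative \<alpha>' t) (at t) \<and> norm (\<alpha>' t) \<le> M" if t: "t \<in> {0..1} - T" for t
  proof -
    obtain i where i: "i < m" "t \<in> {p i<..<p (Suc i)}" using cover t by blast
    have "a i t \<in> (\<Union>i\<in>{..<m}. a i ` {p i..p (Suc i)})" using i by force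
    then have "norm (a i t) \<le> M" using M by blast
    then show ?thesis using vd[OF i] by simp
  qed
  moreover have "continuous_on {0..1} \<alpha>" using path by (simp add: path_def)
  ultimately have "smooth_except \<alpha> \<alpha>' T M" using T cont unfolding smooth_except_def by blast
  then show thesis by (rule that)
qed

lemma smooth_except_open: "smooth_except \<alpha> \<alpha>' T M \<Longrightarrow> {0..1} - T = {0<..<1} - T"
  by (auto simp: smooth_except_def order_less_le)

lemma integrable_bounded_continuous:
  fixes f :: "real \<Rightarrow> real"
  assumes "finite T" "continuous_on ({0..1} - T) f" "\<And>t. t \<in> {0..1} - T \<Longrightarrow> \<bar>f t\<bar> \<le> B"
  shows "f integrable_on {0..1} - T" "f integrable_on {0..1}"
proof -
  have "{0..1::real} \<in> lmeasurable" using lmeasurable_cbox[of 0 "1::real"] by simp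
  then have lm: "{0..1} - T \<in> lmeasurable"
    by (rule fmeasurable.Diff[OF _ negligible_imp_measurable[OF negligible_finite[OF assms(1)]]])
  show 1: "f integrable_on {0..1} - T"
  proof (rule measurable_bounded_by_integrable_imp_integrable)
    show "f \<in> borel_measurable (lebesgue_on ({0..1} - T))"
      by (rule continuous_imp_measurable_on_sets_lebesgue[OF assms(2) fmeasurableD[OF lm]])
    show "(\<lambda>_. B) integrable_on {0..1} - T" by (rule integrable_on_const[OF lm])
  qed (use assms(3) fmeasurableD[OF lm] in auto)
  show "f integrable_on {0..1}"
    by (rule integrable_spike_set[OF 1])
      (rule negligible_subset[OF negligible_finite[OF assms(1)]], blast)+
qed

text \<open>The second form integrates over the set where \<open>\<alpha>'\<close> is continuous and
  bounded, which is where dominated convergence is applied.\<close>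

lemma smooth_except_flen:
  assumes "smooth_except \<alpha> \<alpha>' T M"
  shows "flen \<beta> \<alpha> = integral {0..1} (\<lambda>t. \<beta> (\<alpha> t) (\<alpha>' t))"
    and "flen \<beta> \<alpha> = integral ({0..1} - T) (\<lambda>t. \<beta> (\<alpha> t) (\<alpha>' t))"
proof -
  have T: "negligible T" using assms by (simp add: smooth_except_def negligible_finite)
  have "vector_derivative \<alpha> (at t within {0..1}) = \<alpha>' t" if "t \<in> {0..1} - T" for t
  proof -
    have "t \<in> {0<..<1}" using smooth_except_open[OF assms] that by blast
    then have "at t within {0..1} = at t" by (auto intro: at_within_Icc_at)
    then show ?thesis using assms that by (auto simp: smooth_except_def vector_derivative_at)
  qed
  then show 1: "flen \<beta> \<alpha> = integral {0..1} (\<lambda>t. \<beta> (\<alpha> t) (\<alpha>' t))"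
    unfolding flen_def by (intro integral_spike[OF T]) auto
  show "flen \<beta> \<alpha> = integral ({0..1} - T) (\<lambda>t. \<beta> (\<alpha> t) (\<alpha>' t))"
    unfolding 1 by (rule integral_spike_set) (auto intro: negligible_subset[OF T])
qed

text \<open>\<open>d = 0\<close> and \<open>d = 1\<close> give the two halves of a joined
  path.\<close>

lemma C1_piece_rescale:
  fixes \<alpha> :: "real \<Rightarrow> 'a::real_normed_vector"
  assumes "\<exists>a. continuous_on {u..v} a \<and> (\<forall>t\<in>{u..v}. (\<alpha> has_vector_derivative a t) (at t within {u..v}))"
    and J: "\<And>t. t \<in> {(u + d)/2..(v + d)/2} \<Longrightarrow> J t = \<alpha> (2 * t - d)"
  shows "\<exists>b. continuous_on {(u + d)/2..(v + d)/2} b \<and>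
     (\<forall>t\<in>{(u + d)/2..(v + d)/2}. (J has_vector_derivative b t) (at t within {(u + d)/2..(v + d)/2}))"
proof -
  obtain a where a: "continuous_on {u..v} a" "\<And>t. t \<in> {u..v} \<Longrightarrow> (\<alpha> has_vector_derivative a t) (at t within {u..v})"
    using assms(1) by blast
  let ?I = "{(u + d)/2..(v + d)/2}"
  have sub: "(\<lambda>t. 2 * t - d) ` ?I \<subseteq> {u..v}" by auto
  have "(J has_vector_derivative 2 *\<^sub>R a (2 * t - d)) (at t within ?I)" if t: "t \<in> ?I" for t
  proof (rule has_vector_derivative_transform[OF t J])
    have 1: "((\<lambda>t. 2 * t - d) has_vector_derivative 2) (at t within ?I)"
      by (auto intro!: derivative_eq_intros simp: has_real_derivative_iff_has_vector_derivative[symmetric])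
    have 2: "(\<alpha> has_vector_derivative a (2 * t - d)) (at (2 * t - d) within (\<lambda>t. 2 * t - d) ` ?I)"
      by (rule has_vector_derivative_within_subset[OF a(2) sub]) (use t in auto)
    show "((\<lambda>t. \<alpha> (2 * t - d)) has_vector_derivative 2 *\<^sub>R a (2 * t - d)) (at t within ?I)"
      using vector_diff_chain_within[OF 1 2] by (simp add: comp_def)
  qed
  moreover have "continuous_on ?I (\<lambda>t. 2 *\<^sub>R a (2 * t - d))"
    by (intro continuous_intros continuous_on_compose2[OF a(1) _ sub])
  ultimately show ?thesis by blast
qed

lemma piecewise_C1_curve_join:
  assumes "piecewise_C1_curve \<alpha>" "piecewise_C1_curve \<gamma>" and fin: "pathfinish \<alpha> = pathstart \<gamma>"
  shows "piecewise_C1_curve (\<alpha> +++ \<gamma>)"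
proof -
  obtain m p where p: "p 0 = 0" "p m = 1" "\<forall>i<m. p i < p (Suc i)"
    "\<forall>i<m. \<exists>a. continuous_on {p i..p (Suc i)} a \<and> (\<forall>t\<in>{p i..p (Suc i)}. (\<alpha> has_vector_derivative a t) (at t within {p i..p (Suc i)}))"
    and path: "path \<alpha>"
    using assms(1) unfolding piecewise_C1_curve_def by blast
  obtain m' p' where p': "p' 0 = 0" "p' m' = 1" "\<forall>i<m'. p' i < p' (Suc i)"
    "\<forall>i<m'. \<exists>a. continuous_on {p' i..p' (Suc i)} a \<and> (\<forall>t\<in>{p' i..p' (Suc i)}. (\<gamma> has_vector_derivative a t) (at t within {p' i..p' (Suc i)}))"
    and path': "path \<gamma>"
    using assms(2) unfolding piecewise_C1_curve_def by blast
  \<comment> \<open>Both branches give \<open>1/2\<close> at \<open>i = m\<close>, since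
    \<open>p m = 1\<close> and \<open>p' 0 = 0\<close>, so either formula may be used there.\<close>
  define q where "q i = (if i \<le> m then p i / 2 else (p' (i - m) + 1) / 2)" for i
  have le1: "p i \<le> 1" if "i \<le> m" for i
  proof -
    have "p i \<le> p m" using that by (induction rule: inc_induct) (use p(3) in \<open>auto intro: order_trans less_imp_le\<close>)
    then show ?thesis using p(2) by simp
  qed
  have ge0: "p' i \<ge> 0" if "i \<le> m'" for i
    using that
  proof (induction i)
    case (Suc i)
    then have "p' i < p' (Suc i)" "0 \<le> p' i" using p'(3) by auto
    then show ?case by linarith
  qed (simp add: p'(1))
  have q1: "q i = (p i + 0) / 2" if "i \<le> m" for i using that by (simp add: q_def)
  have q2: "q i = (p' (i - m) + 1) / 2" if "m \<le> i" for i using that p(2) p'(1) by (auto simp: q_def)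
  have "m' \<noteq> 0" using p' by (cases m') auto
  show ?thesis
    unfolding piecewise_C1_curve_def
  proof (intro conjI exI[of _ "m + m'"] exI[of _ q] allI impI)
    show "path (\<alpha> +++ \<gamma>)" using path path' fin by (rule path_join_imp)
    show "q 0 = 0" using p(1) by (simp add: q_def)
    show "q (m + m') = 1" using q2[of "m + m'"] p'(2) by simp
    fix i assume i: "i < m + m'"
    show "q i < q (Suc i)"
    proof (cases "i < m")
      case True
      then have "p i < p (Suc i)" "i \<le> m" "Suc i \<le> m" using p(3) by auto
      then show ?thesis by (simp only: q1) simp
    next
      case False
      then have "p' (i - m) < p' (Suc i - m)" "m \<le> i" "m \<le> Suc i" using p'(3) i by (auto simp: Suc_diff_le)
      then show ?thesis by (simp only: q2) simp
    qed
    show "\<exists>b. continuous_on {q i..q (Suc i)} b \<and> (\<forall>t\<in>{q i..q (Suc i)}. ((\<alpha> +++ \<gamma>) has_vector_derivative b t) (at t within {q i..q (Suc i)}))"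
    proof (cases "i < m")
      case True
      then have e: "q i = (p i + 0) / 2" "q (Suc i) = (p (Suc i) + 0) / 2" using q1 by auto
      show ?thesis unfolding e
      proof (rule C1_piece_rescale)
        show "\<exists>a. continuous_on {p i..p (Suc i)} a \<and> (\<forall>t\<in>{p i..p (Suc i)}. (\<alpha> has_vector_derivative a t) (at t within {p i..p (Suc i)}))"
          using p(4) True by blast
        fix t assume "t \<in> {(p i + 0) / 2..(p (Suc i) + 0) / 2}"
        then have "t \<le> 1/2" using le1[of "Suc i"] True by auto
        then show "(\<alpha> +++ \<gamma>) t = \<alpha> (2 * t - 0)" by (simp add: joinpaths_def)
      qed
    next
      case False
      define k where "k = i - m"
      have k: "k < m'" "i = m + k" using False i by (auto simp: k_def)
      have e: "q i = (p' k + 1) / 2" "q (Suc i) = (p' (Suc k) + 1) / 2" using q2[of i] q2[of "Suc i"] k by auto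
      show ?thesis unfolding e
      proof (rule C1_piece_rescale)
        show "\<exists>a. continuous_on {p' k..p' (Suc k)} a \<and> (\<forall>t\<in>{p' k..p' (Suc k)}. (\<gamma> has_vector_derivative a t) (at t within {p' k..p' (Suc k)}))"
          using p'(4) k by blast
        fix t assume "t \<in> {(p' k + 1) / 2..(p' (Suc k) + 1) / 2}"
        then have "1/2 \<le> t" using ge0[of k] k by auto
        then consider "t = 1/2" | "t > 1/2" by linarith
        then show "(\<alpha> +++ \<gamma>) t = \<gamma> (2 * t - 1)"
        proof cases
          case 1
          show ?thesis unfolding 1 using fin by (simp add: joinpaths_def pathfinish_def pathstart_def)
        qed (simp add: joinpaths_def)
      qed
    qed
  qed
qed

text \<open>The facts about \<open>bergman_metric\<close> on which lengths rest: joint continuity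
  gives integrability and convergence of lengths, homogeneity gives additivity under joining and,
  with continuity, the smallness of short segments.\<close>

locale length_metric =
  fixes G :: "'a::euclidean_space set" and \<beta> :: "'a \<Rightarrow> 'a \<Rightarrow> real"
  assumes G: "open G" and cont: "continuous_on (G \<times> UNIV) (\<lambda>(z, X). \<beta> z X)"
    and scale: "\<And>z X c. c \<ge> 0 \<Longrightarrow> \<beta> z (c *\<^sub>R X) = c * \<beta> z X"
begin

definition curves :: "'a \<Rightarrow> 'a \<Rightarrow> (real \<Rightarrow> 'a) set" where
  "curves x y = {\<alpha>. piecewise_C1_curve \<alpha> \<and> path_image \<alpha> \<subseteq> G \<and> pathstart \<alpha> = x \<and> pathfinish \<alpha> = y}"

lemma continuous_on_beta:
  assumes "continuous_on A f" "continuous_on A g" "f ` A \<subseteq> G"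
  shows "continuous_on A (\<lambda>t. \<beta> (f t) (g t))"
  using continuous_on_compose2[OF cont, of A "\<lambda>t. (f t, g t)"] assms by (auto intro!: continuous_intros)

lemma beta_bounded:
  assumes "compact K" "K \<subseteq> G"
  obtains B where "\<And>z X. z \<in> K \<Longrightarrow> norm X \<le> M \<Longrightarrow> \<bar>\<beta> z X\<bar> \<le> B"
proof -
  have "compact ((\<lambda>(z, X). \<beta> z X) ` (K \<times> cball 0 M))"
    by (intro compact_continuous_image continuous_on_subset[OF cont] compact_Times assms) (use assms in auto)
  then have "bounded ((\<lambda>(z, X). \<beta> z X) ` (K \<times> cball 0 M))" by (rule compact_imp_bounded)
  then obtain B where "\<forall>x\<in>(\<lambda>(z, X). \<beta> z X) ` (K \<times> cball 0 M). norm x \<le> B" unfolding bounded_iff by blast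
  then show thesis by (intro that[of B]) force
qed

lemma smooth_except_integrable:
  assumes \<alpha>: "smooth_except \<alpha> \<alpha>' T M" and im: "\<alpha> ` {0..1} \<subseteq> G"
  shows "(\<lambda>t. \<beta> (\<alpha> t) (\<alpha>' t)) integrable_on {0..1} - T" "(\<lambda>t. \<beta> (\<alpha> t) (\<alpha>' t)) integrable_on {0..1}"
proof -
  have c: "continuous_on {0..1} \<alpha>" and c': "continuous_on ({0..1} - T) \<alpha>'" and T: "finite T"
    and M: "\<And>t. t \<in> {0..1} - T \<Longrightarrow> norm (\<alpha>' t) \<le> M"
    using \<alpha> by (auto simp: smooth_except_def)
  obtain B where B: "\<And>z X. z \<in> \<alpha> ` {0..1} \<Longrightarrow> norm X \<le> M \<Longrightarrow> \<bar>\<beta> z X\<bar> \<le> B"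
    using beta_bounded[OF compact_continuous_image[OF c compact_Icc] im] by blast
  have "continuous_on ({0..1} - T) (\<lambda>t. \<beta> (\<alpha> t) (\<alpha>' t))"
    by (rule continuous_on_beta[OF continuous_on_subset[OF c] c']) (use im in auto)
  from integrable_bounded_continuous[OF T this, of B]
  show "(\<lambda>t. \<beta> (\<alpha> t) (\<alpha>' t)) integrable_on {0..1} - T" "(\<lambda>t. \<beta> (\<alpha> t) (\<alpha>' t)) integrable_on {0..1}"
    using B M by auto
qed

text \<open>The perturbed curves eventually stay in a compact neighbourhood \<open>K'\<close> of the
  curve and have speed at most \<open>M + 1\<close>, so one constant \<open>B\<close> bounds all
  integrands. They converge pointwise off \<open>T\<close> because \<epsilon> controls both the
  shift and its derivative; dominated convergence finishes.\<close>

lemma flen_perturbation: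
  assumes \<alpha>: "smooth_except \<alpha> \<alpha>' T M" and im: "\<alpha> ` {0..1} \<subseteq> G"
    and \<phi>: "\<And>n. smooth_except (\<phi> n) (\<phi>' n) T (\<epsilon> n)" and b: "\<And>n t. t \<in> {0..1} \<Longrightarrow> norm (\<phi> n t) \<le> \<epsilon> n" and \<epsilon>: "\<epsilon> \<longlonglongrightarrow> 0"
  shows "eventually (\<lambda>n. (\<lambda>t. \<alpha> t + \<phi> n t) ` {0..1} \<subseteq> G) sequentially"
    and "(\<lambda>n. flen \<beta> (\<lambda>t. \<alpha> t + \<phi> n t)) \<longlonglongrightarrow> flen \<beta> \<alpha>"
proof -
  have c: "continuous_on {0..1} \<alpha>" using \<alpha> by (simp add: smooth_except_def)
  note K = compact_continuous_image[OF c compact_Icc]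
  obtain e where e: "e > 0" "(\<Union>x\<in>\<alpha> ` {0..1}. cball x e) \<subseteq> G"
    using compact_subset_open_imp_cball_epsilon_subset[OF K G im] by metis
  define K' where "K' = {x + y | x y. x \<in> \<alpha> ` {0..1} \<and> y \<in> cball 0 e}"
  have K': "compact K'" unfolding K'_def by (rule compact_sums[OF K compact_cball])
  have K'G: "K' \<subseteq> G"
  proof
    fix q assume "q \<in> K'"
    then obtain x y where xy: "x \<in> \<alpha> ` {0..1}" "norm y \<le> e" "q = x + y" by (auto simp: K'_def)
    then have "q \<in> cball x e" by (simp add: dist_norm)
    then show "q \<in> G" using e(2) xy(1) by blast
  qed
  obtain B where B: "\<And>z X. z \<in> K' \<Longrightarrow> norm X \<le> M + 1 \<Longrightarrow> \<bar>\<beta> z X\<bar> \<le> B" using beta_bounded[OF K' K'G] by blast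
  have "min e 1 > 0" using e(1) by simp
  from order_tendstoD(2)[OF \<epsilon> this] obtain N where N: "\<And>n. n \<ge> N \<Longrightarrow> \<epsilon> n < min e 1"
    unfolding eventually_sequentially by blast
  have inK: "\<alpha> t + \<phi> n t \<in> K'" if "n \<ge> N" "t \<in> {0..1}" for n t
    unfolding K'_def using b[OF that(2), of n] N[OF that(1)] that by (intro CollectI exI[of _ "\<alpha> t"] exI[of _ "\<phi> n t"]) auto
  have sm: "smooth_except (\<lambda>t. \<alpha> t + \<phi> n t) (\<lambda>t. \<alpha>' t + \<phi>' n t) T (M + \<epsilon> n)" for n
    using \<alpha> \<phi>[of n] unfolding smooth_except_def
    by (auto intro!: continuous_intros has_vector_derivative_add norm_triangle_le add_mono)
  show "eventually (\<lambda>n. (\<lambda>t. \<alpha> t + \<phi> n t) ` {0..1} \<subseteq> G) sequentially"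
    unfolding eventually_sequentially using inK K'G by (intro exI[of _ N]) blast
  define S where "S = {0..1} - T"
  have S: "t \<in> {0..1}" "norm (\<alpha>' t) \<le> M" "norm (\<phi>' n t) \<le> \<epsilon> n" if "t \<in> S" for t n
    using that \<alpha> \<phi>[of n] by (auto simp: S_def smooth_except_def)
  have "(\<lambda>n. integral S (\<lambda>t. \<beta> (\<alpha> t + \<phi> (n + N) t) (\<alpha>' t + \<phi>' (n + N) t))) \<longlonglongrightarrow> integral S (\<lambda>t. \<beta> (\<alpha> t) (\<alpha>' t))"
  proof (rule dominated_convergence(2)[where h="\<lambda>_. B"])
    show "(\<lambda>t. \<beta> (\<alpha> t + \<phi> (n + N) t) (\<alpha>' t + \<phi>' (n + N) t)) integrable_on S" for n
      unfolding S_def by (rule smooth_except_integrable(1)[OF sm]) (use inK[of "n + N"] K'G in auto)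
    show "(\<lambda>_. B) integrable_on S" unfolding S_def
      by (rule integrable_bounded_continuous(1)[where B="\<bar>B\<bar>"]) (use \<alpha> in \<open>auto simp: smooth_except_def\<close>)
    fix t assume t: "t \<in> S"
    show "norm (\<beta> (\<alpha> t + \<phi> (n + N) t) (\<alpha>' t + \<phi>' (n + N) t)) \<le> B" for n
    proof -
      have "norm (\<alpha>' t + \<phi>' (n + N) t) \<le> M + 1"
        using S(2)[OF t] S(3)[OF t, of "n + N"] N[of "n + N"] by (intro norm_triangle_le) auto
      then show ?thesis using B[OF inK[of "n + N" t]] S(1)[OF t] by simp
    qed
    have z: "(\<lambda>n. \<phi> (n + N) t) \<longlonglongrightarrow> 0" "(\<lambda>n. \<phi>' (n + N) t) \<longlonglongrightarrow> 0"
      using LIMSEQ_ignore_initial_segment[OF \<epsilon>, of N] b S[OF t] by (auto intro!: Lim_null_comparison[where g="\<lambda>n. \<epsilon> (n + N)"])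
    have lim: "(\<lambda>n. (\<alpha> t + \<phi> (n + N) t, \<alpha>' t + \<phi>' (n + N) t)) \<longlonglongrightarrow> (\<alpha> t + 0, \<alpha>' t + 0)"
      by (intro tendsto_intros z)
    show "(\<lambda>n. \<beta> (\<alpha> t + \<phi> (n + N) t) (\<alpha>' t + \<phi>' (n + N) t)) \<longlonglongrightarrow> \<beta> (\<alpha> t) (\<alpha>' t)"
      using continuous_on_tendsto_compose[OF cont lim] inK[of "_ + N" t] S(1)[OF t] K'G im
      by (auto simp: image_subset_iff subset_iff)
  qed
  then have "(\<lambda>n. flen \<beta> (\<lambda>t. \<alpha> t + \<phi> (n + N) t)) \<longlonglongrightarrow> flen \<beta> \<alpha>"
    unfolding S_def smooth_except_flen(2)[OF sm] smooth_except_flen(2)[OF \<alpha>] .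
  then show "(\<lambda>n. flen \<beta> (\<lambda>t. \<alpha> t + \<phi> n t)) \<longlonglongrightarrow> flen \<beta> \<alpha>" by (rule LIMSEQ_offset)
qed

text \<open>\<open>\<beta> x 0 = 0\<close> by homogeneity, so continuity makes \<beta> small on
  short vectors near \<open>x\<close>. The lemma serves twice: for joining points of a connected
  set, and for finding points off \<open>S\<close> at bounded distance.\<close>

lemma flen_linepath:
  assumes "x \<in> G" "e > 0"
  obtains r where "r > 0" "ball x r \<subseteq> G"
    "\<And>u v. u \<in> ball x r \<Longrightarrow> v \<in> ball x r \<Longrightarrow> linepath u v \<in> curves u v \<and> flen \<beta> (linepath u v) \<le> e"
proof -
  have "\<beta> x 0 = 0" using scale[of 0 x 0] by simp
  have "open (G \<times> (UNIV :: 'a set))" using G by (simp add: open_Times)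
  then have "isCont (\<lambda>(z, X). \<beta> z X) (x, 0)" using cont assms by (auto simp: continuous_on_eq_continuous_at)
  then have "((\<lambda>(z, X). \<beta> z X) \<longlongrightarrow> 0) (nhds (x, 0))"
    using \<open>\<beta> x 0 = 0\<close> by (simp add: isCont_def tendsto_nhds_iff)
  from order_tendstoD(2)[OF this assms(2)] obtain d where d: "d > 0" "\<And>z X. dist (z, X) (x, 0) < d \<Longrightarrow> \<beta> z X < e"
    unfolding eventually_nhds_metric by fastforce
  obtain r0 where r0: "r0 > 0" "ball x r0 \<subseteq> G" using G assms open_contains_ball by blast
  \<comment> \<open>On the segment the base point is within \<open>d/3\<close> of \<open>x\<close>
    and the velocity \<open>v - u\<close> is shorter than \<open>2 * (d/3)\<close>, so the pair
    stays within \<open>d\<close> of \<open>(x, 0)\<close>.\<close>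
  define r where "r = min r0 (d/3)"
  have r: "r > 0" "ball x r \<subseteq> G" using r0 d by (auto simp: r_def)
  show thesis
  proof (rule that[OF r], intro conjI)
    fix u v assume uv: "u \<in> ball x r" "v \<in> ball x r"
    have "closed_segment u v \<subseteq> ball x r" using uv convex_contains_segment[of "ball x r"] convex_ball by blast
    then have seg: "linepath u v t \<in> ball x r" if "t \<in> {0..1}" for t
      using linepath_in_path[OF that, of u v] by blast
    have pw: "piecewise_C1_curve (linepath u v)"
      unfolding piecewise_C1_curve_def
      by (intro conjI exI[of _ 1] exI[of _ "\<lambda>i. real i"]) (auto intro!: exI[of _ "\<lambda>_. v - u"] has_vector_derivative_linepath_within)
    show "linepath u v \<in> curves u v"
      using pw seg r(2) by (auto simp: curves_def path_image_def)
    have sm: "smooth_except (linepath u v) (\<lambda>_. v - u) {0,1} (norm (v - u))"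
      by (auto simp: smooth_except_def continuous_on_linepath has_vector_derivative_linepath_within)
    have int: "(\<lambda>t. \<beta> (linepath u v t) (v - u)) integrable_on {0..1}"
      by (rule smooth_except_integrable(2)[OF sm]) (use seg r(2) in blast)
    have "flen \<beta> (linepath u v) = integral {0..1} (\<lambda>t. \<beta> (linepath u v t) (v - u))" by (rule smooth_except_flen(1)[OF sm])
    also have "\<dots> \<le> integral {0..1} (\<lambda>t::real. e)"
    proof (rule integral_le[OF int])
      fix t :: real assume "t \<in> {0..1}"
      then have "dist (linepath u v t) x < d/3" using seg[of t] by (simp add: r_def dist_commute)
      moreover have "dist u v < 2 * (d/3)" using uv dist_triangle3[of u v x] by (simp add: r_def)
      ultimately have "dist (linepath u v t, v - u) (x, 0) < d"
        using sqrt_sum_squares_le_sum[of "dist (linepath u v t) x" "dist u v"]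
        unfolding dist_Pair_Pair by (simp add: dist_norm[of "v - u" 0] dist_norm[of u v] norm_minus_commute[of u v])
      then show "\<beta> (linepath u v t) (v - u) \<le> e" using d(2) by fastforce
    qed auto
    finally show "flen \<beta> (linepath u v) \<le> e" by simp
  qed
qed

lemma curves_smooth_except:
  assumes "\<alpha> \<in> curves x y"
  obtains \<alpha>' T M where "smooth_except \<alpha> \<alpha>' T M" "\<alpha> ` {0..1} \<subseteq> G"
  using assms piecewise_C1_smooth_except[of \<alpha>] by (auto simp: curves_def path_image_def)

text \<open>Each half is traversed at double speed; homogeneity turns the factor 2 in the velocity
  into the factor 2 of the substitution.\<close>

lemma curves_join:
  assumes \<alpha>: "\<alpha> \<in> curves x y" and \<gamma>: "\<gamma> \<in> curves y z"
  shows "\<alpha> +++ \<gamma> \<in> curves x z" "flen \<beta> (\<alpha> +++ \<gamma>) = flen \<beta> \<alpha> + flen \<beta> \<gamma>"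
proof -
  show J: "\<alpha> +++ \<gamma> \<in> curves x z"
    using \<alpha> \<gamma> piecewise_C1_curve_join[of \<alpha> \<gamma>] path_image_join_subset[of \<alpha> \<gamma>] by (auto simp: curves_def)
  obtain \<alpha>' T M where a: "smooth_except \<alpha> \<alpha>' T M" "\<alpha> ` {0..1} \<subseteq> G" by (rule curves_smooth_except[OF \<alpha>])
  obtain \<gamma>' T' M' where g: "smooth_except \<gamma> \<gamma>' T' M'" "\<gamma> ` {0..1} \<subseteq> G" by (rule curves_smooth_except[OF \<gamma>])
  let ?D = "\<lambda>t. vector_derivative (\<alpha> +++ \<gamma>) (at t within {0..1})"
  have 1: "((\<lambda>t. \<beta> (\<alpha> t) (\<alpha>' t)) has_integral flen \<beta> \<alpha>) {0..1}"
    unfolding smooth_except_flen(1)[OF a(1)] by (rule integrable_integral[OF smooth_except_integrable(2)[OF a]])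
  have 2: "((\<lambda>t. \<beta> (\<gamma> t) (\<gamma>' t)) has_integral flen \<beta> \<gamma>) {0..1}"
    unfolding smooth_except_flen(1)[OF g(1)] by (rule integrable_integral[OF smooth_except_integrable(2)[OF g]])
  have i1: "((\<lambda>t. 2 * \<beta> (\<alpha> (2*t)) (\<alpha>' (2*t))) has_integral flen \<beta> \<alpha>) {0..1/2}"
   and i2: "((\<lambda>t. 2 * \<beta> (\<gamma> (2*t - 1)) (\<gamma>' (2*t - 1))) has_integral flen \<beta> \<gamma>) {1/2..1}"
    using has_integral_affinity01 [OF 1, where m= 2 and c=0, THEN has_integral_cmul [where c=2]]
          has_integral_affinity01 [OF 2, where m= 2 and c="-1", THEN has_integral_cmul [where c=2]]
    by (simp_all only: image_affinity_atLeastAtMost_div_diff, simp_all add: scaleR_conv_of_real mult_ac)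
  have fin: "finite ((\<lambda>t. t/2) ` T)" "finite ((\<lambda>t. (t+1)/2) ` T')" using a(1) g(1) by (auto simp: smooth_except_def)
  have "((\<lambda>t. \<beta> ((\<alpha> +++ \<gamma>) t) (?D t)) has_integral flen \<beta> \<alpha>) {0..1/2}"
  proof (rule has_integral_spike_finite[OF fin(1) _ i1])
    fix t assume t: "t \<in> {0..1/2} - (\<lambda>t. t/2) ` T"
    have "2 * t \<notin> T"
    proof
      assume "2 * t \<in> T"
      then have "(2 * t) / 2 \<in> (\<lambda>t. t/2) ` T" by (rule imageI)
      then show False using t by simp
    qed
    then have t2: "2 * t \<in> {0..1} - T" using t by auto
    then have t01: "0 < t" "t < 1/2" using smooth_except_open[OF a(1)] by auto
    have d: "((\<lambda>t. 2 * t) has_vector_derivative 2) (at t)"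
      by (auto intro!: derivative_eq_intros simp: has_real_derivative_iff_has_vector_derivative[symmetric])
    have "(\<alpha> has_vector_derivative \<alpha>' (2 * t)) (at (2 * t))" using a(1) t2 by (simp add: smooth_except_def)
    from vector_diff_chain_at[OF d this] have d2: "((\<lambda>t. \<alpha> (2 * t)) has_vector_derivative 2 *\<^sub>R \<alpha>' (2 * t)) (at t)" by (simp add: comp_def)
    have "((\<alpha> +++ \<gamma>) has_vector_derivative 2 *\<^sub>R \<alpha>' (2 * t)) (at t)"
      by (rule has_vector_derivative_transform_within_open[OF d2, of "{0<..<1/2}"]) (use t01 in \<open>auto simp: joinpaths_def\<close>)
    moreover have "at t within {0..1} = at t" using t01 by (intro at_within_Icc_at) auto
    ultimately have "?D t = 2 *\<^sub>R \<alpha>' (2 * t)" by (simp add: vector_derivative_at)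
    then show "\<beta> ((\<alpha> +++ \<gamma>) t) (?D t) = 2 * \<beta> (\<alpha> (2*t)) (\<alpha>' (2*t))"
      using t01 scale[of 2] by (simp add: joinpaths_def)
  qed
  moreover have "((\<lambda>t. \<beta> ((\<alpha> +++ \<gamma>) t) (?D t)) has_integral flen \<beta> \<gamma>) {1/2..1}"
  proof (rule has_integral_spike_finite[OF fin(2) _ i2])
    fix t assume t: "t \<in> {1/2..1} - (\<lambda>t. (t+1)/2) ` T'"
    have "2 * t - 1 \<notin> T'"
    proof
      assume "2 * t - 1 \<in> T'"
      then have "((2 * t - 1) + 1) / 2 \<in> (\<lambda>t. (t+1)/2) ` T'" by (rule imageI)
      then show False using t by simp
    qed
    then have t2: "2 * t - 1 \<in> {0..1} - T'" using t by auto
    then have t01: "1/2 < t" "t < 1" using smooth_except_open[OF g(1)] by auto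
    have d: "((\<lambda>t. 2 * t - 1) has_vector_derivative 2) (at t)"
      by (auto intro!: derivative_eq_intros simp: has_real_derivative_iff_has_vector_derivative[symmetric])
    have "(\<gamma> has_vector_derivative \<gamma>' (2 * t - 1)) (at (2 * t - 1))" using g(1) t2 by (simp add: smooth_except_def)
    from vector_diff_chain_at[OF d this] have d2: "((\<lambda>t. \<gamma> (2 * t - 1)) has_vector_derivative 2 *\<^sub>R \<gamma>' (2 * t - 1)) (at t)" by (simp add: comp_def)
    have "((\<alpha> +++ \<gamma>) has_vector_derivative 2 *\<^sub>R \<gamma>' (2 * t - 1)) (at t)"
      by (rule has_vector_derivative_transform_within_open[OF d2, of "{1/2<..<1}"]) (use t01 in \<open>auto simp: joinpaths_def\<close>)
    moreover have "at t within {0..1} = at t" using t01 by (intro at_within_Icc_at) auto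
    ultimately have "?D t = 2 *\<^sub>R \<gamma>' (2 * t - 1)" by (simp add: vector_derivative_at)
    then show "\<beta> ((\<alpha> +++ \<gamma>) t) (?D t) = 2 * \<beta> (\<gamma> (2*t - 1)) (\<gamma>' (2*t - 1))"
      using t01 scale[of 2] by (simp add: joinpaths_def)
  qed
  ultimately have "((\<lambda>t. \<beta> ((\<alpha> +++ \<gamma>) t) (?D t)) has_integral flen \<beta> \<alpha> + flen \<beta> \<gamma>) {0..1}"
    by (intro has_integral_combine[of 0 "1/2" 1]) auto
  then show "flen \<beta> (\<alpha> +++ \<gamma>) = flen \<beta> \<alpha> + flen \<beta> \<gamma>" unfolding flen_def[of \<beta> "\<alpha> +++ \<gamma>"] by (rule integral_unique)
qed

lemma curves_nonempty:
  assumes "connected G" "x \<in> G" "y \<in> G" shows "curves x y \<noteq> {}"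
proof (rule connected_equivalence_relation_gen[OF assms(1-3), where P="\<lambda>_. True" and R="\<lambda>x y. curves x y \<noteq> {}"])
  show "curves x z \<noteq> {}" if "curves x y \<noteq> {}" "curves y z \<noteq> {}" for x y z
    using that curves_join(1) by blast
  show "\<exists>T. openin (top_of_set G) T \<and> a \<in> T \<and> (\<forall>x\<in>T. \<forall>y\<in>T. True \<and> True \<longrightarrow> curves x y \<noteq> {})" if a: "a \<in> G" for a
  proof -
    obtain r where r: "r > 0" "ball a r \<subseteq> G"
      "\<And>u v. u \<in> ball a r \<Longrightarrow> v \<in> ball a r \<Longrightarrow> linepath u v \<in> curves u v \<and> flen \<beta> (linepath u v) \<le> 1"
      by (rule flen_linepath[OF a zero_less_one]) blast
    show ?thesis
    proof (intro exI[of _ "ball a r"] conjI ballI impI)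
      show "curves x y \<noteq> {}" if "x \<in> ball a r" "y \<in> ball a r" for x y using r(3)[OF that] by blast
    qed (use r(1,2) in \<open>auto intro: open_subset\<close>)
  qed
qed auto

end

section \<open>Hyperbolicity for the Bergman distance\<close>

lemma gromov_hyperbolic_cong:
  assumes "\<And>x y. x \<in> X \<Longrightarrow> y \<in> X \<Longrightarrow> d x y = d' x y"
  shows "gromov_hyperbolic X d \<longleftrightarrow> gromov_hyperbolic X d'"
  unfolding gromov_hyperbolic_def gromov_product_def using assms by simp

text \<open>All Gromov products equal \<open>c / 2\<close>.\<close>

lemma gromov_hyperbolic_const:
  assumes "\<And>x y. x \<in> X \<Longrightarrow> y \<in> X \<Longrightarrow> d x y = c"
  shows "gromov_hyperbolic X d"
  unfolding gromov_hyperbolic_def gromov_product_def using assms by (intro exI[of _ 0]) auto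

text \<open>Replacing points by neighbours in \<open>Y\<close> changes each distance by at most
  \<open>2 * C\<close>, and each Gromov product, half a signed sum of three distances, by at most
  \<open>3 * C\<close>. \<open>near\<close> bounds both orders of the arguments because
  \<open>d\<close> is not assumed symmetric.\<close>

lemma gromov_hyperbolic_dense:
  assumes YX: "Y \<subseteq> X" and tri: "\<And>x y z. x \<in> X \<Longrightarrow> y \<in> X \<Longrightarrow> z \<in> X \<Longrightarrow> d x z \<le> d x y + d y z"
    and near: "\<And>x. x \<in> X \<Longrightarrow> \<exists>x'\<in>Y. d x x' \<le> C \<and> d x' x \<le> C"
  shows "gromov_hyperbolic X d \<longleftrightarrow> gromov_hyperbolic Y d"
proof
  show "gromov_hyperbolic Y d" if "gromov_hyperbolic X d"
    using that YX unfolding gromov_hyperbolic_def by blast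
  assume "gromov_hyperbolic Y d"
  then obtain \<delta> where \<delta>: "\<delta> \<ge> 0" "\<And>x y z p. x \<in> Y \<Longrightarrow> y \<in> Y \<Longrightarrow> z \<in> Y \<Longrightarrow> p \<in> Y \<Longrightarrow>
      gromov_product d p x y \<ge> min (gromov_product d p x z) (gromov_product d p z y) - \<delta>"
    unfolding gromov_hyperbolic_def by blast
  obtain h where h: "\<And>x. x \<in> X \<Longrightarrow> h x \<in> Y \<and> d x (h x) \<le> C \<and> d (h x) x \<le> C" using near by metis
  have cl: "\<bar>d x y - d (h x) (h y)\<bar> \<le> 2 * C" if "x \<in> X" "y \<in> X" for x y
  proof -
    have hX: "h x \<in> X" "h y \<in> X" using h that YX by auto
    have "d x y \<le> d x (h x) + d (h x) y" "d (h x) y \<le> d (h x) (h y) + d (h y) y"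
      "d (h x) (h y) \<le> d (h x) x + d x (h y)" "d x (h y) \<le> d x y + d y (h y)"
      using tri that hX by auto
    then show ?thesis using h[OF that(1)] h[OF that(2)] by linarith
  qed
  have gp: "\<bar>gromov_product d p x y - gromov_product d (h p) (h x) (h y)\<bar> \<le> 3 * C" if "x \<in> X" "y \<in> X" "p \<in> X" for x y p
    using cl[OF that(1,3)] cl[OF that(2,3)] cl[OF that(1,2)] unfolding gromov_product_def by argo
  show "gromov_hyperbolic X d"
    unfolding gromov_hyperbolic_def
  \<comment> \<open>Each side of the four-point inequality may move by \<open>3 * C\<close>; the
    absolute value makes the constant nonnegative whatever \<open>C\<close> is.\<close>
  proof (intro exI[of _ "\<delta> + 6 * \<bar>C\<bar>"] conjI ballI)
    fix x y z p assume X: "x \<in> X" "y \<in> X" "z \<in> X" "p \<in> X"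
    have "gromov_product d (h p) (h x) (h y) \<ge> min (gromov_product d (h p) (h x) (h z)) (gromov_product d (h p) (h z) (h y)) - \<delta>"
      using \<delta>(2) h X by blast
    then show "gromov_product d p x y \<ge> min (gromov_product d p x z) (gromov_product d p z y) - (\<delta> + 6 * \<bar>C\<bar>)"
      using gp[OF X(1,2,4)] gp[OF X(1,3,4)] gp[OF X(3,2,4)] abs_ge_self[of C] unfolding min_def by (auto split: if_splits)
  qed (use \<delta> in auto)
qed

text \<open>Valid also for sets without lower bounds: the real \<open>Inf\<close> unfolds to a least
  upper bound of the negatives, which depends on a set only through its bounds. Distances can thus
  be compared before lengths are known to be bounded below.\<close>

lemma Inf_eq_lower_bounds:
  fixes A B :: "real set"
  assumes "\<And>c. (\<forall>x\<in>A. c \<le> x) \<longleftrightarrow> (\<forall>x\<in>B. c \<le> x)" shows "Inf A = Inf B"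
proof -
  have "(\<forall>x\<in>uminus ` A. x \<le> z) \<longleftrightarrow> (\<forall>x\<in>uminus ` B. x \<le> z)" for z
    using assms[of "- z"] by (simp add: minus_le_iff)
  then show ?thesis unfolding Inf_real_def Sup_real_def by simp
qed

lemma hyperplane_complement_dense:
  fixes \<Omega> :: "(complex^'n) set"
  assumes "open \<Omega>" "complex_hyperplane S" "x \<in> \<Omega>" "r > 0"
  obtains x' where "x' \<in> \<Omega> - S" "x' \<in> ball x r"
proof -
  obtain a b i where S: "a $ i \<noteq> 0" "S = {z. lform a z = b}" using complex_hyperplaneE[OF assms(2)] .
  have "negligible S" unfolding S(2)
    using hyperplane_null_sets[OF S(1), of b] by (simp add: negligible_iff_null_sets null_sets_completionI)
  moreover have "open (\<Omega> \<inter> ball x r)" "x \<in> \<Omega> \<inter> ball x r" using assms by auto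
  ultimately have "\<not> \<Omega> \<inter> ball x r \<subseteq> S" using negligible_subset open_not_negligible by blast
  then show thesis using that by blast
qed

lemma piecewise_C1_curve_add:
  fixes \<alpha> \<phi> :: "real \<Rightarrow> 'a::real_normed_vector"
  assumes "piecewise_C1_curve \<alpha>" and \<phi>: "\<And>t. (\<phi> has_vector_derivative \<phi>' t) (at t)" "continuous_on UNIV \<phi>'"
  shows "piecewise_C1_curve (\<lambda>t. \<alpha> t + \<phi> t)"
proof -
  obtain m p where p: "p 0 = 0" "p m = 1" "\<forall>i<m. p i < p (Suc i)"
    and ex: "\<forall>i<m. \<exists>a. continuous_on {p i..p (Suc i)} a \<and> (\<forall>t\<in>{p i..p (Suc i)}. (\<alpha> has_vector_derivative a t) (at t within {p i..p (Suc i)}))"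
    and path: "path \<alpha>"
    using assms(1) unfolding piecewise_C1_curve_def by blast
  have "continuous_on UNIV \<phi>"
    by (intro continuous_at_imp_continuous_on ballI has_vector_derivative_continuous[OF \<phi>(1)])
  then have "path (\<lambda>t. \<alpha> t + \<phi> t)"
    using path continuous_on_add continuous_on_subset[of UNIV \<phi> "{0..1}"] unfolding path_def by blast
  moreover have "\<exists>a. continuous_on {p i..p (Suc i)} a \<and> (\<forall>t\<in>{p i..p (Suc i)}. ((\<lambda>t. \<alpha> t + \<phi> t) has_vector_derivative a t) (at t within {p i..p (Suc i)}))"
    if i: "i < m" for i
  proof -
    obtain a where a: "continuous_on {p i..p (Suc i)} a" "\<And>t. t \<in> {p i..p (Suc i)} \<Longrightarrow> (\<alpha> has_vector_derivative a t) (at t within {p i..p (Suc i)})"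
      using ex i by blast
    have "continuous_on {p i..p (Suc i)} (\<lambda>t. a t + \<phi>' t)"
      by (intro continuous_on_add a continuous_on_subset[OF \<phi>(2)]) auto
    moreover have "((\<lambda>t. \<alpha> t + \<phi> t) has_vector_derivative a t + \<phi>' t) (at t within {p i..p (Suc i)})" if "t \<in> {p i..p (Suc i)}" for t
      by (intro has_vector_derivative_add a has_vector_derivative_at_within[OF \<phi>(1)] that)
    ultimately show ?thesis by blast
  qed
  ultimately show ?thesis unfolding piecewise_C1_curve_def using p by blast
qed

lemma bounded_linear_lform: "bounded_linear (lform a)"
proof -
  have "linear (lform a)"
    by (rule linearI) (simp_all add: lform_add lform_scaleR scaleR_conv_of_real[where 'a=complex])
  then show ?thesis by (simp add: linear_conv_bounded_linear)
qed

text \<open>For a fixed curve, the parameters \<open>\<tau>\<close> for which the curve shifted by \<open>t (1 - t) \<tau> e\<close> meets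
  the hyperplane form a piecewise \<open>C\<^sup>1\<close> curve in the plane, hence a null set.\<close>

lemma generic_shift:
  fixes \<alpha> :: "real \<Rightarrow> complex^'n"
  assumes \<alpha>: "smooth_except \<alpha> \<alpha>' T M" and \<epsilon>: "\<epsilon> > 0"
  obtains \<tau> where "cmod \<tau> < \<epsilon>" "\<And>t. 0 < t \<Longrightarrow> t < 1 \<Longrightarrow> lform a (\<alpha> t) + of_real (t * (1 - t)) * \<tau> \<noteq> b"
proof -
  \<comment> \<open>For \<open>0 < t < 1\<close>, \<open>g t\<close> is the value of \<tau> that
    puts the shifted curve on the hyperplane at time \<open>t\<close>, so the image of
    \<open>g\<close> contains all values to avoid.\<close>
  define g where "g t = (b - lform a (\<alpha> t)) / complex_of_real (t * (1 - t))" for t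
  have T: "finite T" using \<alpha> by (simp add: smooth_except_def)
  have "g differentiable_on ({0..1} - T)"
    unfolding differentiable_on_def
  proof
    fix t assume t: "t \<in> {0..1} - T"
    then have t01: "0 < t" "t < 1" using smooth_except_open[OF \<alpha>] by auto
    have "(\<alpha> has_vector_derivative \<alpha>' t) (at t)" using \<alpha> t by (simp add: smooth_except_def)
    from bounded_linear.has_vector_derivative[OF bounded_linear_lform this]
    have "(\<lambda>t. lform a (\<alpha> t)) differentiable (at t)" by (rule differentiableI_vector)
    moreover have "(\<lambda>t. complex_of_real (t * (1 - t))) differentiable (at t)"
      by (rule differentiableI_vector, rule has_vector_derivative_of_real) (auto intro!: derivative_eq_intros)
    moreover have "complex_of_real (t * (1 - t)) \<noteq> 0" using t01 by (simp del: of_real_mult of_real_diff)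
    ultimately have "g differentiable (at t)" unfolding g_def
      by (intro differentiable_divide differentiable_diff differentiable_const) auto
    then show "g differentiable (at t within {0..1} - T)" by (rule differentiable_at_withinI)
  qed
  then have "negligible (g ` ({0..1} - T))" by (intro negligible_differentiable_image_lowdim) auto
  moreover have "negligible (g ` T)" using T by (simp add: negligible_finite)
  ultimately have "negligible (g ` ({0..1} - T) \<union> g ` T)" by (rule negligible_Un)
  then have "\<not> ball 0 \<epsilon> \<subseteq> g ` ({0..1} - T) \<union> g ` T"
    using negligible_subset open_not_negligible[of "ball 0 \<epsilon>"] \<epsilon> by (metis ball_eq_empty not_less open_ball)
  then obtain \<tau> where "\<tau> \<in> ball 0 \<epsilon>" and \<tau>2: "\<tau> \<notin> g ` ({0..1} - T) \<union> g ` T" by blast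
  then have \<tau>1: "cmod \<tau> < \<epsilon>" by simp
  show thesis
  proof (rule that[OF \<tau>1])
    fix t :: real assume t: "0 < t" "t < 1"
    have nz: "complex_of_real (t * (1 - t)) \<noteq> 0" using t by (simp del: of_real_mult of_real_diff)
    have "\<tau> \<noteq> g t" using \<tau>2 t by auto
    then show "lform a (\<alpha> t) + of_real (t * (1 - t)) * \<tau> \<noteq> b"
      using nz by (auto simp: g_def field_simps)
  qed
qed

lemma length_metric_bergman:
  assumes "open G" "bounded G" shows "length_metric G (bergman_metric G)"
  using assms bergman_metric_continuous[OF assms] bergman_metric_scale by unfold_locales auto

lemma bergman_dist_flen:
  assumes "open G" "bounded G"
  shows "bergman_dist G x y = (INF \<alpha>\<in>length_metric.curves G x y. flen (bergman_metric G) \<alpha>)"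
proof -
  interpret length_metric G "bergman_metric G" by (rule length_metric_bergman[OF assms])
  show ?thesis unfolding bergman_dist_def curves_def bergman_length_def flen_def ..
qed


text \<open>A curve in \<open>\<Omega> - S\<close> has the same length for both metrics, and the
  length of a curve in \<Omega> is a limit of lengths of curves in \<open>\<Omega> - S\<close>.
  Hence the two sets of lengths have the same lower bounds, which settles the infima, default values
  included.\<close>

lemma bergman_dist_Diff_hyperplane:
  fixes \<Omega> S :: "(complex^'n) set"
  assumes \<Omega>: "open \<Omega>" "bounded \<Omega>" and S: "complex_hyperplane S" and xy: "x \<in> \<Omega> - S" "y \<in> \<Omega> - S"
  shows "bergman_dist (\<Omega> - S) x y = bergman_dist \<Omega> x y"
proof -
  note H = open_Diff_hyperplane[OF \<Omega>(1) S]
  note bH = bounded_subset[OF \<Omega>(2) Diff_subset, of S]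
  interpret A: length_metric \<Omega> "bergman_metric \<Omega>" by (rule length_metric_bergman[OF \<Omega>])
  interpret B: length_metric "\<Omega> - S" "bergman_metric (\<Omega> - S)" by (rule length_metric_bergman[OF H bH])
  obtain a b i where ai: "a $ i \<noteq> 0" and S': "S = {z. lform a z = b}" using complex_hyperplaneE[OF S] .
  define e where "e = axis i (1 / a $ i)"
  have e: "lform a e = 1" using ai by (simp add: e_def lform_axis)
  have sub: "\<alpha> \<in> A.curves x y" "flen (bergman_metric (\<Omega> - S)) \<alpha> = flen (bergman_metric \<Omega>) \<alpha>" if "\<alpha> \<in> B.curves x y" for \<alpha>
  proof -
    show "\<alpha> \<in> A.curves x y" using that by (auto simp: A.curves_def B.curves_def)
    have "\<alpha> t \<in> \<Omega> - S" if "t \<in> {0..1}" for t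
      using \<open>\<alpha> \<in> B.curves x y\<close> that unfolding B.curves_def path_image_def by blast
    then show "flen (bergman_metric (\<Omega> - S)) \<alpha> = flen (bergman_metric \<Omega>) \<alpha>"
      unfolding flen_def by (intro integral_cong bergman_metric_Diff_hyperplane[OF \<Omega> S])
  qed
  have approx: "\<exists>X. (\<forall>n. X n \<in> B.curves x y) \<and> (\<lambda>n. flen (bergman_metric \<Omega>) (X n)) \<longlonglongrightarrow> flen (bergman_metric \<Omega>) \<alpha>"
    if \<alpha>: "\<alpha> \<in> A.curves x y" for \<alpha>
  proof -
    obtain \<alpha>' T M where sm: "smooth_except \<alpha> \<alpha>' T M" "\<alpha> ` {0..1} \<subseteq> \<Omega>" by (rule A.curves_smooth_except[OF \<alpha>])
    have "\<exists>\<tau>. cmod \<tau> < 1 / real (Suc n) \<and> (\<forall>t. 0 < t \<longrightarrow> t < 1 \<longrightarrow> lform a (\<alpha> t) + of_real (t * (1 - t)) * \<tau> \<noteq> b)" for n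
      by (rule generic_shift[OF sm(1), of "1 / real (Suc n)" a b]) auto
    then obtain \<tau> where \<tau>: "\<And>n. cmod (\<tau> n) < 1 / real (Suc n)"
      "\<And>n t. 0 < t \<Longrightarrow> t < 1 \<Longrightarrow> lform a (\<alpha> t) + of_real (t * (1 - t)) * \<tau> n \<noteq> b" by metis
    \<comment> \<open>The factor \<open>t * (1 - t)\<close> keeps the end points fixed; on the unit
      interval the shift and its derivative are both bounded by \<open>\<epsilon> n\<close>, as
      \<open>flen_perturbation\<close> asks.\<close>
    define \<phi> where "\<phi> n t = (t * (1 - t)) *\<^sub>R (\<tau> n *s e)" for n t
    define \<phi>' where "\<phi>' n t = (1 - 2 * t) *\<^sub>R (\<tau> n *s e)" for n t
    define \<epsilon> where "\<epsilon> n = cmod (\<tau> n) * norm e" for n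
    have d\<phi>: "(\<phi> n has_vector_derivative \<phi>' n t) (at t)" for n t
      unfolding \<phi>_def \<phi>'_def
      by (auto intro!: derivative_eq_intros simp: has_real_derivative_iff_has_vector_derivative[symmetric])
    have c\<phi>': "continuous_on A (\<phi>' n)" for A n unfolding \<phi>'_def by (intro continuous_intros)
    have le: "\<bar>t * (1 - t)\<bar> \<le> 1" "\<bar>1 - 2 * t\<bar> \<le> 1" if "t \<in> {0..1}" for t :: real
    proof -
      show "\<bar>t * (1 - t)\<bar> \<le> 1" using that by (simp add: abs_mult mult_le_one)
      show "\<bar>1 - 2 * t\<bar> \<le> 1" using that by auto
    qed
    have b\<phi>: "norm (\<phi> n t) \<le> \<epsilon> n" "norm (\<phi>' n t) \<le> \<epsilon> n" if "t \<in> {0..1}" for n t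
      using le[OF that] by (auto simp: \<phi>_def \<phi>'_def \<epsilon>_def norm_vector_smult intro!: mult_left_le_one_le)
    have sm\<phi>: "smooth_except (\<phi> n) (\<phi>' n) T (\<epsilon> n)" for n
    proof -
      have "continuous_on {0..1} (\<phi> n)" unfolding \<phi>_def by (intro continuous_intros)
      then show ?thesis using sm(1) d\<phi> c\<phi>' b\<phi> by (simp add: smooth_except_def)
    qed
    have \<epsilon>0: "\<epsilon> \<longlonglongrightarrow> 0"
    proof (rule Lim_null_comparison[where g="\<lambda>n. 1 / real (Suc n) * norm e"])
      show "\<forall>\<^sub>F n in sequentially. norm (\<epsilon> n) \<le> 1 / real (Suc n) * norm e"
      proof (intro always_eventually allI)
        fix n
        have "cmod (\<tau> n) * norm e \<le> 1 / real (Suc n) * norm e"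
          by (rule mult_right_mono[OF less_imp_le[OF \<tau>(1)]]) simp
        then show "norm (\<epsilon> n) \<le> 1 / real (Suc n) * norm e" by (simp add: \<epsilon>_def)
      qed
      show "(\<lambda>n. 1 / real (Suc n) * norm e) \<longlonglongrightarrow> 0"
        using tendsto_mult[OF LIMSEQ_inverse_real_of_nat tendsto_const[of "norm e"]]
        by (simp only: inverse_eq_divide mult_zero_left)
    qed
    note per = A.flen_perturbation[OF sm sm\<phi> b\<phi>(1) \<epsilon>0]
    obtain N where N: "\<And>n. n \<ge> N \<Longrightarrow> (\<lambda>t. \<alpha> t + \<phi> n t) ` {0..1} \<subseteq> \<Omega>" using per(1) unfolding eventually_sequentially by blast
    define X where "X n = (\<lambda>t. \<alpha> t + \<phi> (n + N) t)" for n
    have "X n \<in> B.curves x y" for n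
    proof -
      have ends: "\<alpha> 0 = x" "\<alpha> 1 = y" using \<alpha> by (auto simp: A.curves_def pathstart_def pathfinish_def)
      have "X n t \<notin> S" if t: "t \<in> {0..1}" for t
      proof (cases "t = 0 \<or> t = 1")
        case True
        then show ?thesis using ends xy by (auto simp: X_def \<phi>_def)
      next
        case False
        then have "0 < t" "t < 1" using t by auto
        from \<tau>(2)[OF this, of "n + N"] show ?thesis
          by (simp add: X_def \<phi>_def S' lform_add lform_scaleR lform_smult e)
      qed
      then have "path_image (X n) \<subseteq> \<Omega> - S" using N[of "n + N"] by (auto simp: path_image_def X_def)
      moreover have "piecewise_C1_curve (X n)"
        unfolding X_def using \<alpha> by (intro piecewise_C1_curve_add[OF _ d\<phi> c\<phi>']) (simp add: A.curves_def)
      ultimately show ?thesis using ends by (simp add: B.curves_def pathstart_def pathfinish_def X_def \<phi>_def)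
    qed
    moreover have "(\<lambda>n. flen (bergman_metric \<Omega>) (X n)) \<longlonglongrightarrow> flen (bergman_metric \<Omega>) \<alpha>"
      unfolding X_def by (rule LIMSEQ_ignore_initial_segment[OF per(2)])
    ultimately show ?thesis by blast
  qed
  have "(\<forall>\<alpha>\<in>B.curves x y. c \<le> flen (bergman_metric (\<Omega> - S)) \<alpha>) \<longleftrightarrow> (\<forall>\<alpha>\<in>A.curves x y. c \<le> flen (bergman_metric \<Omega>) \<alpha>)" for c
  proof
    assume c: "\<forall>\<alpha>\<in>B.curves x y. c \<le> flen (bergman_metric (\<Omega> - S)) \<alpha>"
    show "\<forall>\<alpha>\<in>A.curves x y. c \<le> flen (bergman_metric \<Omega>) \<alpha>"
    proof
      fix \<alpha> assume "\<alpha> \<in> A.curves x y"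
      from approx[OF this] obtain X where X: "\<And>n. X n \<in> B.curves x y" "(\<lambda>n. flen (bergman_metric \<Omega>) (X n)) \<longlonglongrightarrow> flen (bergman_metric \<Omega>) \<alpha>" by blast
      have "c \<le> flen (bergman_metric \<Omega>) (X n)" for n using c X(1)[of n] sub(2)[of "X n"] by auto
      then show "c \<le> flen (bergman_metric \<Omega>) \<alpha>" using X(2) LIMSEQ_le_const by blast
    qed
  next
    assume "\<forall>\<alpha>\<in>A.curves x y. c \<le> flen (bergman_metric \<Omega>) \<alpha>"
    then show "\<forall>\<alpha>\<in>B.curves x y. c \<le> flen (bergman_metric (\<Omega> - S)) \<alpha>" using sub by auto
  qed
  then show ?thesis unfolding bergman_dist_flen[OF \<Omega>] bergman_dist_flen[OF H bH]
    by (intro Inf_eq_lower_bounds) simp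
qed

text \<open>Lengths are not known to be nonnegative here.  If they are unbounded below for one pair of
  points, they are so for every pair, and the infimum defaults to a constant.\<close>

lemma bergman_hyperbolic_iff:
  fixes \<Omega> S :: "(complex^'n) set"
  assumes \<Omega>: "open \<Omega>" "connected \<Omega>" "bounded \<Omega>" and S: "complex_hyperplane S"
  shows "gromov_hyperbolic \<Omega> (bergman_dist \<Omega>) \<longleftrightarrow> gromov_hyperbolic (\<Omega> - S) (bergman_dist (\<Omega> - S))"
proof -
  interpret length_metric \<Omega> "bergman_metric \<Omega>" by (rule length_metric_bergman[OF \<Omega>(1,3)])
  define L where "L x y = flen (bergman_metric \<Omega>) ` curves x y" for x y
  have d: "bergman_dist \<Omega> x y = Inf (L x y)" for x y by (simp add: bergman_dist_flen[OF \<Omega>(1,3)] L_def)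
  have cong: "gromov_hyperbolic (\<Omega> - S) (bergman_dist (\<Omega> - S)) \<longleftrightarrow> gromov_hyperbolic (\<Omega> - S) (bergman_dist \<Omega>)"
    by (rule gromov_hyperbolic_cong) (rule bergman_dist_Diff_hyperplane[OF \<Omega>(1,3) S])
  have ne: "L x y \<noteq> {}" if "x \<in> \<Omega>" "y \<in> \<Omega>" for x y using curves_nonempty[OF \<Omega>(2) that] by (simp add: L_def)
  have add: "u + v \<in> L x z" if "u \<in> L x y" "v \<in> L y z" for u v x y z
  proof -
    obtain \<alpha> \<gamma> where *: "\<alpha> \<in> curves x y" "\<gamma> \<in> curves y z" "u = flen (bergman_metric \<Omega>) \<alpha>" "v = flen (bergman_metric \<Omega>) \<gamma>"
      using \<open>u \<in> L x y\<close> \<open>v \<in> L y z\<close> unfolding L_def by blast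
    then show ?thesis unfolding L_def
      using curves_join[OF *(1,2)] by (intro image_eqI[of _ _ "\<alpha> +++ \<gamma>"]) simp_all
  qed
  show ?thesis
  proof (cases "\<forall>x\<in>\<Omega>. \<forall>y\<in>\<Omega>. bdd_below (L x y)")
    case True
    have tri: "bergman_dist \<Omega> x z \<le> bergman_dist \<Omega> x y + bergman_dist \<Omega> y z" if X: "x \<in> \<Omega>" "y \<in> \<Omega>" "z \<in> \<Omega>" for x y z
    proof -
      have 1: "Inf (L x z) - v \<le> u" if "u \<in> L x y" "v \<in> L y z" for u v
        using cInf_lower[OF add[OF that]] True X by force
      have 2: "Inf (L x z) - v \<le> Inf (L x y)" if "v \<in> L y z" for v
        by (rule cInf_greatest[OF ne[OF X(1,2)]]) (use 1 that in blast)
      have "Inf (L x z) - Inf (L x y) \<le> Inf (L y z)"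
        by (rule cInf_greatest[OF ne[OF X(2,3)]]) (use 2 in force)
      then show ?thesis unfolding d by linarith
    qed
    \<comment> \<open>Only the radius below depends on \<open>x\<close>; the bound 1 does not, so
      one constant serves in \<open>gromov_hyperbolic_dense\<close>.\<close>
    have near: "\<exists>x'\<in>\<Omega> - S. bergman_dist \<Omega> x x' \<le> 1 \<and> bergman_dist \<Omega> x' x \<le> 1" if x: "x \<in> \<Omega>" for x
    proof -
      obtain r where r: "r > 0" "ball x r \<subseteq> \<Omega>"
        "\<And>u v. u \<in> ball x r \<Longrightarrow> v \<in> ball x r \<Longrightarrow> linepath u v \<in> curves u v \<and> flen (bergman_metric \<Omega>) (linepath u v) \<le> 1"
        by (rule flen_linepath[OF x zero_less_one]) blast
      have le: "bergman_dist \<Omega> u v \<le> 1" if uv: "u \<in> ball x r" "v \<in> ball x r" for u v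
      proof -
        have "flen (bergman_metric \<Omega>) (linepath u v) \<in> L u v" using r(3)[OF uv] by (simp add: L_def)
        moreover have "u \<in> \<Omega>" "v \<in> \<Omega>" using uv r(2) by (simp_all only: subsetD)
        then have "bdd_below (L u v)" using True by simp
        ultimately have "Inf (L u v) \<le> flen (bergman_metric \<Omega>) (linepath u v)" by (rule cInf_lower)
        then show ?thesis using r(3)[OF uv] unfolding d by linarith
      qed
      obtain x' where "x' \<in> \<Omega> - S" "x' \<in> ball x r" by (rule hyperplane_complement_dense[OF \<Omega>(1) S x r(1)])
      then show ?thesis using le r(1) by (intro bexI[of _ x']) auto
    qed
    show ?thesis unfolding cong by (rule gromov_hyperbolic_dense[OF Diff_subset tri near])
  next
    case False
    then obtain x0 y0 where 0: "x0 \<in> \<Omega>" "y0 \<in> \<Omega>" "\<not> bdd_below (L x0 y0)" by metis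
    have unb: "\<not> bdd_below (L x y)" if xy: "x \<in> \<Omega>" "y \<in> \<Omega>" for x y
    proof
      assume "bdd_below (L x y)"
      then obtain c where c: "\<And>v. v \<in> L x y \<Longrightarrow> c \<le> v" by (auto simp: bdd_below_def)
      obtain u w where uw: "u \<in> L x x0" "w \<in> L y0 y"
        using ne[OF xy(1) 0(1)] ne[OF 0(2) xy(2)] by blast
      have "c - u - w \<le> v" if "v \<in> L x0 y0" for v
        using c[OF add[OF add[OF uw(1) that] uw(2)]] by linarith
      then show False using 0(3) by (auto simp: bdd_below_def)
    qed
    \<comment> \<open>Neither set of lengths has a lower bound, so both have the same lower bounds,
      namely none.\<close>
    have "Inf (L x y) = Inf (L x0 y0)" if "x \<in> \<Omega>" "y \<in> \<Omega>" for x y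
      using unb[OF that] 0(3) by (intro Inf_eq_lower_bounds) (auto simp: bdd_below_def)
    then have "bergman_dist \<Omega> x y = Inf (L x0 y0)" if "x \<in> \<Omega>" "y \<in> \<Omega>" for x y using that by (simp add: d)
    then have "gromov_hyperbolic \<Omega> (bergman_dist \<Omega>)" "gromov_hyperbolic (\<Omega> - S) (bergman_dist \<Omega>)"
      by (auto intro!: gromov_hyperbolic_const)
    then show ?thesis unfolding cong by blast
  qed
qed

section \<open>Hyperbolicity for the Caratheodory distance\<close>

lemma pseudohyperbolic_identity:
  "(cmod (1 - cnj a * b))\<^sup>2 - (cmod (a - b))\<^sup>2 = (1 - (cmod a)\<^sup>2) * (1 - (cmod b)\<^sup>2)"
  unfolding cmod_power2 by (simp add: power2_eq_square algebra_simps)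

definition pseudohyp :: "complex \<Rightarrow> complex \<Rightarrow> real" where
  "pseudohyp a b = cmod ((a - b) / (1 - cnj a * b))"

lemma one_minus_cnj_nonzero:
  assumes "cmod a < 1" "cmod b < 1" shows "1 - cnj a * b \<noteq> 0"
proof
  assume "1 - cnj a * b = 0"
  then have "cmod (cnj a * b) = 1" by simp
  moreover have "cmod (cnj a * b) < 1" using mult_strict_mono[of "cmod a" 1 "cmod b" 1] assms by (simp add: norm_mult)
  ultimately show False by simp
qed

lemma one_minus_square_pos: "cmod a < 1 \<Longrightarrow> 0 < 1 - (cmod a)\<^sup>2"
  using power_strict_mono[of "cmod a" 1 2] by simp

lemma pseudohyp_square:
  assumes "cmod a < 1" "cmod b < 1"
  shows "1 - (pseudohyp a b)\<^sup>2 = (1 - (cmod a)\<^sup>2) * (1 - (cmod b)\<^sup>2) / (cmod (1 - cnj a * b))\<^sup>2"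
proof -
  have "(pseudohyp a b)\<^sup>2 = (cmod (a - b))\<^sup>2 / (cmod (1 - cnj a * b))\<^sup>2"
    by (simp add: pseudohyp_def norm_divide power_divide)
  moreover have "1 - x / y = (y - x) / y" if "y \<noteq> 0" for x y :: real using that by (simp add: diff_divide_distrib)
  ultimately show ?thesis
    unfolding pseudohyperbolic_identity[symmetric] using one_minus_cnj_nonzero[OF assms] by simp
qed

lemma pseudohyp_less_1:
  assumes "cmod a < 1" "cmod b < 1" shows "pseudohyp a b < 1"
proof -
  have "0 < 1 - (pseudohyp a b)\<^sup>2" unfolding pseudohyp_square[OF assms]
    using one_minus_square_pos[OF assms(1)] one_minus_square_pos[OF assms(2)] one_minus_cnj_nonzero[OF assms] by simp
  then show ?thesis using power2_less_imp_less[of "pseudohyp a b" 1] by simp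
qed

lemma pseudohyp_nonneg: "0 \<le> pseudohyp a b" by (simp add: pseudohyp_def)

lemma pseudohyp_commute: "pseudohyp a b = pseudohyp b a"
proof -
  have "cmod (1 - cnj a * b) = cmod (cnj (1 - cnj a * b))" by (simp only: complex_mod_cnj)
  then show ?thesis by (simp add: pseudohyp_def norm_divide norm_minus_commute mult.commute)
qed

text \<open>By \<open>pseudohyp_square\<close>, for fixed moduli the distance grows with
  \<open>cmod (1 - cnj a * b)\<close>, and that factor is at most
  \<open>1 + cmod a * cmod b\<close>. The extreme case has 0 between the two points.\<close>

lemma pseudohyp_le:
  assumes "cmod a < 1" "cmod b < 1"
  shows "pseudohyp a b \<le> (cmod a + cmod b) / (1 + cmod a * cmod b)"
proof -
  define x y where "x = cmod a" and "y = cmod b"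
  have xy: "0 \<le> x" "x < 1" "0 \<le> y" "y < 1" using assms by (auto simp: x_def y_def)
  have D: "0 < 1 + x * y" using xy by (simp add: add_pos_nonneg)
  have "cmod (1 - cnj a * b) \<le> 1 + x * y"
    using norm_triangle_ineq4[of 1 "cnj a * b"] by (simp add: norm_mult x_def y_def)
  then have le: "(cmod (1 - cnj a * b))\<^sup>2 \<le> (1 + x * y)\<^sup>2" by (intro power_mono) auto
  have "1 - ((x + y) / (1 + x * y))\<^sup>2 = ((1 + x * y)\<^sup>2 - (x + y)\<^sup>2) / (1 + x * y)\<^sup>2"
    using D by (simp add: power_divide diff_divide_distrib)
  also have "(1 + x * y)\<^sup>2 - (x + y)\<^sup>2 = (1 - x\<^sup>2) * (1 - y\<^sup>2)" by (simp add: power2_eq_square algebra_simps)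
  also have "(1 - x\<^sup>2) * (1 - y\<^sup>2) / (1 + x * y)\<^sup>2 \<le> (1 - x\<^sup>2) * (1 - y\<^sup>2) / (cmod (1 - cnj a * b))\<^sup>2"
    using le one_minus_cnj_nonzero[OF assms] one_minus_square_pos[OF assms(1)] one_minus_square_pos[OF assms(2)] D
    by (intro divide_left_mono) (auto simp: x_def y_def)
  also have "\<dots> = 1 - (pseudohyp a b)\<^sup>2" by (simp add: pseudohyp_square[OF assms] x_def y_def)
  finally have "(pseudohyp a b)\<^sup>2 \<le> ((x + y) / (1 + x * y))\<^sup>2" by simp
  then show ?thesis unfolding x_def[symmetric] y_def[symmetric] by (rule power2_le_imp_le) (use xy D in simp)
qed

text \<open>The disc automorphism that moves \<open>c\<close> to 0, where the bound
  \<open>pseudohyp_le\<close> becomes the triangle inequality.\<close>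

definition disc_aut :: "complex \<Rightarrow> complex \<Rightarrow> complex" where "disc_aut c z = (z - c) / (1 - cnj c * z)"

lemma cmod_disc_aut: "cmod (disc_aut c z) = pseudohyp c z"
  by (simp add: disc_aut_def pseudohyp_def norm_divide norm_minus_commute)

lemma pseudohyp_disc_aut:
  assumes c: "cmod c < 1" and a: "cmod a < 1" and b: "cmod b < 1"
  shows "pseudohyp (disc_aut c a) (disc_aut c b) = pseudohyp a b"
proof -
  define A B where "A = 1 - cnj c * a" and "B = 1 - cnj c * b"
  have AB: "A \<noteq> 0" "B \<noteq> 0" using one_minus_cnj_nonzero[OF c a] one_minus_cnj_nonzero[OF c b] by (auto simp: A_def B_def)
  then have nz: "A \<noteq> 0" "B \<noteq> 0" "cnj A \<noteq> 0" by simp_all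
  define k where "k = 1 - cnj c * c"
  have k: "k \<noteq> 0" using one_minus_cnj_nonzero[OF c c] by (simp add: k_def)
  have cnj_aut: "cnj (disc_aut c a) = (cnj a - cnj c) / cnj A" by (simp add: disc_aut_def A_def)
  have auts: "disc_aut c a = (a - c) / A" "disc_aut c b = (b - c) / B" by (simp_all add: disc_aut_def A_def B_def)
  have 1: "disc_aut c a - disc_aut c b = k * (a - b) / (A * B)"
  proof -
    have "disc_aut c a - disc_aut c b = ((a - c) * B - (b - c) * A) / (A * B)" unfolding auts using nz by (simp add: diff_frac_eq)
    also have "(a - c) * B - (b - c) * A = k * (a - b)" by (simp add: A_def B_def k_def algebra_simps)
    finally show ?thesis .
  qed
  have 2: "1 - cnj (disc_aut c a) * disc_aut c b = k * (1 - cnj a * b) / (cnj A * B)"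
  proof -
    have "1 - cnj (disc_aut c a) * disc_aut c b = (cnj A * B - (cnj a - cnj c) * (b - c)) / (cnj A * B)"
      unfolding cnj_aut auts(2) times_divide_times_eq using nz by (simp add: diff_divide_distrib[of "cnj A * B"])
    also have "cnj A * B - (cnj a - cnj c) * (b - c) = k * (1 - cnj a * b)" by (simp add: A_def B_def k_def algebra_simps)
    finally show ?thesis .
  qed
  have "cmod (cnj A) = cmod A" by (rule complex_mod_cnj)
  then show ?thesis unfolding pseudohyp_def 1 2 using nz k by (simp add: norm_divide norm_mult del: complex_cnj_zero_iff)
qed

lemma pseudohyp_triangle:
  assumes "cmod a < 1" "cmod b < 1" "cmod c < 1"
  shows "pseudohyp a b \<le> (pseudohyp a c + pseudohyp c b) / (1 + pseudohyp a c * pseudohyp c b)"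
  using pseudohyp_le[of "disc_aut c a" "disc_aut c b"] assms
  by (simp add: cmod_disc_aut pseudohyp_less_1 pseudohyp_disc_aut pseudohyp_commute[of a c])

lemma artanh_real_mono:
  assumes "0 \<le> x" "x \<le> y" "y < (1::real)" shows "artanh x \<le> artanh y"
proof -
  have "(1 + x) / (1 - x) \<le> (1 + y) / (1 - y)" using assms by (intro frac_le) auto
  moreover have "0 < (1 + x) / (1 - x)" using assms by simp
  ultimately show ?thesis unfolding artanh_def by (simp add: ln_mono)
qed

text \<open>The addition theorem: under \<open>artanh\<close> the right-hand side of
  \<open>pseudohyp_triangle\<close> becomes a sum.\<close>

lemma artanh_real_add:
  assumes "0 \<le> x" "x < 1" "0 \<le> y" "y < (1::real)"
  shows "artanh x + artanh y = artanh ((x + y) / (1 + x * y))"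
proof -
  have D: "1 + x * y > 0" using assms by (simp add: add_pos_nonneg)
  have E: "(1 - x) * (1 - y) > 0" using assms by simp
  have "(1 + (x + y) / (1 + x * y)) / (1 - (x + y) / (1 + x * y)) = ((1 + x * y) + (x + y)) / ((1 + x * y) - (x + y))"
  proof -
    have "1 + (x + y) / (1 + x * y) = ((1 + x * y) + (x + y)) / (1 + x * y)"
      "1 - (x + y) / (1 + x * y) = ((1 + x * y) - (x + y)) / (1 + x * y)"
      using D by (simp_all add: add_divide_distrib diff_divide_distrib)
    then show ?thesis using D by simp
  qed
  also have "\<dots> = ((1 + x) / (1 - x)) * ((1 + y) / (1 - y))" by (simp add: algebra_simps)
  finally have eq: "(1 + (x + y) / (1 + x * y)) / (1 - (x + y) / (1 + x * y)) = (1 + x) / (1 - x) * ((1 + y) / (1 - y))" .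
  have "ln ((1 + x) / (1 - x) * ((1 + y) / (1 - y))) = ln ((1 + x) / (1 - x)) + ln ((1 + y) / (1 - y))"
    by (rule ln_mult_pos) (use assms in simp_all)
  then show ?thesis unfolding artanh_def eq by simp
qed

lemma poincare_dist_pseudohyp: "poincare_dist a b = artanh (pseudohyp a b)"
  by (simp add: poincare_dist_def pseudohyp_def)

lemma poincare_dist_commute: "poincare_dist a b = poincare_dist b a"
  by (simp add: poincare_dist_pseudohyp pseudohyp_commute)

lemma poincare_dist_triangle:
  assumes "cmod a < 1" "cmod b < 1" "cmod c < 1"
  shows "poincare_dist a b \<le> poincare_dist a c + poincare_dist c b"
proof -
  define x y where "x = pseudohyp a c" and "y = pseudohyp c b"
  have xy: "0 \<le> x" "x < 1" "0 \<le> y" "y < 1"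
    using assms by (auto simp: x_def y_def pseudohyp_nonneg pseudohyp_less_1)
  have D: "1 + x * y > 0" using xy by (simp add: add_pos_nonneg)
  have "0 < (1 - x) * (1 - y)" using xy by simp
  then have "(x + y) / (1 + x * y) < 1" using D by (simp add: algebra_simps)
  then have "artanh (pseudohyp a b) \<le> artanh ((x + y) / (1 + x * y))"
    using pseudohyp_triangle[OF assms] by (intro artanh_real_mono) (auto simp: x_def y_def pseudohyp_nonneg)
  then show ?thesis unfolding poincare_dist_pseudohyp by (simp add: artanh_real_add[OF xy] x_def[symmetric] y_def[symmetric])
qed

text \<open>With \<open>v\<close> twice \<open>w - z\<close>, the unit disc of the line
  \<open>z + \<zeta> *s v\<close> stays in the ball and \<open>w\<close> sits at the parameter
  \<open>1/2\<close>. Schwarz's lemma, applied after the automorphism that moves \<open>f z\<close>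
  to 0, bounds the pseudohyperbolic distance by \<open>1/2\<close>.\<close>

lemma schwarz_pick_ball:
  fixes f :: "complex^'n \<Rightarrow> complex"
  assumes hol: "holomorphic_Cn f (ball z r)" and bd: "f ` ball z r \<subseteq> ball 0 1" and w: "norm (w - z) \<le> r / 2" and r: "r > 0"
  shows "poincare_dist (f z) (f w) \<le> artanh (1/2)"
proof -
  define c where "c = f z"
  have c: "cmod c < 1" using bd r by (force simp: c_def)
  define v where "v = (2 :: complex) *s (w - z)"
  have inb: "z + \<zeta> *s v \<in> ball z r" if "\<zeta> \<in> ball 0 1" for \<zeta>
  proof -
    have "cmod \<zeta> * norm v \<le> cmod \<zeta> * r" using w by (intro mult_left_mono) (simp_all only: v_def norm_vector_smult, simp_all)
    also have "\<dots> < 1 * r" using that r by (intro mult_strict_right_mono) auto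
    finally show ?thesis by (simp add: dist_norm norm_vector_smult)
  qed
  define g where "g \<zeta> = f (z + \<zeta> *s v)" for \<zeta>
  have holg: "g holomorphic_on ball 0 1" unfolding g_def by (rule holomorphic_on_slice[OF hol open_ball inb])
  have g1: "cmod (g \<zeta>) < 1" if "\<zeta> \<in> ball 0 1" for \<zeta> using bd inb[OF that] by (force simp: g_def)
  have "(\<lambda>\<zeta>. disc_aut c (g \<zeta>)) holomorphic_on ball 0 1"
    unfolding disc_aut_def using one_minus_cnj_nonzero[OF c g1] by (intro holomorphic_intros holg) auto
  moreover have "disc_aut c (g 0) = 0" by (simp add: disc_aut_def g_def c_def)
  moreover have "cmod (disc_aut c (g \<zeta>)) < 1" if "cmod \<zeta> < 1" for \<zeta>
    using pseudohyp_less_1[OF c g1] that by (simp add: cmod_disc_aut)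
  moreover have half: "cmod (1/2) = 1/2" using norm_divide[of "1::complex" 2] by simp
  ultimately have "cmod (disc_aut c (g (1/2))) \<le> cmod (1/2)" using Schwarz_Lemma(1)[of "\<lambda>\<zeta>. disc_aut c (g \<zeta>)" "1/2"] by simp
  moreover have "g (1/2) = f w" by (simp add: g_def v_def vector_smult_assoc)
  ultimately have "pseudohyp (f z) (f w) \<le> 1/2" using half by (simp only: cmod_disc_aut c_def)
  then show ?thesis unfolding poincare_dist_pseudohyp by (intro artanh_real_mono pseudohyp_nonneg) auto
qed

section \<open>Maps to the disc and the Caratheodory distance\<close>

definition disc_maps :: "(complex^'n) set \<Rightarrow> (complex^'n \<Rightarrow> complex) set" where
  "disc_maps G = {f. holomorphic_Cn f G \<and> f ` G \<subseteq> ball 0 1}"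

lemma disc_maps_less_1: "f \<in> disc_maps G \<Longrightarrow> z \<in> G \<Longrightarrow> cmod (f z) < 1"
  by (auto simp: disc_maps_def image_subset_iff)

lemma caratheodory_dist_Diff_hyperplane:
  assumes \<Omega>: "open \<Omega>" and S: "complex_hyperplane S" and xy: "x \<in> \<Omega> - S" "y \<in> \<Omega> - S"
  shows "caratheodory_dist (\<Omega> - S) x y = caratheodory_dist \<Omega> x y"
proof -
  have "(\<lambda>f. poincare_dist (f x) (f y)) ` disc_maps (\<Omega> - S) = (\<lambda>f. poincare_dist (f x) (f y)) ` disc_maps \<Omega>"
  proof (intro set_eqI iffI)
    fix p assume "p \<in> (\<lambda>f. poincare_dist (f x) (f y)) ` disc_maps (\<Omega> - S)"
    then obtain f where f: "holomorphic_Cn f (\<Omega> - S)" "f ` (\<Omega> - S) \<subseteq> ball 0 1" "p = poincare_dist (f x) (f y)"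
      by (auto simp: disc_maps_def)
    obtain F where "holomorphic_Cn F \<Omega>" "\<And>z. z \<in> \<Omega> - S \<Longrightarrow> F z = f z" "F ` \<Omega> \<subseteq> ball 0 1"
      by (rule bounded_extension[OF \<Omega> S f(1,2)]) (rule that)
    then show "p \<in> (\<lambda>f. poincare_dist (f x) (f y)) ` disc_maps \<Omega>"
      using f(3) xy by (intro image_eqI[of _ _ F]) (auto simp: disc_maps_def)
  next
    fix p assume "p \<in> (\<lambda>f. poincare_dist (f x) (f y)) ` disc_maps \<Omega>"
    then obtain f where f: "f \<in> disc_maps \<Omega>" "p = poincare_dist (f x) (f y)" by blast
    then have "f \<in> disc_maps (\<Omega> - S)" using holomorphic_Cn_subset[of f \<Omega> "\<Omega> - S"] by (auto simp: disc_maps_def)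
    then show "p \<in> (\<lambda>f. poincare_dist (f x) (f y)) ` disc_maps (\<Omega> - S)" using f(2) by blast
  qed
  then show ?thesis by (simp add: caratheodory_dist_def disc_maps_def)
qed

context
  fixes \<Omega> :: "(complex^'n) set"
  assumes \<Omega>: "open \<Omega>"
begin

lemma disc_maps_local_bound:
  assumes "x \<in> \<Omega>"
  obtains r where "r > 0" "ball x r \<subseteq> \<Omega>"
    "\<And>u v f. u \<in> ball x r \<Longrightarrow> v \<in> ball x r \<Longrightarrow> f \<in> disc_maps \<Omega> \<Longrightarrow> poincare_dist (f u) (f v) \<le> artanh (1/2)"
proof -
  obtain R where R: "R > 0" "ball x R \<subseteq> \<Omega>" using \<Omega> assms open_contains_ball by blast
  \<comment> \<open>\<open>ball u (4 * r)\<close> stays within \<open>5 * r < R\<close> of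
    \<open>x\<close>, and \<open>v\<close> is within \<open>2 * r\<close> of \<open>u\<close>, half
    of that ball's radius.\<close>
  define r where "r = R / 8"
  have r: "r > 0" "8 * r = R" using R by (auto simp: r_def)
  have sub8: "ball x r \<subseteq> \<Omega>" using R r by (auto simp: subset_iff)
  show thesis
  proof (rule that[OF r(1) sub8])
    fix u v f assume uv: "u \<in> ball x r" "v \<in> ball x r" and f: "f \<in> disc_maps \<Omega>"
    have sub: "ball u (4 * r) \<subseteq> \<Omega>"
    proof
      fix p assume "p \<in> ball u (4 * r)"
      then have "dist x p < R" using uv(1) dist_triangle[of x p u] r by simp
      then show "p \<in> \<Omega>" using R(2) by auto
    qed
    show "poincare_dist (f u) (f v) \<le> artanh (1/2)"
    proof (rule schwarz_pick_ball)
      show "holomorphic_Cn f (ball u (4 * r))" using f sub holomorphic_Cn_subset by (auto simp: disc_maps_def)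
      show "f ` ball u (4 * r) \<subseteq> ball 0 1" using f sub by (auto simp: disc_maps_def)
      have "dist v u < 2 * r" using uv dist_triangle3[of v u x] by simp
      then show "norm (v - u) \<le> 4 * r / 2" by (simp add: dist_norm)
      show "0 < 4 * r" using r by simp
    qed
  qed
qed

text \<open>A real supremum is meaningful only for bounded sets. Boundedness over all disc maps is
  transitive by the triangle inequality and holds locally by \<open>disc_maps_local_bound\<close>,
  so connectedness spreads it over \<Omega>.\<close>

lemma caratheodory_bdd_above:
  assumes "connected \<Omega>" "x \<in> \<Omega>" "y \<in> \<Omega>"
  shows "bdd_above ((\<lambda>f. poincare_dist (f x) (f y)) ` disc_maps \<Omega>)"
proof (rule connected_equivalence_relation[OF assms, where R="\<lambda>x y. bdd_above ((\<lambda>f. poincare_dist (f x) (f y)) ` disc_maps \<Omega>)"])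
  show "bdd_above ((\<lambda>f. poincare_dist (f y) (f x)) ` disc_maps \<Omega>)"
    if "bdd_above ((\<lambda>f. poincare_dist (f x) (f y)) ` disc_maps \<Omega>)" for x y
    using that by (simp only: poincare_dist_commute)
  show "bdd_above ((\<lambda>f. poincare_dist (f x) (f z)) ` disc_maps \<Omega>)"
    if b: "bdd_above ((\<lambda>f. poincare_dist (f x) (f y)) ` disc_maps \<Omega>)" "bdd_above ((\<lambda>f. poincare_dist (f y) (f z)) ` disc_maps \<Omega>)"
      and X: "x \<in> \<Omega>" "y \<in> \<Omega>" "z \<in> \<Omega>" for x y z
  proof -
    obtain M N where "\<And>f. f \<in> disc_maps \<Omega> \<Longrightarrow> poincare_dist (f x) (f y) \<le> M" "\<And>f. f \<in> disc_maps \<Omega> \<Longrightarrow> poincare_dist (f y) (f z) \<le> N"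
      using b unfolding bdd_above_def by fast
    moreover have "poincare_dist (f x) (f z) \<le> poincare_dist (f x) (f y) + poincare_dist (f y) (f z)" if "f \<in> disc_maps \<Omega>" for f
      using disc_maps_less_1[OF that] X by (intro poincare_dist_triangle) auto
    ultimately show ?thesis by (intro bdd_aboveI2[where M="M + N"]) (meson add_mono order_trans)
  qed
  show "\<exists>T. openin (top_of_set \<Omega>) T \<and> a \<in> T \<and> (\<forall>x\<in>T. bdd_above ((\<lambda>f. poincare_dist (f a) (f x)) ` disc_maps \<Omega>))" if a: "a \<in> \<Omega>" for a
  proof -
    obtain r where r: "r > 0" "ball a r \<subseteq> \<Omega>"
      "\<And>u v f. u \<in> ball a r \<Longrightarrow> v \<in> ball a r \<Longrightarrow> f \<in> disc_maps \<Omega> \<Longrightarrow> poincare_dist (f u) (f v) \<le> artanh (1/2)"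
      by (rule disc_maps_local_bound[OF a]) blast
    show ?thesis
    proof (intro exI[of _ "ball a r"] conjI ballI)
      show "openin (top_of_set \<Omega>) (ball a r)" using r(2) by (intro open_subset) auto
      show "a \<in> ball a r" using r(1) by simp
      fix x assume "x \<in> ball a r"
      then show "bdd_above ((\<lambda>f. poincare_dist (f a) (f x)) ` disc_maps \<Omega>)"
        using r(1,3) by (intro bdd_aboveI2[where M="artanh (1/2)"]) auto
    qed
  qed
qed

lemma disc_maps_nonempty: "disc_maps \<Omega> \<noteq> {}"
proof -
  have "(\<lambda>z. 0) \<in> disc_maps \<Omega>" by (auto simp: disc_maps_def)
  then show ?thesis by blast
qed

lemma caratheodory_dist_eq: "caratheodory_dist \<Omega> x y = (SUP f\<in>disc_maps \<Omega>. poincare_dist (f x) (f y))"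
  by (simp add: caratheodory_dist_def disc_maps_def)

lemma caratheodory_dist_triangle:
  assumes "connected \<Omega>" and X: "x \<in> \<Omega>" "y \<in> \<Omega>" "z \<in> \<Omega>"
  shows "caratheodory_dist \<Omega> x z \<le> caratheodory_dist \<Omega> x y + caratheodory_dist \<Omega> y z"
  unfolding caratheodory_dist_eq
proof (rule cSUP_least[OF disc_maps_nonempty])
  fix f assume f: "f \<in> disc_maps \<Omega>"
  have "poincare_dist (f x) (f z) \<le> poincare_dist (f x) (f y) + poincare_dist (f y) (f z)"
    using disc_maps_less_1[OF f] X by (intro poincare_dist_triangle) auto
  also have "\<dots> \<le> (SUP f\<in>disc_maps \<Omega>. poincare_dist (f x) (f y)) + (SUP f\<in>disc_maps \<Omega>. poincare_dist (f y) (f z))"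
    by (intro add_mono cSUP_upper f caratheodory_bdd_above assms)
  finally show "poincare_dist (f x) (f z) \<le> (SUP f\<in>disc_maps \<Omega>. poincare_dist (f x) (f y)) + (SUP f\<in>disc_maps \<Omega>. poincare_dist (f y) (f z))" .
qed

end

lemma caratheodory_hyperbolic_iff:
  fixes \<Omega> S :: "(complex^'n) set"
  assumes \<Omega>: "open \<Omega>" "connected \<Omega>" and S: "complex_hyperplane S"
  shows "gromov_hyperbolic \<Omega> (caratheodory_dist \<Omega>) \<longleftrightarrow>
    gromov_hyperbolic (\<Omega> - S) (caratheodory_dist (\<Omega> - S))"
proof -
  have cong: "gromov_hyperbolic (\<Omega> - S) (caratheodory_dist (\<Omega> - S)) \<longleftrightarrow> gromov_hyperbolic (\<Omega> - S) (caratheodory_dist \<Omega>)"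
    by (rule gromov_hyperbolic_cong) (rule caratheodory_dist_Diff_hyperplane[OF \<Omega>(1) S])
  \<comment> \<open>\<open>artanh (1/2)\<close> is the bound from \<open>schwarz_pick_ball\<close>
    and is the same for all \<open>x\<close>, while the radius depends on \<open>x\<close>.\<close>
  have near: "\<exists>x'\<in>\<Omega> - S. caratheodory_dist \<Omega> x x' \<le> artanh (1/2) \<and> caratheodory_dist \<Omega> x' x \<le> artanh (1/2)"
    if x: "x \<in> \<Omega>" for x
  proof -
    obtain r where r: "r > 0" "ball x r \<subseteq> \<Omega>"
      "\<And>u v f. u \<in> ball x r \<Longrightarrow> v \<in> ball x r \<Longrightarrow> f \<in> disc_maps \<Omega> \<Longrightarrow> poincare_dist (f u) (f v) \<le> artanh (1/2)"
      by (rule disc_maps_local_bound[OF \<Omega>(1) x]) blast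
    have le: "caratheodory_dist \<Omega> u v \<le> artanh (1/2)" if "u \<in> ball x r" "v \<in> ball x r" for u v
      unfolding caratheodory_dist_eq[OF \<Omega>(1)] by (rule cSUP_least[OF disc_maps_nonempty[OF \<Omega>(1)] r(3)[OF that]])
    obtain x' where "x' \<in> \<Omega> - S" "x' \<in> ball x r" by (rule hyperplane_complement_dense[OF \<Omega>(1) S x r(1)])
    then show ?thesis using le r(1) by (intro bexI[of _ x']) auto
  qed
  show ?thesis unfolding cong
    by (rule gromov_hyperbolic_dense[OF Diff_subset caratheodory_dist_triangle[OF \<Omega>] near])
qed

theorem proposition1p6:
  fixes \<Omega> S :: "(complex^'n) set"
  assumes "domain_in_Cn \<Omega>" and "bounded \<Omega>"
    and "complex_hyperplane S" and "\<Omega> \<inter> S \<noteq> {}"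
  shows "(gromov_hyperbolic \<Omega> (bergman_dist \<Omega>) \<longleftrightarrow>
            gromov_hyperbolic (\<Omega> - S) (bergman_dist (\<Omega> - S))) \<and>
         (gromov_hyperbolic \<Omega> (caratheodory_dist \<Omega>) \<longleftrightarrow>
            gromov_hyperbolic (\<Omega> - S) (caratheodory_dist (\<Omega> - S)))"
  using assms bergman_hyperbolic_iff caratheodory_hyperbolic_iff unfolding domain_in_Cn_def by blast

end
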